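(* Let $0<h_0<\dots<h_K$ with $h_l=b\,h_{l-1}$ for $1\le l\le K$, fix $k\in\{1,\dots,K\}$ and set $r=h_{k-1}$. Suppose Assumptions A($h_{k-1},h_{k-1}$) (see context) hold with a constant density $f$ on $\mathcal M$, and let $X_1,\dots,X_n$ be i.i.d. with distribution $\mathbb P$. Assume that the AWC algorithm did not detect any gaps in the previous step, i.e. the test statistic $T^{(k)}_{ij}$ is computed from the weights $w^{(k-1)}_{lm}=\mathbf 1(\|X_l-X_m\|\le h_{k-1})$. Then for every $C>0$ (i.e. choosing the threshold $\lambda=C\log n$) and all indices $i\neq j$, $$\mathbb P^{\otimes n}\left(T^{(k)}_{ij}>C\log n\ \middle|\ \|X_i-X_j\|\le h_k\right)\le 2n^{-C}.$$
   Context: $\|\cdot\|$ is the Euclidean norm on $\mathbb R^D$ and $B(x,\rho)$ the closed Euclidean ball. For $S\subset\mathbb R^D$ and $\epsilon>0$ let $S^\epsilon=\{y:\exists x\in S,\ \|x-y\|\le\epsilon\}$ and $\operatorname{reach}(S)=\sup\{\rho\ge0:\text{every }y\in S^\rho\text{ has a unique nearest point in }S\}$. Assumptions A($r_0,r_1$): (i) $\mathbb P$ is the distribution of a random variable $X+\xi$, where $X$ has a density $f$ on $\mathcal M$ (with respect to the Riemannian volume measure of $\mathcal M$) and $\|\xi\|\le r_\xi$; (ii) $\mathcal M$ is a connected compact $d$-dimensional $C^2$ submanifold of $\mathbb R^D$ without boundary; (iii) $\operatorname{reach}(\mathcal M)\ge 1/\kappa$ with $\kappa>0$; (iv) $r_\xi\le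 \frac{r_0}{\max\{20,5d\}}$; (v) $r_1\le\frac{1}{\max\{120,\sqrt{720d}\}\,\kappa}$; (vi) $1<b\le\frac{b'}{(1+360\kappa^2r_1^2)(1+5r_\xi/r_0)}$ for some $b'<2$. Volume coefficient: for $0\le s<2$, $q_d(s)=\left(2\frac{\mathcal B(\frac{d+1}{2},\frac12)}{\mathcal B(1-\frac{s^2}{4},\frac{d+1}{2},\frac12)}-1\right)^{-1}$, where $\mathcal B(x,a,c)=\int_0^x t^{a-1}(1-t)^{c-1}dt$ and $\mathcal B(a,c)=\mathcal B(1,a,c)$. It equals the ratio of the Lebesgue volumes of the intersection and the union of two $d$-dimensional balls of equal radius $r$ with centers at distance $sr$. Adjusted volume coefficient: $\mathfrak q^{(k)}_{ij}=(1+\varepsilon_{\mathcal M})^{-1}(1+\varepsilon_\xi)^{-1}q_d\left(\frac{\|X_i-X_j\|}{h_{k-1}}\right)$ with, for $r=h_{k-1}$, $$\varepsilon_{\mathcal M}=\frac{9600(d+1)\kappa^2r^2}{\left(1-(b'/2)^2\right)^{(d+1)/2}},\qquad \varepsilon_\xi=\frac{80(d+1)\,r_\xi/r}{\left(1-(b'/2)^2\right)^{(d+1)/2}}.$$ Test statistic: given weights $w^{(k-1)}_{lm}\in\{0,1\}$, let $\mathcal C_i^{(k-1)}=\{X_m:w^{(k-1)}_{im}=1\}$, $N_{i\lor j}^{(k)}=\sum_{l\ne i,j}\mathbf 1(X_l\in\mathcal C_i^{(k-1)}\cup\mathcal C_j^{(k-1)})$, $\widetilde\theta_{ij}^{(k)}=\frac{1}{N_{i\lor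 j}^{(k)}}\sum_{l\neq i,j}\mathbf 1(X_l\in\mathcal C_i^{(k-1)}\cap\mathcal C_j^{(k-1)})$, and $$T_{ij}^{(k)}=N_{i\lor j}^{(k)}\,\mathcal K(\widetilde\theta_{ij}^{(k)},\mathfrak q_{ij}^{(k)})\left\{\mathbf 1(\widetilde\theta_{ij}^{(k)}<\mathfrak q_{ij}^{(k)})-\mathbf 1(\widetilde\theta_{ij}^{(k)}\ge\mathfrak q_{ij}^{(k)})\right\},$$ where $\mathcal K(\alpha,\beta)=\alpha\log\frac\alpha\beta+(1-\alpha)\log\frac{1-\alpha}{1-\beta}$ (with $0\log0=0$), and $T^{(k)}_{ij}=0$ if $N^{(k)}_{i\lor j}=0$. *)

theory Defs
  imports "HOL-Probability.Probability"
begin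

section \<open>Reach\<close>

definition closed_tube :: "'a::euclidean_space set \<Rightarrow> real \<Rightarrow> 'a set" where
  "closed_tube S \<epsilon> = {y. \<exists>x\<in>S. norm (x - y) \<le> \<epsilon>}"

text \<open>The reach is extended-real valued, since the supremum may be infinite.\<close>

definition reach :: "'a::euclidean_space set \<Rightarrow> ereal" where
  "reach S = (SUP \<rho>\<in>{\<rho>. 0 \<le> \<rho> \<and>
     (\<forall>y\<in>closed_tube S \<rho>. \<exists>!x. x \<in> S \<and> (\<forall>z\<in>S. norm (y - x) \<le> norm (y - z)))}. ereal \<rho>)"


section \<open>Embedded submanifolds of class C2 and their Riemannian volume\<close>

definition C2_on :: "'e::euclidean_space set \<Rightarrow> ('e \<Rightarrow> 'a::euclidean_space) \<Rightarrow> bool" where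
  "C2_on U \<phi> \<longleftrightarrow>
     (\<exists>(\<phi>' :: 'e \<Rightarrow> 'e \<Rightarrow>\<^sub>L 'a) (\<phi>'' :: 'e \<Rightarrow> 'e \<Rightarrow>\<^sub>L ('e \<Rightarrow>\<^sub>L 'a)).
        (\<forall>u\<in>U. (\<phi> has_derivative blinfun_apply (\<phi>' u)) (at u)) \<and>
        (\<forall>u\<in>U. (\<phi>' has_derivative blinfun_apply (\<phi>'' u)) (at u)) \<and>
        continuous_on U \<phi>'')"

definition local_parametrization ::
  "'a::euclidean_space set \<Rightarrow> (real ^ 'd::finite) set \<Rightarrow> (real ^ 'd \<Rightarrow> 'a) \<Rightarrow> bool" where
  "local_parametrization M U \<phi> \<longleftrightarrow>
     open U \<and> C2_on U \<phi> \<and> (\<forall>u\<in>U. inj (frechet_derivative \<phi> (at u))) \<and>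
     (\<exists>\<psi>. homeomorphism U (\<phi> ` U) \<phi> \<psi>) \<and> openin (top_of_set M) (\<phi> ` U)"

text \<open>The dimension is \<open>CARD('d)\<close>. All parameter domains are open in the full space
  \<open>real ^ 'd\<close>, so there is no boundary.\<close>

definition C2_submanifold :: "'d::finite itself \<Rightarrow> 'a::euclidean_space set \<Rightarrow> bool" where
  "C2_submanifold _ M \<longleftrightarrow>
     (\<forall>p\<in>M. \<exists>U (\<phi> :: real ^ 'd \<Rightarrow> 'a). local_parametrization M U \<phi> \<and> p \<in> \<phi> ` U)"

text \<open>The matrix of the metric induced by the ambient inner product, in the coordinates given
  by \<open>\<phi>\<close>.\<close>

definition metric_matrix :: "(real ^ 'd::finite \<Rightarrow> 'a::euclidean_space) \<Rightarrow> real ^ 'd \<Rightarrow> real ^ 'd ^ 'd" where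
  "metric_matrix \<phi> u =
     (\<chi> i j. frechet_derivative \<phi> (at u) (axis i 1) \<bullet> frechet_derivative \<phi> (at u) (axis j 1))"

text \<open>The Riemannian volume measure of a compact submanifold \<open>M\<close>, as a Borel measure on the
  ambient space that does not charge the complement of \<open>M\<close>: in every local parametrization it has
  Lebesgue density \<open>sqrt (det g)\<close>. As \<open>M\<close> is covered by finitely many parametrizations,
  this determines the measure \<open>V\<close> uniquely.\<close>

definition riemannian_volume ::
  "'d::finite itself \<Rightarrow> 'a::euclidean_space set \<Rightarrow> 'a measure \<Rightarrow> bool" where
  "riemannian_volume _ M V \<longleftrightarrow>
     sets V = sets borel \<and> emeasure V (- M) = 0 \<and>
     (\<forall>U (\<phi> :: real ^ 'd \<Rightarrow> 'a). local_parametrization M U \<phi> \<longrightarrow>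
        (\<forall>B\<in>sets borel. emeasure V (B \<inter> \<phi> ` U) =
           (\<integral>\<^sup>+u\<in>{u\<in>U. \<phi> u \<in> B}. ennreal (sqrt (det (metric_matrix \<phi> u))) \<partial>lborel)))"


section \<open>The model\<close>

text \<open>Assumptions \<open>A(r0, r1)\<close>. The observation is \<open>X + \<xi>\<close>, with \<open>X\<close> and \<open>\<xi>\<close> defined on the
  probability space \<open>\<Omega>\<close> and not assumed independent; \<open>f\<close> is the density of \<open>X\<close> with
  respect to the Riemannian volume \<open>V\<close> of \<open>M\<close>.\<close>

definition assumptions_A ::
  "'d::finite itself \<Rightarrow> 'w measure \<Rightarrow> ('w \<Rightarrow> 'a::euclidean_space) \<Rightarrow> ('w \<Rightarrow> 'a) \<Rightarrow> 'a measure \<Rightarrow>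
   'a set \<Rightarrow> 'a measure \<Rightarrow> ('a \<Rightarrow> real) \<Rightarrow> real \<Rightarrow> real \<Rightarrow> real \<Rightarrow> real \<Rightarrow> real \<Rightarrow> real \<Rightarrow> bool" where
  "assumptions_A _ \<Omega> X \<xi> P M V f \<kappa> r\<xi> b b' r0 r1 \<longleftrightarrow>
     prob_space \<Omega> \<and> X \<in> borel_measurable \<Omega> \<and> \<xi> \<in> borel_measurable \<Omega> \<and>
     P = distr \<Omega> borel (\<lambda>\<omega>. X \<omega> + \<xi> \<omega>) \<and>
     riemannian_volume TYPE('d) M V \<and>
     (\<forall>x\<in>M. 0 \<le> f x) \<and> distributed \<Omega> V X (\<lambda>x. ennreal (f x)) \<and>
     (AE \<omega> in \<Omega>. norm (\<xi> \<omega>) \<le> r\<xi>) \<and>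
     connected M \<and> compact M \<and> C2_submanifold TYPE('d) M \<and>
     0 < \<kappa> \<and> ereal (1 / \<kappa>) \<le> reach M \<and>
     r\<xi> \<le> r0 / max 20 (5 * real CARD('d)) \<and>
     r1 \<le> 1 / (max 120 (sqrt (720 * real CARD('d))) * \<kappa>) \<and>
     b' < 2 \<and> 1 < b \<and> b \<le> b' / ((1 + 360 * \<kappa>\<^sup>2 * r1\<^sup>2) * (1 + 5 * r\<xi> / r0))"


section \<open>Volume coefficients\<close>

text \<open>The complete Beta function is the value at \<open>x = 1\<close>.\<close>

definition inc_Beta :: "real \<Rightarrow> real \<Rightarrow> real \<Rightarrow> real" where
  "inc_Beta x a c = integral {0..x} (\<lambda>t. t powr (a - 1) * (1 - t) powr (c - 1))"

definition vol_coeff :: "nat \<Rightarrow> real \<Rightarrow> real" where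
  "vol_coeff d s =
     inverse (2 * (inc_Beta 1 ((real d + 1) / 2) (1 / 2) /
                   inc_Beta (1 - s\<^sup>2 / 4) ((real d + 1) / 2) (1 / 2)) - 1)"

definition eps_M :: "nat \<Rightarrow> real \<Rightarrow> real \<Rightarrow> real \<Rightarrow> real" where
  "eps_M d \<kappa> b' r =
     9600 * (real d + 1) * \<kappa>\<^sup>2 * r\<^sup>2 / (1 - (b' / 2)\<^sup>2) powr ((real d + 1) / 2)"

definition eps_xi :: "nat \<Rightarrow> real \<Rightarrow> real \<Rightarrow> real \<Rightarrow> real" where
  "eps_xi d r\<xi> b' r =
     80 * (real d + 1) * (r\<xi> / r) / (1 - (b' / 2)\<^sup>2) powr ((real d + 1) / 2)"

definition adj_vol_coeff :: "nat \<Rightarrow> real \<Rightarrow> real \<Rightarrow> real \<Rightarrow> real \<Rightarrow> real \<Rightarrow> real" where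
  "adj_vol_coeff d \<kappa> r\<xi> b' r s =
     inverse (1 + eps_M d \<kappa> b' r) * inverse (1 + eps_xi d r\<xi> b' r) * vol_coeff d s"


section \<open>The test statistic\<close>

text \<open>A sample is a function \<open>x\<close> on the index set \<open>{1..n}\<close>; \<open>w\<close> are the 0-1 weights of the previous
  step.\<close>

definition cluster :: "nat \<Rightarrow> (nat \<Rightarrow> 'a) \<Rightarrow> (nat \<Rightarrow> nat \<Rightarrow> nat) \<Rightarrow> nat \<Rightarrow> 'a set" where
  "cluster n x w i = {x m | m. m \<in> {1..n} \<and> w i m = 1}"

definition N_union :: "nat \<Rightarrow> (nat \<Rightarrow> 'a) \<Rightarrow> (nat \<Rightarrow> nat \<Rightarrow> nat) \<Rightarrow> nat \<Rightarrow> nat \<Rightarrow> real" where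
  "N_union n x w i j =
     (\<Sum>l\<in>{1..n} - {i, j}. indicator (cluster n x w i \<union> cluster n x w j) (x l))"

definition theta :: "nat \<Rightarrow> (nat \<Rightarrow> 'a) \<Rightarrow> (nat \<Rightarrow> nat \<Rightarrow> nat) \<Rightarrow> nat \<Rightarrow> nat \<Rightarrow> real" where
  "theta n x w i j =
     1 / N_union n x w i j *
     (\<Sum>l\<in>{1..n} - {i, j}. indicator (cluster n x w i \<inter> cluster n x w j) (x l))"

text \<open>The convention \<open>0 log 0 = 0\<close> holds automatically, as \<open>0 * _ = 0\<close>.\<close>

definition KL_Bernoulli :: "real \<Rightarrow> real \<Rightarrow> real" where
  "KL_Bernoulli \<alpha> \<beta> = \<alpha> * ln (\<alpha> / \<beta>) + (1 - \<alpha>) * ln ((1 - \<alpha>) / (1 - \<beta>))"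

text \<open>The argument \<open>q\<close> is the value of the (adjusted) volume coefficient the gap coefficient is
  compared with.\<close>

definition test_stat ::
  "nat \<Rightarrow> (nat \<Rightarrow> 'a) \<Rightarrow> (nat \<Rightarrow> nat \<Rightarrow> nat) \<Rightarrow> real \<Rightarrow> nat \<Rightarrow> nat \<Rightarrow> real" where
  "test_stat n x w q i j =
     (if N_union n x w i j = 0 then 0
      else N_union n x w i j * KL_Bernoulli (theta n x w i j) q *
           (of_bool (theta n x w i j < q) - of_bool (theta n x w i j \<ge> q)))"

text \<open>The weights at scale \<open>h\<close> when no gap has been detected.\<close>

definition no_gap_weights :: "real \<Rightarrow> (nat \<Rightarrow> 'a::real_normed_vector) \<Rightarrow> nat \<Rightarrow> nat \<Rightarrow> nat" where
  "no_gap_weights h x l m = of_bool (norm (x l - x m) \<le> h)"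

text \<open>The statistic \<open>T\<close> of a step whose preceding scale is \<open>r\<close>, computed from the sample \<open>x\<close>.\<close>

definition awc_stat ::
  "nat \<Rightarrow> real \<Rightarrow> real \<Rightarrow> real \<Rightarrow> real \<Rightarrow> nat \<Rightarrow> (nat \<Rightarrow> 'a::euclidean_space) \<Rightarrow> nat \<Rightarrow> nat \<Rightarrow> real" where
  "awc_stat d \<kappa> r\<xi> b' r n x i j =
     test_stat n x (no_gap_weights r x)
       (adj_vol_coeff d \<kappa> r\<xi> b' r (norm (x i - x j) / r)) i j"

end

theory Submission
  imports Defs
begin

text \<open>Conditionally on \<open>X_i\<close>, \<open>X_j\<close> and on the set of indices falling into the union of the two balls
  of radius \<open>r\<close>, the number of points in the intersection is binomial, so a Chernoff bound applies as
  soon as the conditional success probability is at least the adjusted volume coefficient.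

  This is a volume comparison on \<open>M\<close>. A Brouwer fixed-point argument shows that every ball of radius
  \<open>1 / \<kappa>\<close> touching \<open>M\<close> meets it only at the touching point, hence a chord of length \<open>\<delta>\<close> deviates from the
  tangent space by at most \<open>\<kappa> \<delta>^2 / 2\<close>. Comparing chords at nearby points bounds the angle between tangent
  spaces infinitesimally, and chaining along the nearest-point projection of a segment bounds it
  globally. So the orthogonal projection to one tangent space is, near its base point, a bijection onto
  a neighbourhood that is almost isometric to second order in \<open>\<kappa> r\<close>, and change of variables reduces
  the comparison to lenses of Euclidean balls, whose volumes are incomplete Beta integrals.\<close>

section \<open>Touching balls, chords and the nearest-point map\<close>

section \<open>Sets of positive reach\<close>

text \<open>Reach speaks of nearest points, the volume measure of charts. They meet in the normal
  vectors, defined by a quadratic bound with an unspecified constant: a chart identifies that bound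
  with orthogonality to the differential, and the touching balls improve the constant to \<kappa> /
  2, so that constants of charts disappear from every global estimate. Angles are of order \<kappa>
  r, but lengths and volumes under projection lose only their squares, by Pythagoras. This produces
  300 (\<kappa> r)^2 and explains why 360 \<kappa>^2 r^2 in assumption (vi) has room for it. The
  distance ratio of two observations is distorted by noise and projection; it has to stay below b' <
  2, since the lens of two balls shrinks to nothing at ratio 2 and relative errors of its volume
  explode there. Hence the powers of 1 - (b'/2)^2 in the denominators of the two corrections. As
  \<open>X\<close> and \<open>\<xi>\<close> may be dependent, noise is treated by inclusions of
  events only: balls of radius r about observations are compared with balls of radius r + 2 r\<xi>
  and r - 2 r\<xi> about points of \<open>M\<close>. The constant density then cancels from the
  ratio.\<close>

definition nearest :: "'a::euclidean_space set \<Rightarrow> 'a \<Rightarrow> 'a \<Rightarrow> bool" where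
  "nearest M y x \<longleftrightarrow> x \<in> M \<and> (\<forall>z\<in>M. norm (y - x) \<le> norm (y - z))"

text \<open>A chart-free normal space. The constant may depend on \<nu>, and the bound is two-sided
  so that the set is a subspace. In a chart it turns out to be the orthogonal complement of the
  range of the differential.\<close>

definition normal_vectors :: "'a::euclidean_space set \<Rightarrow> 'a \<Rightarrow> 'a set" where
  "normal_vectors M p = {\<nu>. \<exists>C. \<forall>z\<in>M. \<bar>(z - p) \<bullet> \<nu>\<bar> \<le> C * (norm (z - p))\<^sup>2}"

lemma power2_norm_diff:
  fixes a b :: "'a::real_inner"
  shows "(norm (a - b))\<^sup>2 = (norm a)\<^sup>2 - 2 * (a \<bullet> b) + (norm b)\<^sup>2"
  by (simp only: power2_norm_eq_inner) (simp add: algebra_simps inner_commute)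

locale compact_reach =
  fixes M :: "'a::euclidean_space set" and \<kappa> :: real
  assumes compact_M: "compact M"
    and kappa_pos: "0 < \<kappa>"
    and reach_M: "ereal (1 / \<kappa>) \<le> reach M"
begin

text \<open>The supremum in the reach need not be attained, so the distance must lie strictly below
  1 / \<kappa>: then some admissible radius \<rho> exceeds it.\<close>

lemma nearest_unique:
  assumes "nearest M y x" "nearest M y x'" "norm (y - x) < 1 / \<kappa>"
  shows "x = x'"
proof -
  have "ereal (norm (y - x)) < reach M"
    using assms(3) reach_M by (metis ereal_less(2) less_ereal.simps(1) order_less_le_trans)
  then obtain \<rho> where \<rho>: "norm (y - x) < \<rho>"
     "\<forall>y\<in>closed_tube M \<rho>. \<exists>!x. x \<in> M \<and> (\<forall>z\<in>M. norm (y - x) \<le> norm (y - z))"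
    unfolding reach_def less_SUP_iff by auto
  have "y \<in> closed_tube M \<rho>"
    using \<rho>(1) assms(1) unfolding closed_tube_def nearest_def
    by (auto simp: norm_minus_commute intro!: bexI[of _ x])
  with \<rho>(2) assms(1,2) show ?thesis unfolding nearest_def by blast
qed

lemma nearest_exists:
  assumes "x0 \<in> M"
  obtains x where "nearest M y x"
proof -
  have "M \<noteq> {}" using assms by auto
  from distance_attains_inf[OF compact_imp_closed[OF compact_M] this, of y]
  obtain x where "x \<in> M" "\<And>z. z \<in> M \<Longrightarrow> dist y x \<le> dist y z" by blast
  then show ?thesis using that[of x] unfolding nearest_def dist_norm by auto
qed

text \<open>Brouwer is applied on the ball of radius \<open>s\<close> about \<open>c\<close> to the
  map sending \<open>y\<close> to the point of the bounding sphere in direction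
  \<open>y - \<xi> y\<close>. At a fixed point \<open>y\<close> the centre \<open>c\<close> lies
  between \<open>\<xi> y\<close> and \<open>y\<close>, so \<open>\<xi> y\<close> is nearest to
  \<open>c\<close> too and equals \<open>p\<close>; hence \<open>y\<close> is the point at distance
  \<open>t + s\<close> on the ray. The bound \<open>s \<le> t / 2\<close> keeps \<open>y\<close> at
  distance at least \<open>s\<close> from \<open>M\<close>, and \<open>t + s < 1 / \<kappa>\<close>
  keeps nearest points unique.\<close>

lemma nearest_extend_step:
  assumes near: "nearest M (p + t *\<^sub>R \<nu>) p" and nu: "norm \<nu> = 1"
    and t: "0 < t" "t < 1 / \<kappa>" and s: "0 < s" "s \<le> t / 2" "t + s < 1 / \<kappa>"
  shows "nearest M (p + (t + s) *\<^sub>R \<nu>) p"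
proof -
  define c where "c = p + t *\<^sub>R \<nu>"
  have pM: "p \<in> M" using near by (simp add: nearest_def)
  define \<xi> where "\<xi> y = (SOME x. nearest M y x)" for y
  have \<xi>: "nearest M y (\<xi> y)" for y
    unfolding \<xi>_def using nearest_exists[OF pM] by (metis someI)
  have cp: "norm (c - p) = t" using nu t by (simp add: c_def)
  have far: "t - s \<le> norm (y - \<xi> y)" and close: "norm (y - \<xi> y) < 1 / \<kappa>" if "y \<in> cball c s" for y
  proof -
    have d: "norm (c - y) \<le> s" using that by (simp add: dist_norm)
    have "t \<le> norm (c - \<xi> y)"
      using near \<xi>[of y] cp unfolding nearest_def c_def[symmetric] by auto
    then show "t - s \<le> norm (y - \<xi> y)"
      using d norm_triangle_ineq[of "c - y" "y - \<xi> y"] by simp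
    have "norm (y - \<xi> y) \<le> norm (y - p)" using \<xi>[of y] pM by (auto simp: nearest_def)
    also have "\<dots> \<le> t + s"
      using d cp norm_triangle_ineq[of "y - c" "c - p"] by (simp add: norm_minus_commute)
    finally show "norm (y - \<xi> y) < 1 / \<kappa>" using s by simp
  qed
  \<comment> \<open>By uniqueness the graph of \<open>\<xi>\<close> is cut out by closed conditions,
    and a closed graph over a compact target gives continuity.\<close>
  have cont: "continuous_on (cball c s) \<xi>"
  proof (rule continuous_from_closed_graph[OF compact_M])
    show "\<xi> \<in> cball c s \<rightarrow> M" using \<xi> by (auto simp: nearest_def)
    have "(\<lambda>y. (y, \<xi> y)) ` cball c s
        = (cball c s \<times> M) \<inter> (\<Inter>z\<in>M. {w. norm (fst w - snd w) \<le> norm (fst w - z)})" (is "?A = ?B")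
    proof
      show "?A \<subseteq> ?B" using \<xi> by (auto simp: nearest_def)
      show "?B \<subseteq> ?A"
      proof
        fix w assume w: "w \<in> ?B"
        then have "nearest M (fst w) (snd w)" "fst w \<in> cball c s" by (auto simp: nearest_def)
        then have "snd w = \<xi> (fst w)"
          using nearest_unique[OF \<xi> _ close] by metis
        then have "w = (fst w, \<xi> (fst w))" by (simp add: prod_eq_iff)
        then show "w \<in> ?A" using \<open>fst w \<in> cball c s\<close> by (rule image_eqI)
      qed
    qed
    moreover have "closed ?B"
      by (intro closed_Int closed_Times closed_INT ballI closed_Collect_le continuous_intros
          compact_imp_closed[OF compact_M]) auto
    ultimately show "closed ((\<lambda>y. (y, \<xi> y)) ` cball c s)" by simp
  qed
  define n where "n y = (1 / norm (y - \<xi> y)) *\<^sub>R (y - \<xi> y)" for y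
  have ne: "y - \<xi> y \<noteq> 0" if "y \<in> cball c s" for y using far[OF that] s t by auto
  have n1: "norm (n y) = 1" if "y \<in> cball c s" for y
    unfolding n_def using ne[OF that] by simp
  have contF: "continuous_on (cball c s) (\<lambda>y. c + s *\<^sub>R n y)"
    unfolding n_def using ne by (intro continuous_intros cont) auto
  have ball: "cball c s \<noteq> {}" "(\<lambda>y. c + s *\<^sub>R n y) \<in> cball c s \<rightarrow> cball c s"
    using n1 s by (auto simp: dist_norm)
  have "\<exists>y\<in>cball c s. c + s *\<^sub>R n y = y"
    using brouwer[OF compact_cball convex_cball ball(1) contF ball(2)] by metis
  then obtain y where y: "y \<in> cball c s" "y = c + s *\<^sub>R n y" by force
  define L where "L = norm (y - \<xi> y)"
  have L: "s \<le> L" using far[OF y(1)] s unfolding L_def by linarith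
  have yL: "y - \<xi> y = L *\<^sub>R n y" unfolding n_def L_def using ne[OF y(1)] by simp
  have c\<xi>: "c - \<xi> y = (L - s) *\<^sub>R n y"
  proof -
    have "c = y - s *\<^sub>R n y" using y(2) by (metis add_diff_cancel_right')
    then have "c - \<xi> y = (y - \<xi> y) - s *\<^sub>R n y" by simp
    then show ?thesis unfolding yL by (simp add: scaleR_left_diff_distrib)
  qed
  have "nearest M c (\<xi> y)" unfolding nearest_def
  proof (intro conjI ballI)
    show "\<xi> y \<in> M" using \<xi> by (simp add: nearest_def)
    fix z assume "z \<in> M"
    then have "L \<le> norm (y - z)" using \<xi>[of y] by (simp add: nearest_def L_def)
    also have "\<dots> \<le> norm (y - c) + norm (c - z)"
      using norm_triangle_ineq[of "y - c" "c - z"] by simp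
    also have "norm (y - c) \<le> s" using y(1) by (simp add: dist_norm norm_minus_commute)
    finally show "norm (c - \<xi> y) \<le> norm (c - z)" using c\<xi> n1[OF y(1)] L by simp
  qed
  then have \<xi>p: "\<xi> y = p"
    using nearest_unique[of c p "\<xi> y"] near cp t by (simp add: c_def)
  have eq: "(L - s) *\<^sub>R n y = t *\<^sub>R \<nu>" using c\<xi> \<xi>p by (simp add: c_def)
  then have "L - s = t" using n1[OF y(1)] nu L t
    by (metis abs_of_nonneg abs_of_pos diff_ge_0_iff_ge mult.right_neutral norm_scaleR)
  with eq t have "n y = \<nu>" by simp
  with \<xi>[of y] \<xi>p y(2) show ?thesis by (simp add: c_def algebra_simps)
qed

text \<open>Continuation along the ray: the admissible parameters contain their supremum, because
  nearness is a closed condition, and below 1 / \<kappa> the previous step would push that supremum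
  further.\<close>

lemma nearest_extend:
  assumes near: "nearest M (p + t0 *\<^sub>R \<nu>) p" and nu: "norm \<nu> = 1" and t0: "0 < t0"
    and t: "0 \<le> t" "t < 1 / \<kappa>"
  shows "nearest M (p + t *\<^sub>R \<nu>) p"
proof -
  define T where "T = {t. t0 \<le> t \<and> t < 1/\<kappa> \<and> nearest M (p + t *\<^sub>R \<nu>) p}"
  have down: "nearest M (p + t *\<^sub>R \<nu>) p" if "nearest M (p + u *\<^sub>R \<nu>) p" "0 \<le> t" "t \<le> u" for t u
    unfolding nearest_def
  proof (intro conjI ballI)
    show "p \<in> M" using that by (simp add: nearest_def)
    fix z assume "z \<in> M"
    then have "norm (u *\<^sub>R \<nu>) \<le> norm (p + u *\<^sub>R \<nu> - z)" using that by (auto simp: nearest_def)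
    also have "\<dots> = norm ((p + t *\<^sub>R \<nu> - z) + (u - t) *\<^sub>R \<nu>)" by (simp add: algebra_simps)
    also have "\<dots> \<le> norm (p + t *\<^sub>R \<nu> - z) + norm ((u - t) *\<^sub>R \<nu>)" by (rule norm_triangle_ineq)
    finally show "norm (p + t *\<^sub>R \<nu> - p) \<le> norm (p + t *\<^sub>R \<nu> - z)" using nu that by simp
  qed
  show ?thesis
  proof (rule ccontr)
    assume not: "\<not> ?thesis"
    have "t0 < t" using down[OF near t(1)] not by force
    have ub: "u \<le> t" if "u \<in> T" for u
      using down[of u t] not t that unfolding T_def by force
    have t0T: "t0 \<in> T" using near \<open>t0 < t\<close> t by (auto simp: T_def)
    define u where "u = Sup T"
    have bdd: "bdd_above T" using ub by (meson bdd_aboveI)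
    have u: "t0 \<le> u" "u \<le> t" unfolding u_def using t0T ub bdd
      by (auto intro: cSup_upper cSup_least)
    have "u \<in> T"
    proof -
      have "nearest M (p + u *\<^sub>R \<nu>) p" unfolding nearest_def
      proof (intro conjI ballI)
        show "p \<in> M" using near by (simp add: nearest_def)
        fix z assume z: "z \<in> M"
        show "norm (p + u *\<^sub>R \<nu> - p) \<le> norm (p + u *\<^sub>R \<nu> - z)"
        proof (rule ccontr)
          assume "\<not> ?thesis"
          then have less: "norm (p + u *\<^sub>R \<nu> - z) < u" using nu u t0 by simp
          define e where "e = (u - norm (p + u *\<^sub>R \<nu> - z)) / 2"
          have "e > 0" using less by (simp add: e_def)
          then obtain v where v: "v \<in> T" "u - e < v"
            unfolding u_def using t0T bdd less_cSup_iff[of T] by (metis diff_less_eq empty_iff less_add_same_cancel1)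
          have vu: "v \<le> u" unfolding u_def using v bdd by (simp add: cSup_upper)
          have "v \<le> norm (p + v *\<^sub>R \<nu> - z)"
            using v z nu t0 unfolding T_def nearest_def by force
          also have "\<dots> = norm ((p + u *\<^sub>R \<nu> - z) + (v - u) *\<^sub>R \<nu>)" by (simp add: algebra_simps)
          also have "\<dots> \<le> norm (p + u *\<^sub>R \<nu> - z) + norm ((v - u) *\<^sub>R \<nu>)" by (rule norm_triangle_ineq)
          also have "norm ((v - u) *\<^sub>R \<nu>) = u - v" using nu vu by simp
          finally show False using v(2) unfolding e_def by (simp add: field_simps)
        qed
      qed
      then show ?thesis using u t by (simp add: T_def)
    qed
    define R where "R = 1 / \<kappa>"
    \<comment> \<open>Half of the room left below 1 / \<kappa>, capped by \<open>u / 2\<close>: the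
      two side conditions of the extension step.\<close>
    define s where "s = min (u / 2) ((R - u) / 2)"
    have "u < R" using u t by (simp add: R_def)
    then have "0 < s" "s \<le> u / 2" "u + s < R"
      using u t0 unfolding s_def by (auto simp: min_def diff_divide_distrib)
    note s = this[unfolded R_def]
    have "nearest M (p + (u + s) *\<^sub>R \<nu>) p"
      using nearest_extend_step[of p u \<nu> s] \<open>u \<in> T\<close> nu u t t0 s unfolding T_def by auto
    then have "u + s \<in> T" using u s by (simp add: T_def)
    then have "u + s \<le> u" unfolding u_def by (intro cSup_upper bdd)
    then show False using s by simp
  qed
qed

text \<open>The open balls of radius \<open>1 / \<kappa>\<close> touching \<open>M\<close> at \<open>a\<close> contain no point of \<open>M\<close>.\<close>

lemma reach_inner_le:
  assumes near: "nearest M x a" and z: "z \<in> M"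
  shows "(z - a) \<bullet> (x - a) \<le> \<kappa> / 2 * (norm (z - a))\<^sup>2 * norm (x - a)"
proof (cases "x = a")
  case False
  define t0 where "t0 = norm (x - a)"
  define \<nu> where "\<nu> = (1 / t0) *\<^sub>R (x - a)"
  have t0: "t0 > 0" and nu: "norm \<nu> = 1" and x: "x - a = t0 *\<^sub>R \<nu>"
    using False by (auto simp: t0_def \<nu>_def)
  have x': "x = a + t0 *\<^sub>R \<nu>" using x by (simp add: algebra_simps)
  have bound: "2 * t * ((z - a) \<bullet> \<nu>) \<le> (norm (z - a))\<^sup>2" if "0 \<le> t" "t < 1 / \<kappa>" for t
  proof -
    have "nearest M (a + t *\<^sub>R \<nu>) a"
      using nearest_extend[of a t0 \<nu> t] near t0 nu that unfolding x' by simp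
    then have "(norm (t *\<^sub>R \<nu>))\<^sup>2 \<le> (norm (t *\<^sub>R \<nu> - (z - a)))\<^sup>2"
      using z unfolding nearest_def by (intro power_mono) (auto simp: algebra_simps)
    also have "\<dots> = (norm (t *\<^sub>R \<nu>))\<^sup>2 - 2 * t * ((z - a) \<bullet> \<nu>) + (norm (z - a))\<^sup>2"
      by (simp add: power2_norm_diff inner_commute)
    finally show ?thesis by simp
  qed
  \<comment> \<open>Touching balls are available for radii below 1 / \<kappa> only; the limiting
    radius is reached from the left.\<close>
  have "((\<lambda>t. 2 * t * ((z - a) \<bullet> \<nu>)) \<longlongrightarrow> 2 * (1 / \<kappa>) * ((z - a) \<bullet> \<nu>)) (at_left (1 / \<kappa>))"
    by (intro tendsto_intros)
  moreover have "\<forall>\<^sub>F t in at_left (1 / \<kappa>). 2 * t * ((z - a) \<bullet> \<nu>) \<le> (norm (z - a))\<^sup>2"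
    using kappa_pos bound by (auto simp: eventually_at_left_field intro!: exI[of _ 0])
  ultimately have "2 * (1 / \<kappa>) * ((z - a) \<bullet> \<nu>) \<le> (norm (z - a))\<^sup>2"
    by (rule tendsto_upperbound) simp
  then have "(z - a) \<bullet> \<nu> \<le> \<kappa> / 2 * (norm (z - a))\<^sup>2"
    using kappa_pos by (simp add: field_simps)
  then have "t0 * ((z - a) \<bullet> \<nu>) \<le> t0 * (\<kappa> / 2 * (norm (z - a))\<^sup>2)"
    using t0 by (intro mult_left_mono) auto
  then show ?thesis unfolding x norm_scaleR nu by (simp add: t0_def mult.commute mult.left_commute)
qed simp

text \<open>Any constant \<open>C\<close> improves to \<kappa> / 2. A step along the normal so short
  that \<open>2 * t * C \<le> 1\<close> still has \<open>p\<close> as nearest point, and then the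
  touching ball of radius 1 / \<kappa> takes over. Applying this to \<nu> and -\<nu> gives the
  absolute value.\<close>

lemma normal_vectors_inner_le:
  assumes p: "p \<in> M" and nu: "\<nu> \<in> normal_vectors M p" and z: "z \<in> M"
  shows "\<bar>(z - p) \<bullet> \<nu>\<bar> \<le> \<kappa> / 2 * (norm (z - p))\<^sup>2 * norm \<nu>"
proof -
  obtain C where C: "\<And>z. z \<in> M \<Longrightarrow> \<bar>(z - p) \<bullet> \<nu>\<bar> \<le> C * (norm (z - p))\<^sup>2"
    using nu by (auto simp: normal_vectors_def)
  define t where "t = 1 / (2 * (\<bar>C\<bar> + 1))"
  have t: "t > 0" "2 * t * C \<le> 1" by (auto simp: t_def field_simps)
  have *: "(z - p) \<bullet> \<mu> \<le> \<kappa> / 2 * (norm (z - p))\<^sup>2 * norm \<mu>"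
    if C: "\<And>z. z \<in> M \<Longrightarrow> (z - p) \<bullet> \<mu> \<le> C * (norm (z - p))\<^sup>2" for \<mu>
  proof -
    have "nearest M (p + t *\<^sub>R \<mu>) p" unfolding nearest_def
    proof (intro conjI ballI p)
      fix z assume z: "z \<in> M"
      have "2 * t * ((z - p) \<bullet> \<mu>) \<le> 2 * t * (C * (norm (z - p))\<^sup>2)"
        using C[OF z] t by (intro mult_left_mono) auto
      also have "\<dots> = 2 * t * C * (norm (z - p))\<^sup>2" by simp
      also have "\<dots> \<le> 1 * (norm (z - p))\<^sup>2"
        using t by (intro mult_right_mono) auto
      finally have "(norm (t *\<^sub>R \<mu>))\<^sup>2 \<le> (norm (t *\<^sub>R \<mu>))\<^sup>2 - 2 * t * ((z - p) \<bullet> \<mu>) + (norm (z - p))\<^sup>2" by simp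
      also have "\<dots> = (norm (t *\<^sub>R \<mu> - (z - p)))\<^sup>2"
        by (simp add: power2_norm_diff inner_commute)
      finally have "norm (t *\<^sub>R \<mu>) \<le> norm (t *\<^sub>R \<mu> - (z - p))"
        by (rule power2_le_imp_le) simp
      then show "norm (p + t *\<^sub>R \<mu> - p) \<le> norm (p + t *\<^sub>R \<mu> - z)" by (simp add: algebra_simps)
    qed
    from reach_inner_le[OF this z] t show ?thesis by (simp add: field_simps)
  qed
  have "(z - p) \<bullet> \<nu> \<le> \<kappa> / 2 * (norm (z - p))\<^sup>2 * norm \<nu>" using C by (intro *) force
  moreover have "(z - p) \<bullet> (- \<nu>) \<le> \<kappa> / 2 * (norm (z - p))\<^sup>2 * norm (- \<nu>)"
    using C by (intro *) force
  ultimately show ?thesis by auto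
qed

text \<open>Federer's Lipschitz bound for the nearest-point map. The square of
  \<open>norm (b - a)\<close> splits into the inner products with \<open>x - a\<close>,
  \<open>y - b\<close> and \<open>y - x\<close>; the touching balls at \<open>a\<close> and
  \<open>b\<close> bound the first two by \<kappa> t / 2 times that square each, which is absorbed
  on the left.\<close>

lemma nearest_lipschitz:
  assumes "nearest M x a" "nearest M y b" "norm (x - a) \<le> t" "norm (y - b) \<le> t"
  shows "(1 - \<kappa> * t) * norm (b - a) \<le> norm (y - x)"
proof (cases "a = b")
  case False
  have "(b - a) \<bullet> (x - a) \<le> \<kappa> / 2 * (norm (b - a))\<^sup>2 * norm (x - a)"
    using reach_inner_le[OF assms(1)] assms(2) by (auto simp: nearest_def)
  also have "\<dots> \<le> \<kappa> / 2 * (norm (b - a))\<^sup>2 * t"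
    using assms kappa_pos by (intro mult_left_mono) auto
  finally have 1: "(b - a) \<bullet> (x - a) \<le> \<kappa> / 2 * (norm (b - a))\<^sup>2 * t" .
  have "(a - b) \<bullet> (y - b) \<le> \<kappa> / 2 * (norm (a - b))\<^sup>2 * norm (y - b)"
    using reach_inner_le[OF assms(2)] assms(1) by (auto simp: nearest_def)
  also have "\<dots> \<le> \<kappa> / 2 * (norm (a - b))\<^sup>2 * t"
    using assms kappa_pos by (intro mult_left_mono) auto
  finally have 2: "(a - b) \<bullet> (y - b) \<le> \<kappa> / 2 * (norm (b - a))\<^sup>2 * t"
    by (simp add: norm_minus_commute)
  have "(norm (b - a))\<^sup>2 = (b - a) \<bullet> (x - a) + (a - b) \<bullet> (y - b) + (b - a) \<bullet> (y - x)"
    unfolding power2_norm_eq_inner by (simp add: algebra_simps inner_commute)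
  also have "\<dots> \<le> \<kappa> * t * (norm (b - a))\<^sup>2 + norm (b - a) * norm (y - x)"
    using 1 2 norm_cauchy_schwarz[of "b - a" "y - x"] by (simp add: field_simps)
  finally have "norm (b - a) * ((1 - \<kappa> * t) * norm (b - a)) \<le> norm (b - a) * norm (y - x)"
    by (simp add: algebra_simps power2_eq_square)
  then show ?thesis using False by simp
qed simp

end

section \<open>Tangent spaces and how fast they turn\<close>

section \<open>Normal and tangent vectors\<close>

definition tangent_space :: "'a::euclidean_space set \<Rightarrow> 'a \<Rightarrow> 'a set" where
  "tangent_space M p = (normal_vectors M p)\<^sup>\<bottom>"

text \<open>\<open>c\<close> bounds the sine of the largest angle between a vector of the tangent
  space at \<open>z\<close> and its projection to the one at \<open>p\<close>. The bilinear form
  makes chaining a matter of splitting one vector.\<close>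

definition angle_le :: "'a::euclidean_space set \<Rightarrow> 'a \<Rightarrow> 'a \<Rightarrow> real \<Rightarrow> bool" where
  "angle_le M z p c \<longleftrightarrow>
     (\<forall>w\<in>tangent_space M z. \<forall>\<nu>\<in>normal_vectors M p. \<bar>w \<bullet> \<nu>\<bar> \<le> c * norm w * norm \<nu>)"

lemma subspace_normal_vectors: "subspace (normal_vectors M p)"
proof (rule subspaceI)
  show "0 \<in> normal_vectors M p" by (auto simp: normal_vectors_def intro!: exI[of _ 0])
next
  fix a b assume "a \<in> normal_vectors M p" "b \<in> normal_vectors M p"
  then obtain C D where CD: "\<And>z. z \<in> M \<Longrightarrow> \<bar>(z - p) \<bullet> a\<bar> \<le> C * (norm (z - p))\<^sup>2"
      "\<And>z. z \<in> M \<Longrightarrow> \<bar>(z - p) \<bullet> b\<bar> \<le> D * (norm (z - p))\<^sup>2"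
    unfolding normal_vectors_def by blast
  have "\<bar>(z - p) \<bullet> (a + b)\<bar> \<le> (C + D) * (norm (z - p))\<^sup>2" if "z \<in> M" for z
    unfolding inner_add_right distrib_right using CD[OF that] abs_triangle_ineq[of "(z - p) \<bullet> a"] by fastforce
  then show "a + b \<in> normal_vectors M p" unfolding normal_vectors_def by blast
next
  fix c a assume "a \<in> normal_vectors M p"
  then obtain C where C: "\<And>z. z \<in> M \<Longrightarrow> \<bar>(z - p) \<bullet> a\<bar> \<le> C * (norm (z - p))\<^sup>2"
    unfolding normal_vectors_def by blast
  have "\<bar>(z - p) \<bullet> (c *\<^sub>R a)\<bar> \<le> (\<bar>c\<bar> * C) * (norm (z - p))\<^sup>2" if "z \<in> M" for z
    using mult_left_mono[OF C[OF that], of "\<bar>c\<bar>"] by (simp add: abs_mult mult.assoc)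
  then show "c *\<^sub>R a \<in> normal_vectors M p" unfolding normal_vectors_def by blast
qed

lemma subspace_tangent_space: "subspace (tangent_space M p)"
  unfolding tangent_space_def by (rule subspace_orthogonal_comp)

lemma orthogonal_comp_tangent_space: "(tangent_space M p)\<^sup>\<bottom> = normal_vectors M p"
  unfolding tangent_space_def by (rule orthogonal_comp_self[OF subspace_normal_vectors])

lemma tangent_normal_inner: "w \<in> tangent_space M p \<Longrightarrow> \<nu> \<in> normal_vectors M p \<Longrightarrow> w \<bullet> \<nu> = 0"
  by (auto simp: tangent_space_def orthogonal_comp_def orthogonal_def inner_commute)

lemma tangent_normal_decomp:
  obtains t n where "t \<in> tangent_space M p" "n \<in> normal_vectors M p" "x = t + n"
    "(norm x)\<^sup>2 = (norm t)\<^sup>2 + (norm n)\<^sup>2"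
proof -
  obtain t n where tn: "t \<in> span (tangent_space M p)"
      "\<And>w. w \<in> span (tangent_space M p) \<Longrightarrow> orthogonal n w" "x = t + n"
    using orthogonal_subspace_decomp_exists[of "tangent_space M p" x] by metis
  have t: "t \<in> tangent_space M p" using tn(1) by (simp only: span_eq_iff[THEN iffD2, OF subspace_tangent_space])
  have "n \<in> (tangent_space M p)\<^sup>\<bottom>"
    using tn(2) by (auto simp: orthogonal_comp_def orthogonal_commute span_base)
  then have n: "n \<in> normal_vectors M p" by (simp add: orthogonal_comp_tangent_space)
  have "(norm x)\<^sup>2 = (norm t)\<^sup>2 + (norm n)\<^sup>2"
    unfolding tn(3) power2_norm_eq_inner using tangent_normal_inner[OF t n]
    by (simp add: inner_add inner_commute)
  then show ?thesis using that t n tn(3) by blast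
qed

text \<open>Testing against the component itself turns bounds on inner products with normals, which
  is what reach and angles provide, into a bound on a length.\<close>

lemma normal_component_le:
  assumes t: "t \<in> tangent_space M p" and n: "n \<in> normal_vectors M p"
    and le: "\<bar>(t + n) \<bullet> n\<bar> \<le> K * norm n" and K: "0 \<le> K"
  shows "norm n \<le> K"
proof -
  have "norm n * norm n = (t + n) \<bullet> n"
    using tangent_normal_inner[OF t n] by (simp add: inner_add dot_square_norm power2_eq_square)
  with le have "norm n * norm n \<le> K * norm n" by linarith
  then show ?thesis using K by (cases "n = 0") auto
qed

text \<open>Split \<open>w\<close> at the intermediate point \<open>y\<close>: its normal part has
  length at most \<open>c * norm w\<close>, and its tangential part, no longer than
  \<open>w\<close>, sees \<nu> at the angle bounded by \<open>d\<close>.\<close>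

lemma angle_le_triangle:
  assumes "angle_le M z y c" "angle_le M y p d" "0 \<le> c" "0 \<le> d"
  shows "angle_le M z p (c + d)"
  unfolding angle_le_def
proof (intro ballI)
  fix w \<nu> assume w: "w \<in> tangent_space M z" and nu: "\<nu> \<in> normal_vectors M p"
  obtain t n where tn: "t \<in> tangent_space M y" "n \<in> normal_vectors M y" "w = t + n"
      "(norm w)\<^sup>2 = (norm t)\<^sup>2 + (norm n)\<^sup>2"
    using tangent_normal_decomp by metis
  have n: "norm n \<le> c * norm w"
    by (rule normal_component_le[OF tn(1,2)]) (use assms(1,3) w tn(2,3) in \<open>auto simp: angle_le_def\<close>)
  have t: "norm t \<le> norm w" using tn(4) by (auto intro: power2_le_imp_le[of "norm t" "norm w"])
  have "\<bar>w \<bullet> \<nu>\<bar> \<le> \<bar>t \<bullet> \<nu>\<bar> + \<bar>n \<bullet> \<nu>\<bar>" unfolding tn(3) by (simp add: inner_add)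
  also have "\<bar>n \<bullet> \<nu>\<bar> \<le> norm n * norm \<nu>" by (rule Cauchy_Schwarz_ineq2)
  also have "\<dots> \<le> c * norm w * norm \<nu>" using n by (intro mult_right_mono) auto
  also have "\<bar>t \<bullet> \<nu>\<bar> \<le> d * norm t * norm \<nu>" using assms(2) tn(1) nu unfolding angle_le_def by blast
  also have "\<dots> \<le> d * norm w * norm \<nu>" using t assms(4) by (intro mult_right_mono mult_left_mono) auto
  finally show "\<bar>w \<bullet> \<nu>\<bar> \<le> (c + d) * norm w * norm \<nu>" by (simp add: algebra_simps)
qed

section \<open>Local parametrizations\<close>

lemma local_parametrization_has_derivative:
  assumes "local_parametrization M U \<phi>" "u \<in> U"
  shows "(\<phi> has_derivative frechet_derivative \<phi> (at u)) (at u)"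
  using assms unfolding local_parametrization_def C2_on_def
  by (metis differentiable_def frechet_derivative_works)

text \<open>The second derivative is bounded on a compact ball, which gives a uniform Taylor
  remainder; injectivity of the differential at \<open>u0\<close> persists nearby with half its
  constant. The last clause, from the homeomorphism onto a relatively open image, excludes other
  sheets of \<open>M\<close> near \<open>\<phi> u0\<close>. The ball of radius
  \<open>2 * \<rho>\<close> leaves room for \<open>u + v\<close>.\<close>

lemma local_parametrization_taylor:
  fixes \<phi> :: "real ^ 'd::finite \<Rightarrow> 'a::euclidean_space"
  assumes lp: "local_parametrization M U \<phi>" and u0: "u0 \<in> U"
  obtains \<rho> C \<mu> \<epsilon> where "0 < \<rho>" "0 \<le> C" "0 < \<mu>" "0 < \<epsilon>" "cball u0 (2 * \<rho>) \<subseteq> U"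
    "\<And>u v. u \<in> cball u0 \<rho> \<Longrightarrow> norm v \<le> \<rho> \<Longrightarrow>
       norm (\<phi> (u + v) - \<phi> u - frechet_derivative \<phi> (at u) v) \<le> C * (norm v)\<^sup>2"
    "\<And>u v. u \<in> cball u0 \<rho> \<Longrightarrow> \<mu> * norm v \<le> norm (frechet_derivative \<phi> (at u) v)"
    "\<And>u v. u \<in> cball u0 \<rho> \<Longrightarrow> norm v \<le> \<rho> \<Longrightarrow> \<mu> / 2 * norm v \<le> norm (\<phi> (u + v) - \<phi> u)"
    "M \<inter> ball (\<phi> u0) \<epsilon> \<subseteq> \<phi> ` ball u0 \<rho>"
proof -
  from lp obtain \<phi>' \<phi>'' where
    oU: "open U" and d1: "\<And>u. u \<in> U \<Longrightarrow> (\<phi> has_derivative blinfun_apply (\<phi>' u)) (at u)"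
    and d2: "\<And>u. u \<in> U \<Longrightarrow> (\<phi>' has_derivative blinfun_apply (\<phi>'' u)) (at u)"
    and c2: "continuous_on U \<phi>''" and inj: "\<And>u. u \<in> U \<Longrightarrow> inj (frechet_derivative \<phi> (at u))"
    unfolding local_parametrization_def C2_on_def by blast
  from lp obtain \<psi> where hom: "homeomorphism U (\<phi> ` U) \<phi> \<psi>" and op: "openin (top_of_set M) (\<phi> ` U)"
    unfolding local_parametrization_def by blast
  have D: "frechet_derivative \<phi> (at u) = blinfun_apply (\<phi>' u)" if "u \<in> U" for u
    using frechet_derivative_at[OF d1[OF that]] by simp
  obtain \<rho>0 where \<rho>0: "\<rho>0 > 0" "cball u0 (2 * \<rho>0) \<subseteq> U"
  proof -
    obtain e where "e > 0" "cball u0 e \<subseteq> U" using oU u0 open_contains_cball by metis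
    then show ?thesis using that[of "e / 2"] by simp
  qed
  have "compact (\<phi>'' ` cball u0 (2 * \<rho>0))"
    by (intro compact_continuous_image continuous_on_subset[OF c2 \<rho>0(2)] compact_cball)
  then obtain B where B: "B > 0" "\<And>u. u \<in> cball u0 (2 * \<rho>0) \<Longrightarrow> norm (\<phi>'' u) \<le> B"
    using compact_imp_bounded bounded_pos by (metis image_eqI)
  have lip: "norm (\<phi>' u - \<phi>' u1) \<le> B * norm (u - u1)"
    if "u \<in> cball u0 (2 * \<rho>0)" "u1 \<in> cball u0 (2 * \<rho>0)" for u u1
    using that \<rho>0(2) B(2)
    by (intro differentiable_bound[of "cball u0 (2 * \<rho>0)" \<phi>' "\<lambda>u. blinfun_apply (\<phi>'' u)"])
       (auto simp: norm_blinfun.rep_eq[symmetric] intro!: has_derivative_at_withinI[OF d2])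
  have taylor: "norm (\<phi> (u + v) - \<phi> u - blinfun_apply (\<phi>' u) v) \<le> B * (norm v)\<^sup>2"
    if u: "u \<in> cball u0 \<rho>0" and v: "norm v \<le> \<rho>0" for u v
  proof -
    have seg: "u + t *\<^sub>R v \<in> cball u0 (2 * \<rho>0)" if "t \<in> {0..1}" for t
    proof -
      have "norm (u - u0 + t *\<^sub>R v) \<le> norm (u - u0) + norm (t *\<^sub>R v)" by (rule norm_triangle_ineq)
      also have "norm (t *\<^sub>R v) \<le> norm v" using that by (simp add: mult_left_le_one_le)
      finally show ?thesis using u v by (simp add: dist_norm norm_minus_commute algebra_simps)
    qed
    have "norm (\<phi> (u + v) - \<phi> u - blinfun_apply (\<phi>' u) (u + v - u)) \<le> norm (u + v - u) * (B * norm v)"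
    proof (rule differentiable_bound_linearization[where S = "closed_segment u (u + v)"])
      fix t :: real assume t: "t \<in> {0..1}"
      show "u + t *\<^sub>R (u + v - u) \<in> closed_segment u (u + v)"
        using t by (auto simp: closed_segment_def algebra_simps intro!: exI[of _ t])
    next
      fix x assume "x \<in> closed_segment u (u + v)"
      then obtain t where t: "t \<in> {0..1}" "x = u + t *\<^sub>R v"
        by (auto simp: closed_segment_def algebra_simps)
      have x: "x \<in> cball u0 (2 * \<rho>0)" using seg[OF t(1)] t(2) by simp
      then show "(\<phi> has_derivative blinfun_apply (\<phi>' x)) (at x within closed_segment u (u + v))"
        using d1 \<rho>0(2) by (blast intro: has_derivative_at_withinI)
      have "onorm (blinfun_apply (\<phi>' x) - blinfun_apply (\<phi>' u)) = norm (\<phi>' x - \<phi>' u)"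
        by (simp add: norm_blinfun.rep_eq minus_blinfun.rep_eq fun_diff_def)
      also have "\<dots> \<le> B * norm (x - u)" using lip x seg[of 0] by simp
      also have "norm (x - u) \<le> norm v" using t by (simp add: mult_left_le_one_le)
      finally show "onorm (blinfun_apply (\<phi>' x) - blinfun_apply (\<phi>' u)) \<le> B * norm v"
        using B(1) by simp
    qed auto
    then show ?thesis by (simp add: power2_eq_square mult_ac)
  qed
  obtain \<mu>0 where \<mu>0: "\<mu>0 > 0" "\<And>v. \<mu>0 * norm v \<le> norm (blinfun_apply (\<phi>' u0) v)"
    using linear_inj_bounded_below_pos[of "blinfun_apply (\<phi>' u0)"] inj[OF u0] D[OF u0]
    by (metis blinfun.bounded_linear_right bounded_linear.linear)
  define \<mu> where "\<mu> = \<mu>0 / 2"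
  \<comment> \<open>With \<open>B * \<rho> \<le> \<mu> / 2\<close> the Taylor remainder eats at most
    half of the lower bound \<open>\<mu> * norm v\<close>, and the change of the differential from
    \<open>u0\<close> to \<open>u\<close> at most half of \<open>\<mu>0\<close>.\<close>
  define \<rho> where "\<rho> = min \<rho>0 (\<mu> / (2 * B))"
  have \<mu>: "\<mu> > 0" using \<mu>0 by (simp add: \<mu>_def)
  have \<rho>: "\<rho> > 0" "\<rho> \<le> \<rho>0" "B * \<rho> \<le> \<mu> / 2"
  proof -
    have "\<rho> \<le> \<mu> / (2 * B)" by (simp add: \<rho>_def)
    then show "B * \<rho> \<le> \<mu> / 2" using B(1) by (simp add: field_simps)
  qed (use \<mu> B \<rho>0 in \<open>auto simp: \<rho>_def\<close>)
  have sub: "cball u0 (2 * \<rho>) \<subseteq> U"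
    using \<rho> \<rho>0 by (meson dual_order.trans mult_left_mono subset_cball zero_le_numeral)
  have inU: "u \<in> U" if "u \<in> cball u0 \<rho>" for u
    using that sub \<rho>(1) by auto
  have lower: "\<mu> * norm v \<le> norm (blinfun_apply (\<phi>' u) v)" if u: "u \<in> cball u0 \<rho>" for u v
  proof -
    have "norm (\<phi>' u - \<phi>' u0) \<le> B * norm (u - u0)" using lip[of u u0] u \<rho> \<rho>0 by auto
    also have "\<dots> \<le> B * \<rho>" using u B(1) by (intro mult_left_mono) (auto simp: dist_norm norm_minus_commute)
    also have "\<dots> \<le> \<mu>" using \<rho> \<mu> by simp
    finally have "norm (blinfun_apply (\<phi>' u - \<phi>' u0) v) \<le> \<mu> * norm v"
      using norm_blinfun[of "\<phi>' u - \<phi>' u0" v] by (meson mult_right_mono norm_ge_zero order_trans)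
    moreover have "\<mu>0 * norm v \<le> norm (blinfun_apply (\<phi>' u) v) + norm (blinfun_apply (\<phi>' u - \<phi>' u0) v)"
      using \<mu>0(2)[of v] norm_triangle_ineq4[of "blinfun_apply (\<phi>' u) v" "blinfun_apply (\<phi>' u - \<phi>' u0) v"]
      by (simp add: blinfun.diff_left)
    moreover have "\<mu>0 = \<mu> + \<mu>" by (simp add: \<mu>_def)
    ultimately show ?thesis by (simp add: distrib_right)
  qed
  have lower2: "\<mu> / 2 * norm v \<le> norm (\<phi> (u + v) - \<phi> u)" if u: "u \<in> cball u0 \<rho>" and v: "norm v \<le> \<rho>" for u v
  proof -
    have "norm (\<phi> (u + v) - \<phi> u - blinfun_apply (\<phi>' u) v) \<le> B * (norm v)\<^sup>2"
      using taylor[of u v] u v \<rho> by simp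
    also have "\<dots> \<le> B * (\<rho> * norm v)"
      using v B(1) by (auto simp: power2_eq_square intro!: mult_left_mono mult_right_mono)
    also have "\<dots> \<le> \<mu> / 2 * norm v" using mult_right_mono[OF \<rho>(3), of "norm v"] by (simp add: mult_ac)
    finally show ?thesis
      using lower[OF u, of v]
        norm_triangle_ineq4[of "\<phi> (u + v) - \<phi> u" "\<phi> (u + v) - \<phi> u - blinfun_apply (\<phi>' u) v"] by simp
  qed
  have "openin (top_of_set (\<phi> ` U)) (\<phi> ` ball u0 \<rho>)"
    using \<rho> sub by (intro homeomorphism_imp_open_map[OF hom]) (auto simp: openin_open intro!: exI[of _ "ball u0 \<rho>"])
  then have "openin (top_of_set M) (\<phi> ` ball u0 \<rho>)" using op openin_trans by blast
  moreover have "\<phi> u0 \<in> \<phi> ` ball u0 \<rho>" using \<rho> by auto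
  ultimately obtain \<epsilon> where \<epsilon>: "\<epsilon> > 0" "ball (\<phi> u0) \<epsilon> \<inter> M \<subseteq> \<phi> ` ball u0 \<rho>"
    unfolding openin_contains_ball by blast
  show ?thesis
  proof (rule that[of \<rho> B \<mu> \<epsilon>])
    show "norm (\<phi> (u + v) - \<phi> u - frechet_derivative \<phi> (at u) v) \<le> B * (norm v)\<^sup>2"
      if "u \<in> cball u0 \<rho>" "norm v \<le> \<rho>" for u v
      using taylor[of u v] that \<rho> D inU by auto
    show "\<mu> * norm v \<le> norm (frechet_derivative \<phi> (at u) v)" if "u \<in> cball u0 \<rho>" for u v
      using lower that D inU by auto
    show "M \<inter> ball (\<phi> u0) \<epsilon> \<subseteq> \<phi> ` ball u0 \<rho>" using \<epsilon> by blast
    show "\<mu> / 2 * norm v \<le> norm (\<phi> (u + v) - \<phi> u)" if "u \<in> cball u0 \<rho>" "norm v \<le> \<rho>" for u v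
      using lower2 that .
    show "cball u0 (2 * \<rho>) \<subseteq> U" by (rule sub)
  qed (use \<rho>(1) B(1) \<mu> \<epsilon>(1) in auto)
qed

text \<open>Inserting the curve \<open>\<phi> (u + t *\<^sub>R v)\<close> into the quadratic bound
  shows that \<open>?D v \<bullet> \<nu>\<close> is of order \<open>t\<close>, hence zero.
  Conversely, for \<nu> orthogonal to the range only the Taylor remainder is left, which is
  quadratic in \<open>norm v\<close> and so in the chord.\<close>

lemma normal_vectors_local_parametrization:
  fixes \<phi> :: "real ^ 'd::finite \<Rightarrow> 'a::euclidean_space"
  assumes lp: "local_parametrization M U \<phi>" and u: "u \<in> U"
  shows "normal_vectors M (\<phi> u) = (range (frechet_derivative \<phi> (at u)))\<^sup>\<bottom>"
proof -
  let ?D = "frechet_derivative \<phi> (at u)"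
  obtain \<rho> C \<mu> \<epsilon> where
    pos: "0 < \<rho>" "0 \<le> C" "0 < \<mu>" "0 < \<epsilon>" and sub: "cball u (2 * \<rho>) \<subseteq> U"
    and taylor': "\<And>x v. x \<in> cball u \<rho> \<Longrightarrow> norm v \<le> \<rho> \<Longrightarrow>
       norm (\<phi> (x + v) - \<phi> x - frechet_derivative \<phi> (at x) v) \<le> C * (norm v)\<^sup>2"
    and lower': "\<And>x v. x \<in> cball u \<rho> \<Longrightarrow> norm v \<le> \<rho> \<Longrightarrow> \<mu> / 2 * norm v \<le> norm (\<phi> (x + v) - \<phi> x)"
    and near: "M \<inter> ball (\<phi> u) \<epsilon> \<subseteq> \<phi> ` ball u \<rho>"
    by (rule local_parametrization_taylor[OF lp u]) blast
  have taylor: "norm (\<phi> (u + v) - \<phi> u - ?D v) \<le> C * (norm v)\<^sup>2" if "norm v \<le> \<rho>" for v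
    using taylor'[of u v] that pos by simp
  have lower: "\<mu> / 2 * norm v \<le> norm (\<phi> (u + v) - \<phi> u)" if "norm v \<le> \<rho>" for v
    using lower'[of u v] that pos by simp
  have lin: "linear ?D"
    using local_parametrization_has_derivative[OF lp u] has_derivative_linear by blast
  have im: "\<phi> ` U \<subseteq> M" using lp unfolding local_parametrization_def by (meson openin_imp_subset)
  show ?thesis
  proof (intro equalityI subsetI)
    fix \<nu> assume "\<nu> \<in> normal_vectors M (\<phi> u)"
    then obtain B where B: "\<And>z. z \<in> M \<Longrightarrow> \<bar>(z - \<phi> u) \<bullet> \<nu>\<bar> \<le> B * (norm (z - \<phi> u))\<^sup>2"
      unfolding normal_vectors_def by blast
    have "?D v \<bullet> \<nu> = 0" for v
    proof -
      define L where "L = norm (?D v) + C * (norm v)\<^sup>2"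
      define K where "K = \<bar>B\<bar> * L\<^sup>2 + C * (norm v)\<^sup>2 * norm \<nu>"
      have bound: "\<bar>?D v \<bullet> \<nu>\<bar> \<le> K * t" if t: "0 < t" "t \<le> 1" "norm (t *\<^sub>R v) \<le> \<rho>" for t
      proof -
        define z where "z = \<phi> (u + t *\<^sub>R v)"
        define e where "e = z - \<phi> u - ?D (t *\<^sub>R v)"
        have e: "norm e \<le> C * (t\<^sup>2 * (norm v)\<^sup>2)"
          using taylor[OF t(3)] unfolding e_def z_def by (simp add: power_mult_distrib)
        have t2: "t\<^sup>2 \<le> t" using t by (simp add: power2_eq_square mult_left_le)
        have "u + t *\<^sub>R v \<in> U" using sub t(3) pos(1) by (auto simp: subset_iff dist_norm)
        then have zM: "z \<in> M" using im by (auto simp: z_def)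
        have "norm (z - \<phi> u) = norm (t *\<^sub>R ?D v + e)" by (simp add: e_def linear_scale[OF lin])
        also have "\<dots> \<le> t * norm (?D v) + C * (t\<^sup>2 * (norm v)\<^sup>2)"
          using norm_triangle_ineq[of "t *\<^sub>R ?D v" e] e t(1) by simp
        also have "\<dots> \<le> t * norm (?D v) + C * (t * (norm v)\<^sup>2)"
          using t2 pos by (intro add_mono mult_left_mono mult_right_mono) auto
        finally have zL: "norm (z - \<phi> u) \<le> t * L" by (simp add: L_def algebra_simps)
        have "t * (?D v \<bullet> \<nu>) = (z - \<phi> u) \<bullet> \<nu> - e \<bullet> \<nu>"
          by (simp add: e_def linear_scale[OF lin] inner_diff_left)
        then have "t * \<bar>?D v \<bullet> \<nu>\<bar> \<le> \<bar>(z - \<phi> u) \<bullet> \<nu>\<bar> + \<bar>e \<bullet> \<nu>\<bar>"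
          using t(1) by (metis abs_mult abs_of_pos abs_triangle_ineq4)
        also have "\<bar>(z - \<phi> u) \<bullet> \<nu>\<bar> \<le> \<bar>B\<bar> * (norm (z - \<phi> u))\<^sup>2"
          using B[OF zM] by (meson abs_ge_self mult_right_mono order_trans zero_le_power2)
        also have "\<dots> \<le> \<bar>B\<bar> * (t * L)\<^sup>2" using zL by (intro mult_left_mono power_mono) auto
        also have "\<bar>e \<bullet> \<nu>\<bar> \<le> norm e * norm \<nu>" by (rule Cauchy_Schwarz_ineq2)
        also have "\<dots> \<le> C * (t\<^sup>2 * (norm v)\<^sup>2) * norm \<nu>" using e by (intro mult_right_mono) auto
        finally have "t * \<bar>?D v \<bullet> \<nu>\<bar> \<le> t * (K * t)"
          by (simp add: K_def power2_eq_square algebra_simps)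
        then show ?thesis using t(1) by simp
      qed
      define t0 where "t0 = min 1 (\<rho> / (norm v + 1))"
      have t0: "0 < t0" using pos by (auto simp: t0_def intro!: divide_pos_pos add_nonneg_pos)
      have K0: "K \<ge> 0" using pos by (simp add: K_def)
      have "\<bar>?D v \<bullet> \<nu>\<bar> \<le> 0 + e" if e: "e > 0" for e
      proof -
        define t where "t = min t0 (e / (K + 1))"
        have t: "0 < t" "t \<le> t0" "t \<le> e / (K + 1)" using t0 e K0 by (auto simp: t_def)
        have "t \<le> \<rho> / (norm v + 1)" using t(2) by (simp add: t0_def)
        then have "t * (norm v + 1) \<le> \<rho>" by (simp add: pos_le_divide_eq add_nonneg_pos)
        then have "norm (t *\<^sub>R v) \<le> \<rho>" using t(1) by (simp add: algebra_simps)
        then have "\<bar>?D v \<bullet> \<nu>\<bar> \<le> K * t" using bound[of t] t by (simp add: t0_def)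
        also have "\<dots> \<le> (K + 1) * t" using t by simp
        also have "\<dots> \<le> e" using t(3) K0 by (simp add: pos_le_divide_eq mult.commute)
        finally show ?thesis by simp
      qed
      then show ?thesis using field_le_epsilon[of "\<bar>?D v \<bullet> \<nu>\<bar>" 0] by auto
    qed
    then show "\<nu> \<in> (range ?D)\<^sup>\<bottom>" by (auto simp: orthogonal_comp_def orthogonal_def)
  next
    fix \<nu> assume nu: "\<nu> \<in> (range ?D)\<^sup>\<bottom>"
    \<comment> \<open>The first entry serves points inside the chart neighbourhood; the second
      serves points at distance at least \<epsilon>, where Cauchy-Schwarz alone is
      quadratic.\<close>
    define K where "K = max (C * norm \<nu> * (4 / \<mu>\<^sup>2)) (norm \<nu> / \<epsilon>)"
    have "\<bar>(z - \<phi> u) \<bullet> \<nu>\<bar> \<le> K * (norm (z - \<phi> u))\<^sup>2" if z: "z \<in> M" for z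
    proof (cases "norm (z - \<phi> u) < \<epsilon>")
      case True
      then obtain x where x: "z = \<phi> x" "x \<in> ball u \<rho>"
        using near z by (auto simp: dist_norm norm_minus_commute subset_iff image_iff)
      define v where "v = x - u"
      have v: "norm v \<le> \<rho>" "x = u + v" using x by (auto simp: v_def dist_norm norm_minus_commute)
      have "?D v \<bullet> \<nu> = 0" using nu by (auto simp: orthogonal_comp_def orthogonal_def)
      then have "\<bar>(z - \<phi> u) \<bullet> \<nu>\<bar> = \<bar>(\<phi> (u + v) - \<phi> u - ?D v) \<bullet> \<nu>\<bar>"
        by (simp add: x v inner_diff_left)
      also have "\<dots> \<le> norm (\<phi> (u + v) - \<phi> u - ?D v) * norm \<nu>" by (rule Cauchy_Schwarz_ineq2)
      also have "\<dots> \<le> C * (norm v)\<^sup>2 * norm \<nu>" using taylor[OF v(1)] by (intro mult_right_mono) auto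
      also have "\<dots> \<le> C * (2 / \<mu> * norm (z - \<phi> u))\<^sup>2 * norm \<nu>"
        using lower[OF v(1)] pos
        by (intro mult_right_mono mult_left_mono power_mono) (auto simp: x v(2) field_simps)
      finally have "\<bar>(z - \<phi> u) \<bullet> \<nu>\<bar> \<le> (C * norm \<nu> * (4 / \<mu>\<^sup>2)) * (norm (z - \<phi> u))\<^sup>2"
        by (simp add: power_mult_distrib power_divide mult_ac)
      also have "\<dots> \<le> K * (norm (z - \<phi> u))\<^sup>2" by (intro mult_right_mono) (auto simp: K_def)
      finally show ?thesis .
    next
      case False
      have "\<bar>(z - \<phi> u) \<bullet> \<nu>\<bar> \<le> norm (z - \<phi> u) * norm \<nu>" by (rule Cauchy_Schwarz_ineq2)
      also have "\<dots> = (norm (z - \<phi> u) * (norm \<nu> / \<epsilon>)) * \<epsilon>" using pos by simp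
      also have "\<dots> \<le> (norm (z - \<phi> u) * (norm \<nu> / \<epsilon>)) * norm (z - \<phi> u)"
        using False pos by (intro mult_left_mono) auto
      also have "\<dots> = norm \<nu> / \<epsilon> * (norm (z - \<phi> u))\<^sup>2" by (simp add: power2_eq_square)
      also have "\<dots> \<le> K * (norm (z - \<phi> u))\<^sup>2" by (intro mult_right_mono) (auto simp: K_def)
      finally show ?thesis .
    qed
    then show "\<nu> \<in> normal_vectors M (\<phi> u)" unfolding normal_vectors_def by blast
  qed
qed

lemma tangent_space_local_parametrization:
  assumes "local_parametrization M U \<phi>" "u \<in> U"
  shows "tangent_space M (\<phi> u) = range (frechet_derivative \<phi> (at u))"
proof -
  have "linear (frechet_derivative \<phi> (at u))"
    using local_parametrization_has_derivative[OF assms] has_derivative_linear by blast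
  then show ?thesis
    unfolding tangent_space_def normal_vectors_local_parametrization[OF assms]
    by (intro orthogonal_comp_self linear_subspace_image subspace_UNIV)
qed

section \<open>Angles between tangent spaces\<close>

context compact_reach
begin

text \<open>Let \<open>a\<close> be the supremal sine. From \<open>z1\<close> one follows the chart
  in a tangent direction \<open>w\<close> of length \<delta> to a third point \<open>z3\<close>, so
  \<open>w\<close> is a difference of two chords at \<open>z2\<close> minus a Taylor error. The
  chords are almost orthogonal to the normals at \<open>z2\<close>; the normal part of the error is
  controlled by the chord from \<open>z1\<close> to \<open>z3\<close>; its tangential part is at
  most \<delta> / 10 and is again tangent at \<open>z1\<close>, so it is fed back into
  \<open>a\<close>. Thus \<open>a\<close> is absorbed, and only \<epsilon>, not the factor 4,
  depends on the chart.\<close>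

lemma angle_le_local:
  fixes \<phi> :: "real ^ 'd::finite \<Rightarrow> 'a"
  assumes lp: "local_parametrization M U \<phi>" and u0: "u0 \<in> U"
  obtains \<epsilon> where "0 < \<epsilon>"
    "\<And>z1 z2. z1 \<in> M \<inter> ball (\<phi> u0) \<epsilon> \<Longrightarrow> z2 \<in> M \<inter> ball (\<phi> u0) \<epsilon> \<Longrightarrow>
       angle_le M z1 z2 (4 * \<kappa> * norm (z1 - z2))"
proof -
  obtain \<rho> C \<mu> \<epsilon>0 where
    pos: "0 < \<rho>" "0 \<le> C" "0 < \<mu>" "0 < \<epsilon>0" and sub: "cball u0 (2 * \<rho>) \<subseteq> U"
    and taylor: "\<And>x v. x \<in> cball u0 \<rho> \<Longrightarrow> norm v \<le> \<rho> \<Longrightarrow>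
       norm (\<phi> (x + v) - \<phi> x - frechet_derivative \<phi> (at x) v) \<le> C * (norm v)\<^sup>2"
    and lower: "\<And>x v. x \<in> cball u0 \<rho> \<Longrightarrow> \<mu> * norm v \<le> norm (frechet_derivative \<phi> (at x) v)"
    and near: "M \<inter> ball (\<phi> u0) \<epsilon>0 \<subseteq> \<phi> ` ball u0 \<rho>"
    by (rule local_parametrization_taylor[OF lp u0]) blast
  have im: "\<phi> ` U \<subseteq> M" using lp unfolding local_parametrization_def by (meson openin_imp_subset)
  \<comment> \<open>\<open>2 * \<epsilon> \<le> \<rho> * \<mu>\<close> keeps the parameter step
    within \<rho>; \<open>20 * C * \<epsilon> \<le> \<mu>\<^sup>2\<close> makes the Taylor error at
    most a tenth of \<delta>. \<open>C + 1\<close> avoids a division by zero.\<close>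
  define \<epsilon> where "\<epsilon> = min \<epsilon>0 (min (\<rho> * \<mu> / 2) (\<mu>\<^sup>2 / (20 * (C + 1))))"
  have eps: "0 < \<epsilon>" "\<epsilon> \<le> \<epsilon>0" "2 * \<epsilon> \<le> \<rho> * \<mu>" "20 * C * \<epsilon> \<le> \<mu>\<^sup>2"
  proof -
    show "0 < \<epsilon>" "\<epsilon> \<le> \<epsilon>0" using pos by (auto simp: \<epsilon>_def intro!: divide_pos_pos add_nonneg_pos)
    have "\<epsilon> \<le> \<rho> * \<mu> / 2" unfolding \<epsilon>_def by (meson min.cobounded1 min.cobounded2 order_trans)
    then show "2 * \<epsilon> \<le> \<rho> * \<mu>" by simp
    have "\<epsilon> \<le> \<mu>\<^sup>2 / (20 * (C + 1))" unfolding \<epsilon>_def by (meson min.cobounded2 order_trans)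
    then have "20 * (C + 1) * \<epsilon> \<le> \<mu>\<^sup>2" using pos by (simp add: pos_le_divide_eq mult_ac)
    then show "20 * C * \<epsilon> \<le> \<mu>\<^sup>2" using \<open>0 < \<epsilon>\<close> by (simp add: algebra_simps)
  qed
  have "angle_le M z1 z2 (4 * \<kappa> * norm (z1 - z2))"
    if z1: "z1 \<in> M \<inter> ball (\<phi> u0) \<epsilon>" and z2: "z2 \<in> M \<inter> ball (\<phi> u0) \<epsilon>" for z1 z2
  proof (cases "z1 = z2")
    case True
    then show ?thesis by (simp add: angle_le_def tangent_normal_inner)
  next
    case False
    let ?T = "tangent_space M z1" and ?N = "normal_vectors M z2"
    define \<delta> where "\<delta> = norm (z1 - z2)"
    have \<delta>: "0 < \<delta>" using False by (simp add: \<delta>_def)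
    have "dist z1 z2 < 2 * \<epsilon>" using z1 z2 by (auto intro: dist_triangle_half_r[of "\<phi> u0" _ "2 * \<epsilon>"])
    then have \<delta>2: "\<delta> < 2 * \<epsilon>" by (simp add: \<delta>_def dist_norm)
    obtain u1 where u1: "u1 \<in> ball u0 \<rho>" "z1 = \<phi> u1"
      using near z1 eps(2) by (auto simp: subset_iff image_iff)
    have u1U: "u1 \<in> U" using u1(1) sub pos(1) by (auto simp: subset_iff)
    define D where "D = frechet_derivative \<phi> (at u1)"
    have T: "?T = range D" unfolding u1(2) D_def by (rule tangent_space_local_parametrization[OF lp u1U])
    define S where "S = {\<bar>w \<bullet> \<nu>\<bar> | w \<nu>. w \<in> ?T \<and> \<nu> \<in> ?N \<and> norm w \<le> 1 \<and> norm \<nu> \<le> 1}"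
    have S1: "s \<le> 1" if s_in: "s \<in> S" for s
    proof -
      obtain w \<nu> :: 'a where s: "s = \<bar>w \<bullet> \<nu>\<bar>" "norm w \<le> 1" "norm \<nu> \<le> 1"
        using s_in unfolding S_def by blast
      have "s \<le> norm w * norm \<nu>" unfolding s(1) by (rule Cauchy_Schwarz_ineq2)
      also have "\<dots> \<le> 1 * 1" using s by (intro mult_mono) auto
      finally show ?thesis by simp
    qed
    have "(0::'a) \<in> ?T" "(0::'a) \<in> ?N"
      using subspace_0[OF subspace_tangent_space] subspace_0[OF subspace_normal_vectors] by auto
    then have S0: "0 \<in> S" unfolding S_def by force
    have bdd: "bdd_above S" using S1 by (rule bdd_aboveI)
    define a where "a = Sup S"
    have a0: "0 \<le> a" unfolding a_def by (rule cSup_upper[OF S0 bdd])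
    have a: "\<bar>w \<bullet> \<nu>\<bar> \<le> a * norm w * norm \<nu>" if w: "w \<in> ?T" and \<nu>: "\<nu> \<in> ?N" for w \<nu>
    proof (cases "w = 0 \<or> \<nu> = 0")
      case False
      have "\<bar>((1 / norm w) *\<^sub>R w) \<bullet> ((1 / norm \<nu>) *\<^sub>R \<nu>)\<bar> \<in> S"
        unfolding S_def using False w \<nu> subspace_scale[OF subspace_tangent_space] subspace_scale[OF subspace_normal_vectors]
        by (intro CollectI exI[of _ "(1 / norm w) *\<^sub>R w"] exI[of _ "(1 / norm \<nu>) *\<^sub>R \<nu>"] conjI refl) auto
      then have "\<bar>((1 / norm w) *\<^sub>R w) \<bullet> ((1 / norm \<nu>) *\<^sub>R \<nu>)\<bar> \<le> a"
        unfolding a_def by (rule cSup_upper[OF _ bdd])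
      then show ?thesis using False by (simp add: abs_mult field_simps)
    qed (use a0 in auto)
    \<comment> \<open>3.31 is half of 2.1^2 + 1 + 1.1^2, from the chords \<open>z3 - z2\<close>,
      \<open>z1 - z2\<close> and \<open>z3 - z1\<close>, whose lengths are at most 2.1 \<delta>,
      \<delta> and 1.1 \<delta>. Absorbing \<open>a / 10\<close> afterwards gives 3.31 / 0.9, which
      is below 4.\<close>
    have key: "\<bar>w \<bullet> \<nu>\<bar> \<le> (3.31 * \<kappa> * \<delta>\<^sup>2 + a * (\<delta> / 10)) * norm \<nu>"
      if w: "w \<in> ?T" "norm w = \<delta>" and \<nu>: "\<nu> \<in> ?N" for w \<nu>
    proof -
      obtain v where v: "w = D v" using w T by auto
      have \<mu>v: "\<mu> * norm v \<le> \<delta>" using lower[of u1 v] u1 w(2) v by (simp add: D_def)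
      then have "\<mu> * norm v \<le> \<mu> * \<rho>" using \<delta>2 eps(3) by (simp add: mult.commute)
      then have v\<rho>: "norm v \<le> \<rho>" using pos by simp
      define z3 where "z3 = \<phi> (u1 + v)"
      have "norm (u0 - (u1 + v)) \<le> norm (u0 - u1) + norm v"
        using norm_triangle_ineq4[of "u0 - u1" v] by (simp add: algebra_simps)
      then have "u1 + v \<in> U" using u1 v\<rho> by (intro subsetD[OF sub]) (auto simp: dist_norm)
      then have z3: "z3 \<in> M" using im by (auto simp: z3_def)
      define e where "e = z3 - z1 - w"
      have "norm e \<le> C * (norm v)\<^sup>2"
        using taylor[of u1 v] u1 v\<rho> by (simp add: e_def z3_def v D_def)
      then have "\<mu>\<^sup>2 * norm e \<le> \<mu>\<^sup>2 * (C * (norm v)\<^sup>2)" by (rule mult_left_mono) simp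
      also have "\<dots> = C * (\<mu> * norm v)\<^sup>2" by (simp add: power_mult_distrib)
      also have "\<dots> \<le> C * \<delta>\<^sup>2" using \<mu>v pos by (intro mult_left_mono power_mono) auto
      also have "\<dots> \<le> C * (2 * \<epsilon>) * \<delta>"
        using pos \<delta> \<delta>2 by (auto simp: power2_eq_square mult.assoc intro!: mult_left_mono mult_right_mono)
      also have "\<dots> \<le> \<mu>\<^sup>2 / 10 * \<delta>" using eps(4) \<delta> by (intro mult_right_mono) auto
      finally have "\<mu>\<^sup>2 * norm e \<le> \<mu>\<^sup>2 * (\<delta> / 10)" by simp
      then have e: "norm e \<le> \<delta> / 10" using pos by simp
      obtain eT eN where eTN: "eT \<in> ?T" "eN \<in> normal_vectors M z1" "e = eT + eN"
        "(norm e)\<^sup>2 = (norm eT)\<^sup>2 + (norm eN)\<^sup>2"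
        using tangent_normal_decomp by metis
      have eT: "norm eT \<le> \<delta> / 10"
        using eTN(4) e power2_le_imp_le[of "norm eT" "norm e"] by simp
      have z31: "norm (z3 - z1) \<le> 1.1 * \<delta>"
        using norm_triangle_ineq[of w e] e w(2) by (simp add: e_def)
      have z32: "norm (z3 - z2) \<le> 2.1 * \<delta>"
        using norm_triangle_ineq[of "z3 - z1" "z1 - z2"] z31 by (simp add: \<delta>_def)
      have "norm eN * norm eN = (z3 - z1) \<bullet> eN"
        using tangent_normal_inner[OF eTN(1,2)] tangent_normal_inner[OF w(1) eTN(2)] eTN(3)
        by (simp add: e_def inner_add inner_diff dot_square_norm power2_eq_square algebra_simps)
      also have "\<dots> \<le> \<kappa> / 2 * (norm (z3 - z1))\<^sup>2 * norm eN"
        using normal_vectors_inner_le[OF _ eTN(2) z3] z1 by auto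
      also have "\<dots> \<le> \<kappa> / 2 * (1.1 * \<delta>)\<^sup>2 * norm eN"
        using z31 kappa_pos by (intro mult_right_mono mult_left_mono power_mono) auto
      finally have eN: "norm eN \<le> \<kappa> / 2 * (1.1 * \<delta>)\<^sup>2"
        using kappa_pos by (cases "eN = 0") (auto simp del: mult_divide_mult_cancel_left_if)
      have 1: "\<bar>(z3 - z2) \<bullet> \<nu>\<bar> \<le> \<kappa> / 2 * (2.1 * \<delta>)\<^sup>2 * norm \<nu>"
      proof -
        have "\<bar>(z3 - z2) \<bullet> \<nu>\<bar> \<le> \<kappa> / 2 * (norm (z3 - z2))\<^sup>2 * norm \<nu>"
          using normal_vectors_inner_le[OF _ \<nu> z3] z2 by auto
        also have "\<dots> \<le> \<kappa> / 2 * (2.1 * \<delta>)\<^sup>2 * norm \<nu>"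
          using z32 kappa_pos by (intro mult_right_mono mult_left_mono power_mono) auto
        finally show ?thesis .
      qed
      have 2: "\<bar>(z1 - z2) \<bullet> \<nu>\<bar> \<le> \<kappa> / 2 * \<delta>\<^sup>2 * norm \<nu>"
        using normal_vectors_inner_le[OF _ \<nu>] z1 z2 by (auto simp: \<delta>_def)
      have 3: "\<bar>eT \<bullet> \<nu>\<bar> \<le> a * (\<delta> / 10) * norm \<nu>"
        using a[OF eTN(1) \<nu>] mult_right_mono[OF mult_left_mono[OF eT a0], of "norm \<nu>"] by auto
      have 4: "\<bar>eN \<bullet> \<nu>\<bar> \<le> \<kappa> / 2 * (1.1 * \<delta>)\<^sup>2 * norm \<nu>"
        using Cauchy_Schwarz_ineq2[of eN \<nu>] mult_right_mono[OF eN, of "norm \<nu>"] by auto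
      have "w = (z3 - z2) - (z1 - z2) - eT - eN" using eTN(3) by (simp add: e_def algebra_simps)
      then have "w \<bullet> \<nu> = (z3 - z2) \<bullet> \<nu> - (z1 - z2) \<bullet> \<nu> - eT \<bullet> \<nu> - eN \<bullet> \<nu>"
        by (simp add: inner_diff_left)
      then have "\<bar>w \<bullet> \<nu>\<bar> \<le> \<kappa> / 2 * (2.1 * \<delta>)\<^sup>2 * norm \<nu> + \<kappa> / 2 * \<delta>\<^sup>2 * norm \<nu>
          + a * (\<delta> / 10) * norm \<nu> + \<kappa> / 2 * (1.1 * \<delta>)\<^sup>2 * norm \<nu>"
        using 1 2 3 4 by linarith
      also have "\<dots> = (3.31 * \<kappa> * \<delta>\<^sup>2 + a * (\<delta> / 10)) * norm \<nu>"
        by (simp add: power2_eq_square algebra_simps)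
      finally show ?thesis .
    qed
    have key1: "\<bar>w \<bullet> \<nu>\<bar> \<le> (3.31 * \<kappa> * \<delta> + a / 10) * norm w * norm \<nu>"
      if w: "w \<in> ?T" and \<nu>: "\<nu> \<in> ?N" for w \<nu>
    proof (cases "w = 0")
      case False
      define w' where "w' = (\<delta> / norm w) *\<^sub>R w"
      have w': "w' \<in> ?T" "norm w' = \<delta>"
        using False w \<delta> subspace_scale[OF subspace_tangent_space] by (auto simp: w'_def)
      have "\<bar>w' \<bullet> \<nu>\<bar> = \<delta> / norm w * \<bar>w \<bullet> \<nu>\<bar>" using \<delta> by (simp add: w'_def abs_mult)
      then have "\<delta> / norm w * \<bar>w \<bullet> \<nu>\<bar> \<le> (3.31 * \<kappa> * \<delta>\<^sup>2 + a * (\<delta> / 10)) * norm \<nu>"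
        using key[OF w' \<nu>] by simp
      then have "\<delta> * \<bar>w \<bullet> \<nu>\<bar> \<le> \<delta> * ((3.31 * \<kappa> * \<delta> + a / 10) * norm w * norm \<nu>)"
        using False by (simp add: field_simps power2_eq_square)
      then show ?thesis using \<delta> by simp
    qed simp
    have "a \<le> 3.31 * \<kappa> * \<delta> + a / 10" unfolding a_def
    proof (rule cSup_least)
      show "S \<noteq> {}" using S0 by auto
      fix s assume "s \<in> S"
      then obtain w \<nu> where s: "s = \<bar>w \<bullet> \<nu>\<bar>" "w \<in> ?T" "\<nu> \<in> ?N" "norm w \<le> 1" "norm \<nu> \<le> 1" by (auto simp: S_def)
      have "s \<le> (3.31 * \<kappa> * \<delta> + a / 10) * norm w * norm \<nu>" unfolding s(1) by (rule key1[OF s(2,3)])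
      also have "\<dots> \<le> (3.31 * \<kappa> * \<delta> + a / 10) * 1 * 1"
        using s \<delta> kappa_pos a0 by (intro mult_mono) auto
      finally show "s \<le> 3.31 * \<kappa> * \<delta> + Sup S / 10" by (simp add: a_def)
    qed
    then have "a \<le> 3.31 / 0.9 * (\<kappa> * \<delta>)" by simp
    also have "\<dots> \<le> 4 * (\<kappa> * \<delta>)" using kappa_pos \<delta> by (intro mult_right_mono) auto
    finally have a4: "a \<le> 4 * \<kappa> * \<delta>" by simp
    show ?thesis unfolding angle_le_def
    proof (intro ballI)
      fix w \<nu> assume "w \<in> ?T" "\<nu> \<in> ?N"
      then have "\<bar>w \<bullet> \<nu>\<bar> \<le> a * norm w * norm \<nu>" by (rule a)
      also have "\<dots> \<le> 4 * \<kappa> * \<delta> * norm w * norm \<nu>" using a4 by (intro mult_right_mono) auto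
      finally show "\<bar>w \<bullet> \<nu>\<bar> \<le> 4 * \<kappa> * norm (z1 - z2) * norm w * norm \<nu>" by (simp add: \<delta>_def)
    qed
  qed
  then show ?thesis using that eps(1) by blast
qed

end

locale compact_reach_submanifold = compact_reach M \<kappa>
  for M :: "'a::euclidean_space set" and \<kappa> +
  fixes dty :: "'d::finite itself"
  assumes submanifold_M: "C2_submanifold dty M"
begin

lemma chart_at:
  assumes "p \<in> M"
  obtains U \<phi> u where "local_parametrization M U (\<phi> :: real ^ 'd \<Rightarrow> 'a)" "u \<in> U" "p = \<phi> u"
  using submanifold_M assms unfolding C2_submanifold_def by blast

text \<open>A Lebesgue number of the cover of \<open>M\<close> by the balls on which the local
  estimate holds.\<close>

lemma angle_le_uniform_local:
  obtains e where "0 < e"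
    "\<And>z1 z2. z1 \<in> M \<Longrightarrow> z2 \<in> M \<Longrightarrow> norm (z1 - z2) < e \<Longrightarrow> angle_le M z1 z2 (4 * \<kappa> * norm (z1 - z2))"
proof -
  define \<G> where "\<G> = {ball p \<epsilon> | p \<epsilon>. p \<in> M \<and> 0 < \<epsilon> \<and>
     (\<forall>z1\<in>M \<inter> ball p \<epsilon>. \<forall>z2\<in>M \<inter> ball p \<epsilon>. angle_le M z1 z2 (4 * \<kappa> * norm (z1 - z2)))}"
  have "M \<subseteq> \<Union>\<G>"
  proof
    fix p assume p: "p \<in> M"
    obtain U \<phi> u where lp: "local_parametrization M U (\<phi> :: real ^ 'd \<Rightarrow> 'a)" "u \<in> U" "p = \<phi> u"
      using chart_at[OF p] .
    obtain \<epsilon> where "0 < \<epsilon>" "\<And>z1 z2. z1 \<in> M \<inter> ball p \<epsilon> \<Longrightarrow> z2 \<in> M \<inter> ball p \<epsilon> \<Longrightarrow>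
       angle_le M z1 z2 (4 * \<kappa> * norm (z1 - z2))"
      unfolding lp(3) by (rule angle_le_local[OF lp(1,2)]) blast
    then have "ball p \<epsilon> \<in> \<G>" "p \<in> ball p \<epsilon>" using p unfolding \<G>_def by blast (simp add: \<open>0 < \<epsilon>\<close>)
    then show "p \<in> \<Union>\<G>" by blast
  qed
  moreover have "\<And>G. G \<in> \<G> \<Longrightarrow> open G" by (auto simp: \<G>_def)
  ultimately obtain e where e: "0 < e" "\<And>x. x \<in> M \<Longrightarrow> \<exists>G\<in>\<G>. ball x e \<subseteq> G"
    using Heine_Borel_lemma[OF compact_M] by metis
  have "angle_le M z1 z2 (4 * \<kappa> * norm (z1 - z2))"
    if z: "z1 \<in> M" "z2 \<in> M" "norm (z1 - z2) < e" for z1 z2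
  proof -
    obtain p \<epsilon> where G: "ball z1 e \<subseteq> ball p \<epsilon>"
       "\<forall>z1\<in>M \<inter> ball p \<epsilon>. \<forall>z2\<in>M \<inter> ball p \<epsilon>. angle_le M z1 z2 (4 * \<kappa> * norm (z1 - z2))"
      using e(2)[OF z(1)] unfolding \<G>_def by blast
    have "z1 \<in> ball z1 e" "z2 \<in> ball z1 e" using z e(1) by (auto simp: dist_norm)
    then show ?thesis using G z by blast
  qed
  with e(1) show ?thesis using that by blast
qed

text \<open>The nearest-point projection maps the segment from \<open>z\<close> to \<open>p\<close> to a path in \<open>M\<close> that is
  only slightly longer, along which the local estimate is chained.\<close>

lemma angle_le_global:
  assumes p: "p \<in> M" and z: "z \<in> M" and small: "\<kappa> * norm (z - p) < 1"
  shows "angle_le M z p (4 * \<kappa> * (norm (z - p) / (1 - \<kappa> * norm (z - p))))"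
proof -
  define \<delta> where "\<delta> = norm (z - p)"
  \<comment> \<open>An upper bound for the length of the projected path: as \<open>p\<close> lies in
    \<open>M\<close>, every point of the segment is within \<delta> of \<open>M\<close>, where the
    nearest-point map has Lipschitz constant \<open>1 / (1 - \<kappa> * \<delta>)\<close>.\<close>
  define L where "L = \<delta> / (1 - \<kappa> * \<delta>)"
  have L: "0 \<le> L" using small by (simp add: L_def \<delta>_def)
  obtain e where e: "0 < e" "\<And>z1 z2. z1 \<in> M \<Longrightarrow> z2 \<in> M \<Longrightarrow> norm (z1 - z2) < e \<Longrightarrow>
      angle_le M z1 z2 (4 * \<kappa> * norm (z1 - z2))"
    by (rule angle_le_uniform_local) blast
  obtain n0 where n0: "L / e < real n0" using reals_Archimedean2 by blast
  define n where "n = Suc n0"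
  have n: "0 < real n" "L / real n < e"
  proof -
    have "L / e < real n" using n0 by (simp add: n_def)
    then show "L / real n < e" using e(1) by (simp add: n_def field_simps)
  qed (simp add: n_def)
  define x where "x i = p + (real i / real n) *\<^sub>R (z - p)" for i
  define \<xi> where "\<xi> y = (SOME x. nearest M y x)" for y
  have \<xi>: "nearest M y (\<xi> y)" for y
    unfolding \<xi>_def using nearest_exists[OF p] by (metis someI)
  have \<xi>_id: "\<xi> y = y" if "y \<in> M" for y
    using \<xi>[of y] that by (auto simp: nearest_def)
  have dist: "norm (x i - \<xi> (x i)) \<le> \<delta>" if "i \<le> n" for i
  proof -
    have "norm (x i - \<xi> (x i)) \<le> norm (x i - p)" using \<xi>[of "x i"] p by (auto simp: nearest_def)
    also have "\<dots> = real i / real n * \<delta>" by (simp add: x_def \<delta>_def)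
    also have "\<dots> \<le> 1 * \<delta>" using that n(1) by (intro mult_right_mono) (auto simp: \<delta>_def)
    finally show ?thesis by simp
  qed
  have step: "norm (\<xi> (x (Suc i)) - \<xi> (x i)) \<le> L / real n" if "Suc i \<le> n" for i
  proof -
    have "(1 - \<kappa> * \<delta>) * norm (\<xi> (x (Suc i)) - \<xi> (x i)) \<le> norm (x (Suc i) - x i)"
      using that by (intro nearest_lipschitz[OF \<xi> \<xi>] dist) auto
    also have "x (Suc i) - x i = (1 / real n) *\<^sub>R (z - p)"
      by (simp add: x_def add_divide_distrib scaleR_left_distrib)
    also have "norm \<dots> = \<delta> / real n" by (simp add: \<delta>_def)
    finally show ?thesis using small n(1) by (simp add: L_def \<delta>_def field_simps)
  qed
  have "angle_le M (\<xi> (x i)) p (4 * \<kappa> * (real i * (L / real n)))" if "i \<le> n" for i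
    using that
  proof (induction i)
    case 0
    then show ?case using \<xi>_id[OF p] by (simp add: x_def angle_le_def tangent_normal_inner)
  next
    case (Suc i)
    have "norm (\<xi> (x (Suc i)) - \<xi> (x i)) < e" using step[of i] Suc.prems n(2) by linarith
    then have "angle_le M (\<xi> (x (Suc i))) (\<xi> (x i)) (4 * \<kappa> * norm (\<xi> (x (Suc i)) - \<xi> (x i)))"
      using \<xi> by (intro e(2)) (auto simp: nearest_def)
    from angle_le_triangle[OF this Suc.IH]
    have *: "angle_le M (\<xi> (x (Suc i))) p
       (4 * \<kappa> * norm (\<xi> (x (Suc i)) - \<xi> (x i)) + 4 * \<kappa> * (real i * (L / real n)))"
      using Suc.prems kappa_pos L n(1) by simp
    have le: "4 * \<kappa> * norm (\<xi> (x (Suc i)) - \<xi> (x i)) + 4 * \<kappa> * (real i * (L / real n))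
        \<le> 4 * \<kappa> * (real (Suc i) * (L / real n))"
      using mult_left_mono[OF step[of i], of "4 * \<kappa>"] Suc.prems kappa_pos by (simp add: algebra_simps add_divide_distrib)
    show ?case unfolding angle_le_def
    proof (intro ballI)
      fix w \<nu> assume "w \<in> tangent_space M (\<xi> (x (Suc i)))" "\<nu> \<in> normal_vectors M p"
      then have "\<bar>w \<bullet> \<nu>\<bar> \<le> (4 * \<kappa> * norm (\<xi> (x (Suc i)) - \<xi> (x i)) + 4 * \<kappa> * (real i * (L / real n))) * norm w * norm \<nu>"
        using * unfolding angle_le_def by blast
      also have "\<dots> \<le> 4 * \<kappa> * (real (Suc i) * (L / real n)) * norm w * norm \<nu>"
        by (intro mult_right_mono le) auto
      finally show "\<bar>w \<bullet> \<nu>\<bar> \<le> 4 * \<kappa> * (real (Suc i) * (L / real n)) * norm w * norm \<nu>" .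
    qed
  qed
  from this[of n] have "angle_le M (\<xi> (x n)) p (4 * \<kappa> * L)" using n(1) by simp
  moreover have "x n = z" using n(1) by (simp add: x_def)
  ultimately show ?thesis using \<xi>_id[OF z] by (simp add: L_def \<delta>_def)
qed

text \<open>The chord is split at its own end point \<open>z1\<close>: the tangential part pays for
  the angle between \<open>z1\<close> and \<open>p\<close>, the normal part for the curvature along
  the chord.\<close>

lemma chord_normal_le:
  assumes z1: "z1 \<in> M" and z2: "z2 \<in> M" and ang: "angle_le M z1 p c" and c: "0 \<le> c"
    and \<nu>: "\<nu> \<in> normal_vectors M p"
  shows "\<bar>(z2 - z1) \<bullet> \<nu>\<bar> \<le> (c + \<kappa> / 2 * norm (z2 - z1)) * norm (z2 - z1) * norm \<nu>"
proof -
  obtain t n where tn: "t \<in> tangent_space M z1" "n \<in> normal_vectors M z1" "z2 - z1 = t + n"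
      "(norm (z2 - z1))\<^sup>2 = (norm t)\<^sup>2 + (norm n)\<^sup>2"
    using tangent_normal_decomp by metis
  have n: "norm n \<le> \<kappa> / 2 * (norm (z2 - z1))\<^sup>2"
    by (rule normal_component_le[OF tn(1,2)])
       (use normal_vectors_inner_le[OF z1 tn(2) z2] tn(3) kappa_pos in simp_all)
  have t: "norm t \<le> norm (z2 - z1)" using tn(4) by (auto intro: power2_le_imp_le)
  have "\<bar>(z2 - z1) \<bullet> \<nu>\<bar> \<le> \<bar>t \<bullet> \<nu>\<bar> + \<bar>n \<bullet> \<nu>\<bar>" unfolding tn(3) by (simp add: inner_add)
  also have "\<bar>n \<bullet> \<nu>\<bar> \<le> norm n * norm \<nu>" by (rule Cauchy_Schwarz_ineq2)
  also have "\<dots> \<le> \<kappa> / 2 * (norm (z2 - z1))\<^sup>2 * norm \<nu>" using n by (intro mult_right_mono) auto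
  also have "\<bar>t \<bullet> \<nu>\<bar> \<le> c * norm t * norm \<nu>" using ang tn(1) \<nu> unfolding angle_le_def by blast
  also have "\<dots> \<le> c * norm (z2 - z1) * norm \<nu>" using t c by (intro mult_right_mono mult_left_mono) auto
  finally show ?thesis by (simp add: algebra_simps power2_eq_square)
qed

end

section \<open>Near-isometric projection of a piece of the manifold to one tangent space\<close>

section \<open>Projection to a tangent space\<close>

lemma (in compact_reach_submanifold) dim_tangent_space:
  assumes "p \<in> M"
  shows "dim (tangent_space M p) = CARD('d)"
proof -
  obtain U \<phi> u where lp: "local_parametrization M U (\<phi> :: real ^ 'd \<Rightarrow> 'a)" "u \<in> U" "p = \<phi> u"
    using chart_at[OF assms] .
  have lin: "linear (frechet_derivative \<phi> (at u))"
    using local_parametrization_has_derivative[OF lp(1,2)] has_derivative_linear by blast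
  have "inj (frechet_derivative \<phi> (at u))" using lp unfolding local_parametrization_def by blast
  then have "dim (range (frechet_derivative \<phi> (at u))) = dim (UNIV :: (real ^ 'd) set)"
    using lin by (intro dim_image_eq) auto
  then show ?thesis unfolding lp(3) tangent_space_local_parametrization[OF lp(1,2)] by simp
qed

lemma (in compact_reach_submanifold) tangent_isometry:
  assumes "p \<in> M" "CARD('e::finite) = CARD('d)"
  obtains Q :: "real ^ 'e \<Rightarrow> 'a" where "linear Q" "range Q = tangent_space M p" "\<And>x. norm (Q x) = norm x"
proof (rule isometry_subspaces[of "UNIV :: (real ^ 'e) set" "tangent_space M p"])
  show "dim (UNIV :: (real ^ 'e) set) = dim (tangent_space M p)"
    using assms by (simp add: dim_tangent_space)
qed (use that subspace_tangent_space in auto)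

lemma linear_isometry_inner:
  fixes Q :: "'b::real_inner \<Rightarrow> 'a::real_inner"
  assumes "linear Q" "\<And>x. norm (Q x) = norm x"
  shows "Q x \<bullet> Q y = x \<bullet> y"
  unfolding dot_norm by (simp add: assms linear_add[OF assms(1), symmetric])

lemma adjoint_isometry:
  fixes Q :: "'b::euclidean_space \<Rightarrow> 'a::euclidean_space"
  assumes "linear Q" "\<And>x. norm (Q x) = norm x"
  shows "adjoint Q (Q x) = x"
proof -
  have "y \<bullet> adjoint Q (Q x) = y \<bullet> x" for y
    using adjoint_works[OF assms(1), of y "Q x"] linear_isometry_inner[OF assms] by simp
  then show ?thesis using vector_eq_ldot[of "adjoint Q (Q x)" x] by blast
qed

text \<open>\<open>Q\<close> parametrizes the tangent space at \<open>p\<close> isometrically, so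
  \<open>adjoint Q\<close> is the orthogonal projection to it read in coordinates. The bound 1 / 120
  on \<open>\<kappa> * r\<close> is the first half of assumption (v).\<close>

locale tangent_projection = compact_reach_submanifold M \<kappa> dty
  for M :: "'a::euclidean_space set" and \<kappa> and dty :: "'d::finite itself" +
  fixes p :: 'a and r :: real and Q :: "real ^ 'e::{finite, wellorder} \<Rightarrow> 'a"
  assumes pM: "p \<in> M" and r_pos: "0 < r" and kr: "\<kappa> * r \<le> 1 / 120"
    and linear_Q: "linear Q" and range_Q: "range Q = tangent_space M p" and norm_Q: "\<And>x. norm (Q x) = norm x"
    and card_e: "CARD('e) = CARD('d)"
begin

definition proj :: "'a \<Rightarrow> (real, 'e) vec" where
  "proj z = adjoint Q (z - p)"

text \<open>Relative loss of length under projection. Sines of angles will be at most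
  \<open>17 * (\<kappa> * r)\<close>, and 17^2 = 289 is rounded up to 300.\<close>

definition \<eta> :: real where "\<eta> = 300 * (\<kappa> * r)\<^sup>2"

lemma kr_sq_le: "(\<kappa> * r)\<^sup>2 \<le> 1 / 14400"
proof -
  have "(\<kappa> * r)\<^sup>2 \<le> (1 / 120)\<^sup>2" using kr kappa_pos r_pos by (intro power_mono) auto
  then show ?thesis by (simp add: power2_eq_square)
qed

lemma eta: "0 < \<eta>" "\<eta> \<le> 1 / 48"
  using kr_sq_le kappa_pos r_pos by (auto simp: \<eta>_def)

lemma linear_adjoint_Q: "linear (adjoint Q)"
  by (rule adjoint_linear[OF linear_Q])

lemma proj_p: "proj p = 0"
  by (simp add: proj_def linear_0[OF linear_adjoint_Q])

lemma proj_diff: "proj z1 - proj z2 = adjoint Q (z1 - z2)"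
  by (simp add: proj_def linear_diff[OF linear_adjoint_Q, symmetric])

lemma adjoint_Q_norm:
  assumes "t \<in> tangent_space M p" "n \<in> normal_vectors M p"
  shows "norm (adjoint Q (t + n)) = norm t"
proof -
  obtain x where x: "t = Q x" using assms range_Q by auto
  have "y \<bullet> adjoint Q n = 0" for y
    using adjoint_works[OF linear_Q, of y n] tangent_normal_inner[OF _ assms(2), of "Q y"] range_Q by auto
  then have "adjoint Q n = 0" using inner_eq_zero_iff by blast
  then show ?thesis
    using adjoint_isometry[OF linear_Q norm_Q] norm_Q by (simp add: linear_add[OF linear_adjoint_Q] x)
qed

lemma adjoint_Q_le: "norm (adjoint Q v) \<le> norm v"
proof -
  obtain t n where tn: "t \<in> tangent_space M p" "n \<in> normal_vectors M p" "v = t + n"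
      "(norm v)\<^sup>2 = (norm t)\<^sup>2 + (norm n)\<^sup>2"
    using tangent_normal_decomp by metis
  then show ?thesis
    using adjoint_Q_norm[OF tn(1,2)] by (auto intro: power2_le_imp_le)
qed

text \<open>By Pythagoras the tangential part loses only the square of the sine;
  \<open>(1 - \<eta>)\<^sup>2 \<le> 1 - \<eta>\<close> then allows the root to be taken without
  square roots.\<close>

lemma adjoint_Q_ge:
  assumes "\<And>\<nu>. \<nu> \<in> normal_vectors M p \<Longrightarrow> \<bar>v \<bullet> \<nu>\<bar> \<le> 17 * (\<kappa> * r) * norm v * norm \<nu>"
  shows "(1 - \<eta>) * norm v \<le> norm (adjoint Q v)"
proof -
  obtain t n where tn: "t \<in> tangent_space M p" "n \<in> normal_vectors M p" "v = t + n"
      "(norm v)\<^sup>2 = (norm t)\<^sup>2 + (norm n)\<^sup>2"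
    using tangent_normal_decomp by metis
  have "norm n \<le> 17 * (\<kappa> * r) * norm v"
    by (rule normal_component_le[OF tn(1,2)]) (use assms[OF tn(2)] tn(3) kappa_pos r_pos in simp_all)
  then have "(norm n)\<^sup>2 \<le> (17 * (\<kappa> * r) * norm v)\<^sup>2" by (intro power_mono) auto
  also have "\<dots> = 289 * (\<kappa> * r)\<^sup>2 * (norm v)\<^sup>2" by (simp add: power_mult_distrib)
  also have "\<dots> \<le> \<eta> * (norm v)\<^sup>2" unfolding \<eta>_def by (intro mult_right_mono) auto
  finally have t: "(1 - \<eta>) * (norm v)\<^sup>2 \<le> (norm t)\<^sup>2" using tn(4) by (simp add: algebra_simps)
  have "((1 - \<eta>) * norm v)\<^sup>2 = (1 - \<eta>) * ((1 - \<eta>) * (norm v)\<^sup>2)" by (simp add: power2_eq_square)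
  also have "\<dots> \<le> 1 * ((1 - \<eta>) * (norm v)\<^sup>2)" using eta by (intro mult_right_mono) auto
  finally have "((1 - \<eta>) * norm v)\<^sup>2 \<le> (norm t)\<^sup>2" using t by simp
  then have "(1 - \<eta>) * norm v \<le> norm t" by (rule power2_le_imp_le) simp
  then show ?thesis using adjoint_Q_norm[OF tn(1,2)] tn(3) by simp
qed

text \<open>The radius 3.3 r contains all balls needed later: base points at most 2.1 r apart and
  radii up to 1.1 r. There \<open>\<kappa> * \<delta>\<close> is at most 0.0275, and 3.3 / 0.9725 is
  below 3.4, whence 4 * 3.4 = 13.6.\<close>

lemma angle_le_near:
  assumes z: "z \<in> M \<inter> cball p (3.3 * r)"
  shows "angle_le M z p (13.6 * (\<kappa> * r))"
proof -
  define \<delta> where "\<delta> = norm (z - p)"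
  have \<delta>: "0 \<le> \<delta>" "\<delta> \<le> 3.3 * r" using z by (auto simp: \<delta>_def dist_norm norm_minus_commute)
  have "\<kappa> * \<delta> \<le> \<kappa> * (3.3 * r)" using \<delta> kappa_pos by (intro mult_left_mono) auto
  also have "\<dots> \<le> 0.0275" using kr by simp
  finally have k\<delta>: "\<kappa> * \<delta> \<le> 0.0275" .
  have ang: "angle_le M z p (4 * \<kappa> * (\<delta> / (1 - \<kappa> * \<delta>)))"
    using angle_le_global[OF pM, of z] z k\<delta> by (simp add: \<delta>_def)
  have "\<delta> / (1 - \<kappa> * \<delta>) \<le> 3.3 * r / 0.9725" using \<delta> k\<delta> r_pos by (intro frac_le) auto
  also have "\<dots> \<le> 3.4 * r" using r_pos by simp
  finally have le: "4 * \<kappa> * (\<delta> / (1 - \<kappa> * \<delta>)) \<le> 13.6 * (\<kappa> * r)"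
    using mult_left_mono[of "\<delta> / (1 - \<kappa> * \<delta>)" "3.4 * r" "4 * \<kappa>"] kappa_pos by simp
  show ?thesis unfolding angle_le_def
  proof (intro ballI)
    fix w \<nu> assume "w \<in> tangent_space M z" "\<nu> \<in> normal_vectors M p"
    then have "\<bar>w \<bullet> \<nu>\<bar> \<le> 4 * \<kappa> * (\<delta> / (1 - \<kappa> * \<delta>)) * norm w * norm \<nu>"
      using ang unfolding angle_le_def by blast
    also have "\<dots> \<le> 13.6 * (\<kappa> * r) * norm w * norm \<nu>" by (intro mult_right_mono le) auto
    finally show "\<bar>w \<bullet> \<nu>\<bar> \<le> 13.6 * (\<kappa> * r) * norm w * norm \<nu>" .
  qed
qed

lemma adjoint_Q_tangent_ge:
  assumes z: "z \<in> M \<inter> cball p (3.3 * r)" and w: "w \<in> tangent_space M z"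
  shows "(1 - \<eta>) * norm w \<le> norm (adjoint Q w)"
proof (rule adjoint_Q_ge)
  fix \<nu> assume "\<nu> \<in> normal_vectors M p"
  then have "\<bar>w \<bullet> \<nu>\<bar> \<le> 13.6 * (\<kappa> * r) * norm w * norm \<nu>"
    using angle_le_near[OF z] w unfolding angle_le_def by blast
  also have "\<dots> \<le> 17 * (\<kappa> * r) * norm w * norm \<nu>"
    using kappa_pos r_pos by (intro mult_right_mono) auto
  finally show "\<bar>w \<bullet> \<nu>\<bar> \<le> 17 * (\<kappa> * r) * norm w * norm \<nu>" .
qed

lemma proj_le: "norm (proj z1 - proj z2) \<le> norm (z1 - z2)"
  unfolding proj_diff by (rule adjoint_Q_le)

text \<open>A chord here has length at most 6.6 r, so its curvature term is at most 3.3 \<kappa> r;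
  with 13.6 \<kappa> r for the angle the sum stays below 17 \<kappa> r.\<close>

lemma proj_ge:
  assumes z1: "z1 \<in> M \<inter> cball p (3.3 * r)" and z2: "z2 \<in> M \<inter> cball p (3.3 * r)"
  shows "(1 - \<eta>) * norm (z1 - z2) \<le> norm (proj z1 - proj z2)"
  unfolding proj_diff
proof (rule adjoint_Q_ge)
  fix \<nu> assume \<nu>: "\<nu> \<in> normal_vectors M p"
  have "norm (z1 - z2) \<le> norm (z1 - p) + norm (p - z2)" using norm_triangle_ineq[of "z1 - p" "p - z2"] by simp
  also have "\<dots> \<le> 6.6 * r" using z1 z2 by (simp add: dist_norm norm_minus_commute)
  finally have "\<kappa> / 2 * norm (z1 - z2) \<le> \<kappa> / 2 * (6.6 * r)" using kappa_pos by (intro mult_left_mono) auto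
  also have "\<dots> = 3.3 * (\<kappa> * r)" by simp
  finally have le: "13.6 * (\<kappa> * r) + \<kappa> / 2 * norm (z1 - z2) \<le> 17 * (\<kappa> * r)"
    using mult_pos_pos[OF kappa_pos r_pos] by linarith
  have "\<bar>(z1 - z2) \<bullet> \<nu>\<bar> \<le> (13.6 * (\<kappa> * r) + \<kappa> / 2 * norm (z1 - z2)) * norm (z1 - z2) * norm \<nu>"
    using chord_normal_le[OF _ _ angle_le_near[OF z2] _ \<nu>, of z1] z1 z2 kappa_pos r_pos by auto
  also have "\<dots> \<le> 17 * (\<kappa> * r) * norm (z1 - z2) * norm \<nu>" by (intro mult_right_mono le) auto
  finally show "\<bar>(z1 - z2) \<bullet> \<nu>\<bar> \<le> 17 * (\<kappa> * r) * norm (z1 - z2) * norm \<nu>" .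
qed

lemma continuous_proj: "continuous_on S proj"
  unfolding proj_def
  by (intro continuous_on_compose2[OF linear_continuous_on[OF linear_conv_bounded_linear[THEN iffD1, OF linear_adjoint_Q]]]
       continuous_intros) auto

lemma inj_on_proj: "inj_on proj (M \<inter> cball p (3.3 * r))"
proof (rule inj_onI)
  fix x y assume "x \<in> M \<inter> cball p (3.3 * r)" "y \<in> M \<inter> cball p (3.3 * r)" "proj x = proj y"
  then have "(1 - \<eta>) * norm (x - y) \<le> 0" using proj_ge[of x y] by simp
  then show "x = y" using eta by (simp add: mult_le_0_iff)
qed

text \<open>Invariance of domain for \<open>proj \<circ> \<phi>\<close>, a continuous map between
  spaces of equal dimension that is injective by the lower bound on projected chords.\<close>

lemma open_proj_image:
  assumes "\<rho> \<le> 3.3 * r"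
  shows "open (proj ` (M \<inter> ball p \<rho>))"
proof (subst open_subopen, intro ballI)
  fix v assume "v \<in> proj ` (M \<inter> ball p \<rho>)"
  then obtain z where z: "z \<in> M" "z \<in> ball p \<rho>" "v = proj z" by blast
  obtain U \<phi> u where lp: "local_parametrization M U (\<phi> :: real ^ 'd \<Rightarrow> 'a)" "u \<in> U" "z = \<phi> u"
    using chart_at[OF z(1)] .
  obtain \<psi> where hom: "homeomorphism U (\<phi> ` U) \<phi> \<psi>" and op: "openin (top_of_set M) (\<phi> ` U)" and oU: "open U"
    using lp(1) unfolding local_parametrization_def by blast
  have cont: "continuous_on U \<phi>" using hom by (simp add: homeomorphism_def)
  define U' where "U' = U \<inter> \<phi> -` ball p \<rho>"
  have oU': "open U'" unfolding U'_def using continuous_open_preimage[OF cont oU open_ball] .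
  have sub: "\<phi> ` U' \<subseteq> M \<inter> ball p \<rho>" using op openin_imp_subset by (fastforce simp: U'_def)
  have "inj_on \<phi> U'" using hom unfolding U'_def by (metis homeomorphism_def inj_on_Int inj_on_inverseI)
  moreover have "inj_on proj (\<phi> ` U')"
    using assms by (intro inj_on_subset[OF inj_on_proj]) (use sub in force)
  ultimately have "inj_on (proj \<circ> \<phi>) U'" by (rule comp_inj_on)
  moreover have "continuous_on U' (proj \<circ> \<phi>)"
    by (intro continuous_on_compose continuous_proj continuous_on_subset[OF cont]) (auto simp: U'_def)
  ultimately have "open ((proj \<circ> \<phi>) ` U')"
    using oU' card_e by (intro invariance_of_domain_gen) auto
  moreover have "v \<in> (proj \<circ> \<phi>) ` U'" using z lp by (auto simp: U'_def)
  moreover have "(proj \<circ> \<phi>) ` U' \<subseteq> proj ` (M \<inter> ball p \<rho>)" using sub by (auto simp: image_comp[symmetric])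
  ultimately show "\<exists>T. open T \<and> v \<in> T \<and> T \<subseteq> proj ` (M \<inter> ball p \<rho>)" by blast
qed

text \<open>A connectedness argument. The image of the open piece is open, and so is the complement
  of the image of the closed piece. Inside the ball they are disjoint and exhaustive, since a point
  projecting into it cannot lie on the boundary of the piece. The first set contains 0, so the
  second misses the ball.\<close>

lemma proj_surj:
  assumes \<rho>: "0 < \<rho>" "\<rho> \<le> 3.3 * r"
  shows "ball 0 ((1 - \<eta>) * \<rho>) \<subseteq> proj ` (M \<inter> ball p \<rho>)"
proof -
  let ?B = "ball (0 :: (real, 'e) vec) ((1 - \<eta>) * \<rho>)"
  let ?A1 = "proj ` (M \<inter> ball p \<rho>)" and ?A2 = "- (proj ` (M \<inter> cball p \<rho>))"
  have "open ?A2"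
    using compact_continuous_image[OF continuous_proj compact_Int_closed[OF compact_M closed_cball]]
    by (simp add: compact_imp_closed open_Compl)
  moreover have "open ?A1" using \<rho>(2) by (rule open_proj_image)
  moreover have cov: "?B \<subseteq> ?A1 \<union> ?A2"
  proof
    fix v assume v: "v \<in> ?B"
    show "v \<in> ?A1 \<union> ?A2"
    proof (rule ccontr)
      assume n: "v \<notin> ?A1 \<union> ?A2"
      then obtain z where z: "z \<in> M" "z \<in> cball p \<rho>" "v = proj z" by blast
      have "(1 - \<eta>) * norm (z - p) \<le> norm (proj z - proj p)"
        using z pM \<rho> r_pos by (intro proj_ge) auto
      also have "\<dots> < (1 - \<eta>) * \<rho>" using v z(3) by (simp add: proj_p)
      finally have "z \<in> ball p \<rho>" using eta by (simp add: dist_norm norm_minus_commute)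
      then show False using n z by blast
    qed
  qed
  moreover have "?A1 \<inter> ?A2 \<inter> ?B = {}" by auto
  moreover have "?A1 \<inter> ?B \<noteq> {}"
  proof -
    have "0 \<in> ?A1" using pM \<rho> proj_p by (intro image_eqI[of _ _ p]) auto
    moreover have "0 \<in> ?B" using eta \<rho> by simp
    ultimately show ?thesis by blast
  qed
  ultimately have "?A2 \<inter> ?B = {}"
    using connectedD[OF connected_ball, of ?A1 ?A2 0 "(1 - \<eta>) * \<rho>"] by blast
  then show ?thesis using cov by blast
qed

end

section \<open>Riemannian against Lebesgue volume under the projection\<close>

section \<open>Reindexing coordinates\<close>

text \<open>The change-of-variables theorem of the library needs a well-ordered index type, so volumes are
  computed in \<open>real ^ 'e\<close> for a well-ordered copy \<open>'e\<close> of \<open>'d\<close>.\<close>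

definition reindex :: "('d \<Rightarrow> 'e) \<Rightarrow> (real, 'e::finite) vec \<Rightarrow> (real, 'd::finite) vec" where
  "reindex \<sigma> x = (\<chi> i. x $ \<sigma> i)"

lemma linear_reindex: "linear (reindex \<sigma>)"
  by (rule linearI) (auto simp: reindex_def vec_eq_iff)

lemma reindex_axis:
  assumes "bij \<sigma>"
  shows "reindex \<sigma> (axis (\<sigma> i) c) = axis i c"
  using assms by (auto simp: reindex_def axis_def vec_eq_iff bij_def inj_eq)

lemma bij_reindex:
  assumes "bij (\<sigma> :: 'd::finite \<Rightarrow> 'e::finite)"
  shows "bij (reindex \<sigma>)"
proof (rule bijI)
  show "inj (reindex \<sigma>)"
    using assms by (auto simp: reindex_def inj_def vec_eq_iff) (metis bij_pointE)
  show "surj (reindex \<sigma>)"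
  proof (rule surjI)
    fix y :: "real ^ 'd"
    show "reindex \<sigma> (\<chi> k. y $ inv \<sigma> k) = y"
      using assms by (simp add: reindex_def vec_eq_iff bij_def)
  qed
qed

lemma measurable_reindex [measurable]: "reindex \<sigma> \<in> borel_measurable borel"
  by (intro borel_measurable_continuous_onI linear_continuous_on linear_conv_bounded_linear[THEN iffD1] linear_reindex)

lemma prod_Basis_vec:
  fixes f :: "(real, 'n::finite) vec \<Rightarrow> real"
  shows "(\<Prod>b\<in>Basis. f b) = (\<Prod>k\<in>UNIV. f (axis k 1))"
proof -
  have B: "(Basis :: (real, 'n) vec set) = range (\<lambda>k. axis k 1)" by (auto simp: Basis_vec_def)
  show ?thesis unfolding B by (subst prod.reindex) (auto simp: inj_def axis_eq_axis)
qed

lemma lborel_distr_reindex: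
  assumes bij: "bij (\<sigma> :: 'd::finite \<Rightarrow> 'e::finite)"
  shows "lborel = distr lborel borel (reindex \<sigma>)"
proof (rule lborel_eqI)
  fix l u :: "real ^ 'd" assume "\<And>b. b \<in> Basis \<Longrightarrow> l \<bullet> b \<le> u \<bullet> b"
  then have le: "l $ i \<le> u $ i" for i by (metis axis_in_Basis_iff cart_eq_inner_axis insertI1 Basis_real_def)
  define l' u' :: "real ^ 'e" where "l' = (\<chi> k. l $ inv \<sigma> k)" and "u' = (\<chi> k. u $ inv \<sigma> k)"
  have inv: "inv \<sigma> (\<sigma> i) = i" for i using bij by (simp add: bij_def)
  have surj: "\<exists>i. k = \<sigma> i" for k using bij by (metis bij_pointE)
  have "reindex \<sigma> -` box l u = box l' u'"
    by (auto simp: mem_box_cart l'_def u'_def reindex_def) (metis inv surj)+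
  then have "emeasure (distr lborel borel (reindex \<sigma>)) (box l u) = emeasure lborel (box l' u')"
    by (subst emeasure_distr) auto
  also have "\<dots> = ennreal (\<Prod>b\<in>Basis. (u' - l') \<bullet> b)"
    by (rule emeasure_lborel_box) (auto simp: Basis_vec_def inner_axis l'_def u'_def le)
  also have "(\<Prod>b\<in>Basis. (u' - l') \<bullet> b) = (\<Prod>k\<in>UNIV. u' $ k - l' $ k)"
    unfolding prod_Basis_vec by (simp add: inner_axis)
  also have "\<dots> = (\<Prod>i\<in>UNIV. u $ i - l $ i)"
    using bij by (intro prod.reindex_bij_betw[of \<sigma> UNIV UNIV "\<lambda>k. u' $ k - l' $ k", symmetric, THEN trans])
       (auto simp: l'_def u'_def inv)
  also have "\<dots> = (\<Prod>b\<in>Basis. (u - l) \<bullet> b)"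
    unfolding prod_Basis_vec by (simp add: inner_axis)
  finally show "emeasure (distr lborel borel (reindex \<sigma>)) (box l u) = (\<Prod>b\<in>Basis. (u - l) \<bullet> b)" .
qed simp

text \<open>Conjugation with \<sigma> is a bijection between the permutations of the two index types
  that preserves signs, so the Leibniz sums agree term by term.\<close>

lemma det_reindex:
  fixes A :: "real ^ 'd::finite ^ 'd" and \<sigma> :: "'d \<Rightarrow> 'e::finite"
  assumes bij: "bij \<sigma>"
  shows "det (\<chi> k l. A $ inv \<sigma> k $ inv \<sigma> l :: real ^ 'e ^ 'e) = det A"
proof -
  define h where "h p = \<sigma> \<circ> p \<circ> inv \<sigma>" for p :: "'d \<Rightarrow> 'd"
  have inv: "inv \<sigma> (\<sigma> i) = i" "\<sigma> (inv \<sigma> k) = k" for i k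
    using bij by (auto simp: bij_def surj_f_inv_f)
  have h: "h p = map_permutation UNIV \<sigma> p" for p
    using bij by (auto simp: h_def map_permutation_def restrict_id_def fun_eq_iff bij_def)
  have "bij_betw h {p. p permutes UNIV} {p. p permutes UNIV}"
  proof (rule bij_betw_byWitness[where f' = "\<lambda>q. inv \<sigma> \<circ> q \<circ> \<sigma>"])
    have b: "bij (inv \<sigma>)" using bij by (rule bij_imp_bij_inv)
    have perm: "p permutes UNIV \<longleftrightarrow> bij p" for p :: "'c \<Rightarrow> 'c"
      using permutes_bij[of p UNIV] bij_imp_permutes[of p UNIV] by blast
    show "h ` {p. p permutes UNIV} \<subseteq> {p. p permutes UNIV}"
      using bij b by (auto simp: h_def perm intro!: bij_comp)
    show "(\<lambda>q. inv \<sigma> \<circ> q \<circ> \<sigma>) ` {p. p permutes UNIV} \<subseteq> {p. p permutes UNIV}"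
      using bij b by (auto simp: perm intro!: bij_comp)
  qed (auto simp: h_def fun_eq_iff inv)
  then have "det (\<chi> k l. A $ inv \<sigma> k $ inv \<sigma> l :: real ^ 'e ^ 'e)
     = (\<Sum>p | p permutes (UNIV :: 'd set). of_int (sign (h p)) * (\<Prod>k\<in>UNIV. A $ inv \<sigma> k $ inv \<sigma> (h p k)))"
    unfolding det_def by (subst sum.reindex_bij_betw[symmetric, of h]) auto
  also have "\<dots> = det A" unfolding det_def
  proof (rule sum.cong[OF refl])
    fix p :: "'d \<Rightarrow> 'd" assume "p \<in> {p. p permutes UNIV}"
    then have "sign (h p) = sign p"
      unfolding h using bij by (intro sign_map_permutation) (auto simp: bij_def)
    moreover have "(\<Prod>k\<in>UNIV. A $ inv \<sigma> k $ inv \<sigma> (h p k)) = (\<Prod>i\<in>UNIV. A $ i $ p i)"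
      using bij by (subst prod.reindex_bij_betw[of \<sigma> UNIV UNIV, symmetric]) (auto simp: h_def inv)
    ultimately show "of_int (sign (h p)) * (\<Prod>k\<in>UNIV. A $ inv \<sigma> k $ inv \<sigma> (h p k)) =
       of_int (sign p) * (\<Prod>i\<in>UNIV. A $ i $ p i)" by simp
  qed
  finally show ?thesis .
qed

section \<open>Determinants of near isometries\<close>

text \<open>The determinant is read as the factor by which \<open>B\<close> changes the volume of
  the unit ball, whose image stays in the unit ball.\<close>

lemma abs_det_le_1:
  fixes B :: "real ^ 'e::{finite, wellorder} \<Rightarrow> real ^ 'e::_"
  assumes lin: "linear B" and le: "\<And>v. norm (B v) \<le> norm v"
  shows "\<bar>det (matrix B)\<bar> \<le> 1"
proof -
  have "\<bar>det (matrix B)\<bar> * measure lebesgue (cball (0 :: (real, 'e) vec) 1) = measure lebesgue (B ` cball 0 1)"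
    by (simp add: measure_linear_image[OF lin])
  also have "\<dots> \<le> measure lebesgue (cball (0 :: (real, 'e) vec) 1)"
    using le by (intro measure_mono_fmeasurable fmeasurableD[OF measurable_linear_image[OF lin]]) (auto intro: order_trans[OF le])
  finally show ?thesis using content_cball_pos[of 1 "0 :: (real, 'e) vec"] by simp
qed

text \<open>The same reading from below: \<open>B\<close> is onto, and the image of the unit ball
  contains the ball of radius \<open>c\<close>.\<close>

lemma abs_det_ge_power:
  fixes B :: "real ^ 'e::{finite, wellorder} \<Rightarrow> real ^ 'e::_"
  assumes lin: "linear B" and c: "0 < c" and ge: "\<And>v. c * norm v \<le> norm (B v)"
  shows "c ^ CARD('e) \<le> \<bar>det (matrix B)\<bar>"
proof -
  have inj: "inj B"
  proof (subst linear_injective_0[OF lin], intro allI impI)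
    fix v assume "B v = 0"
    then have "c * norm v \<le> 0" using ge[of v] by simp
    then show "v = 0" using c by (simp add: mult_le_0_iff)
  qed
  then have surj: "surj B" using linear_injective_imp_surjective[OF lin] by simp
  have sub: "cball 0 c \<subseteq> B ` cball 0 1"
  proof
    fix y :: "(real, 'e) vec" assume y: "y \<in> cball 0 c"
    obtain x where x: "y = B x" using surj by blast
    have "c * norm x \<le> c" using ge[of x] x y by simp
    then have "norm x \<le> 1" using c by simp
    then show "y \<in> B ` cball 0 1" using x by auto
  qed
  have "c ^ CARD('e) * measure lebesgue (cball (0 :: (real, 'e) vec) 1) = measure lebesgue (cball (0 :: (real, 'e) vec) c)"
    using c by (simp add: content_cball)
  also have "\<dots> \<le> measure lebesgue (B ` cball 0 1)"
    by (intro measure_mono_fmeasurable sub measurable_linear_image[OF lin]) auto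
  also have "\<dots> = \<bar>det (matrix B)\<bar> * measure lebesgue (cball (0 :: (real, 'e) vec) 1)"
    by (simp add: measure_linear_image[OF lin])
  finally show ?thesis using content_cball_pos[of 1 "0 :: (real, 'e) vec"] by simp
qed

lemma det_gram:
  fixes A :: "real ^ 'e::finite \<Rightarrow> real ^ 'e"
  shows "det (\<chi> k l. A (axis k 1) \<bullet> A (axis l 1)) = (det (matrix A))\<^sup>2"
proof -
  have "(\<chi> k l. A (axis k 1) \<bullet> A (axis l 1)) = transpose (matrix A) ** matrix A"
    by (simp add: vec_eq_iff matrix_matrix_mult_def transpose_def matrix_def inner_vec_def)
  then show ?thesis by (simp add: det_mul det_transpose power2_eq_square)
qed

text \<open>An isometry \<open>R\<close> onto the range of \<open>L\<close> makes everything square: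
  the chart differential becomes \<open>R \<circ> A\<close>, so the Gram root is the absolute
  determinant of \<open>A\<close>. The Jacobian of the projected chart has the extra factor
  \<open>B = adjoint Q \<circ> R\<close>, which shrinks lengths by a factor between \<open>c\<close>
  and 1.\<close>

lemma jacobian_bounds:
  fixes L :: "real ^ 'd::finite \<Rightarrow> 'a::euclidean_space" and Q :: "real ^ 'e::{finite, wellorder} \<Rightarrow> 'a"
  assumes linL: "linear L" and injL: "inj L" and linQ: "linear Q" and Q: "\<And>x. norm (Q x) = norm x"
    and bij: "bij (\<sigma> :: 'd \<Rightarrow> 'e)" and c: "0 < c"
    and ge: "\<And>w. w \<in> range L \<Longrightarrow> c * norm w \<le> norm (adjoint Q w)"
    and le: "\<And>w. norm (adjoint Q w) \<le> norm w"
  defines "g \<equiv> sqrt (det (\<chi> i j. L (axis i 1) \<bullet> L (axis j 1)))"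
    and "J \<equiv> \<bar>det (matrix (adjoint Q \<circ> L \<circ> reindex \<sigma>))\<bar>"
  shows "J \<le> g" "c ^ CARD('e) * g \<le> J"
proof -
  have card: "CARD('d) = CARD('e)" using bij by (rule bij_betw_same_card)
  have "dim (range L) = dim (UNIV :: (real ^ 'd) set)" using linL injL by (intro dim_image_eq) auto
  then have dim: "dim (UNIV :: (real, 'e) vec set) = dim (range L)" by (simp add: card)
  obtain R :: "(real, 'e) vec \<Rightarrow> 'a" where R: "linear R" "range R = range L" "\<And>x. norm (R x) = norm x"
    by (rule isometry_subspaces[OF subspace_UNIV linear_subspace_image[OF linL subspace_UNIV] dim]) auto
  define A where "A = adjoint R \<circ> L \<circ> reindex \<sigma>"
  have linLJ: "linear (L \<circ> reindex \<sigma>)" by (rule linear_compose[OF linear_reindex linL])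
  have RA: "L (reindex \<sigma> x) = R (A x)" for x
  proof -
    obtain y where "L (reindex \<sigma> x) = R y" using R(2) by (metis rangeE rangeI)
    then show ?thesis using adjoint_isometry[OF R(1,3)] by (simp add: A_def)
  qed
  have linA: "linear A"
    unfolding A_def comp_assoc by (rule linear_compose[OF linLJ adjoint_linear[OF R(1)]])
  define B where "B = adjoint Q \<circ> R"
  have linB: "linear B" unfolding B_def by (rule linear_compose[OF R(1) adjoint_linear[OF linQ]])
  have eq: "adjoint Q \<circ> L \<circ> reindex \<sigma> = B \<circ> A" by (auto simp: B_def RA)
  have J: "J = \<bar>det (matrix B)\<bar> * \<bar>det (matrix A)\<bar>"
    unfolding J_def eq matrix_compose[OF linA linB] det_mul abs_mult ..
  have inner: "A x \<bullet> A y = L (reindex \<sigma> x) \<bullet> L (reindex \<sigma> y)" for x y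
    unfolding RA linear_isometry_inner[OF R(1,3)] ..
  have ax: "reindex \<sigma> (axis k 1) = axis (inv \<sigma> k) 1" for k
    using reindex_axis[OF bij, of "inv \<sigma> k" 1] bij by (simp add: bij_def surj_f_inv_f)
  have "det (\<chi> i j. L (axis i 1) \<bullet> L (axis j 1)) = det (\<chi> k l. L (axis (inv \<sigma> k) 1) \<bullet> L (axis (inv \<sigma> l) 1) :: ((real, 'e) vec, 'e) vec)"
    using det_reindex[OF bij, of "\<chi> i j. L (axis i 1) \<bullet> L (axis j 1)"] by simp
  also have "\<dots> = det (\<chi> k l. A (axis k 1) \<bullet> A (axis l 1))" by (simp add: inner ax)
  also have "\<dots> = (det (matrix A))\<^sup>2" by (rule det_gram)
  finally have g: "g = \<bar>det (matrix A)\<bar>" unfolding g_def by simp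
  have "\<bar>det (matrix B)\<bar> \<le> 1"
    using le R(3) by (intro abs_det_le_1 linB) (use le R(3) in \<open>simp add: B_def, metis\<close>)
  then show "J \<le> g" unfolding J g by (simp add: mult_left_le_one_le)
  have "c ^ CARD('e) \<le> \<bar>det (matrix B)\<bar>"
  proof (rule abs_det_ge_power[OF linB c])
    show "c * norm v \<le> norm (B v)" for v using ge[of "R v"] R(2,3) by (auto simp: B_def)
  qed
  then show "c ^ CARD('e) * g \<le> J" unfolding J g by (intro mult_right_mono) auto
qed

section \<open>Riemannian volume and Lebesgue measure of the projection\<close>

context tangent_projection
begin

text \<open>Both volumes are integrals over the same parameter set: the Riemannian one of the Gram
  root, the Lebesgue one of the Jacobian of the projected chart. The Jacobian bounds compare the
  integrands pointwise.\<close>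

lemma chart_volume:
  fixes \<phi> :: "real ^ 'd \<Rightarrow> 'a"
  assumes rv: "riemannian_volume dty M V" and lp: "local_parametrization M U \<phi>"
    and B: "B \<in> sets borel" and sub: "B \<subseteq> M \<inter> cball p (3.3 * r)"
  shows "proj ` (B \<inter> \<phi> ` U) \<in> sets lebesgue"
    and "emeasure lebesgue (proj ` (B \<inter> \<phi> ` U)) \<le> emeasure V (B \<inter> \<phi> ` U)"
    and "ennreal ((1 - \<eta>) ^ CARD('e)) * emeasure V (B \<inter> \<phi> ` U) \<le> emeasure lebesgue (proj ` (B \<inter> \<phi> ` U))"
proof -
  let ?D = "\<lambda>u. frechet_derivative \<phi> (at u)"
  obtain \<sigma> :: "'d \<Rightarrow> 'e" where bij: "bij \<sigma>"
    using finite_same_card_bij[of "UNIV :: 'd set" "UNIV :: 'e set"] card_e by auto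
  let ?J = "reindex \<sigma>"
  from lp obtain \<psi> where hom: "homeomorphism U (\<phi> ` U) \<phi> \<psi>" and oU: "open U" and C2: "C2_on U \<phi>"
    and injD: "\<And>u. u \<in> U \<Longrightarrow> inj (?D u)"
    unfolding local_parametrization_def by blast
  have cont: "continuous_on U \<phi>" and inj: "inj_on \<phi> U"
    using hom by (auto simp: homeomorphism_def intro: inj_on_inverseI)
  have der: "(\<phi> has_derivative ?D u) (at u)" if "u \<in> U" for u
    using local_parametrization_has_derivative[OF lp that] .
  define S where "S = B \<inter> \<phi> ` U"
  define E where "E = {u \<in> U. \<phi> u \<in> B}"
  define E' where "E' = ?J -` E"
  have EU: "E \<subseteq> U" by (auto simp: E_def)
  have "\<phi> -` B \<inter> space (restrict_space borel U) \<in> sets (restrict_space borel U)"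
    using borel_measurable_continuous_on_restrict[OF cont] B by (rule measurable_sets)
  then have E: "E \<in> sets borel"
    using oU by (subst (asm) sets_restrict_space_iff) (auto simp: E_def space_restrict_space Int_def vimage_def conj_commute)
  then have E': "E' \<in> sets borel"
    using measurable_sets[OF measurable_reindex[of \<sigma>]] by (simp add: E'_def)
  define G where "G u = sqrt (det (metric_matrix \<phi> u))" for u
  have contD: "continuous_on U (\<lambda>u. ?D u v)" for v
  proof -
    obtain \<phi>' :: "real ^ 'd \<Rightarrow> ((real ^ 'd) \<Rightarrow>\<^sub>L 'a)" and \<phi>'' where
      d: "\<And>u. u \<in> U \<Longrightarrow> (\<phi> has_derivative blinfun_apply (\<phi>' u)) (at u)"
         "\<And>u. u \<in> U \<Longrightarrow> (\<phi>' has_derivative blinfun_apply (\<phi>'' u)) (at u)"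
      using C2 unfolding C2_on_def by blast
    have "continuous_on U \<phi>'"
      using d(2) by (meson continuous_at_imp_continuous_on has_derivative_continuous)
    then have "continuous_on U (\<lambda>u. blinfun_apply (\<phi>' u) v)" by (intro continuous_intros)
    moreover have "?D u v = blinfun_apply (\<phi>' u) v" if "u \<in> U" for u
      using frechet_derivative_at[OF d(1)[OF that]] by simp
    ultimately show ?thesis by (simp cong: continuous_on_cong)
  qed
  have contG: "continuous_on U G"
    unfolding G_def metric_matrix_def det_def by (simp) (intro continuous_intros contD)
  \<comment> \<open>\<open>G\<close> is known to be continuous on \<open>U\<close> only, so it is
    first cut off by the indicator of \<open>U\<close>; since \<open>E\<close> lies in
    \<open>U\<close>, this leaves the integrand over \<open>E\<close> unchanged.\<close>
  have measG: "(\<lambda>u. indicator U u *\<^sub>R G u) \<in> borel_measurable borel"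
    using oU contG by (intro borel_measurable_continuous_on_indicator) auto
  have "(\<lambda>u. ennreal (indicator U u *\<^sub>R G u) * indicator E u) \<in> borel_measurable borel"
    using measG E by measurable
  also have "(\<lambda>u. ennreal (indicator U u *\<^sub>R G u) * indicator E u) = (\<lambda>u. ennreal (G u) * indicator E u)"
    using EU by (auto simp: fun_eq_iff indicator_def)
  finally have meas: "(\<lambda>u. ennreal (G u) * indicator E u) \<in> borel_measurable borel" .
  have "emeasure V S = (\<integral>\<^sup>+u\<in>E. ennreal (G u) \<partial>lborel)"
    using rv lp B unfolding riemannian_volume_def S_def E_def G_def by blast
  also have "\<dots> = (\<integral>\<^sup>+u. ennreal (G u) * indicator E u \<partial>distr lborel borel ?J)"
    using lborel_distr_reindex[OF bij] by simp
  also have "\<dots> = (\<integral>\<^sup>+x. ennreal (G (?J x)) * indicator E (?J x) \<partial>lborel)"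
    using meas by (intro nn_integral_distr) auto
  finally have V: "emeasure V S = (\<integral>\<^sup>+x. ennreal (G (?J x)) * indicator E' x \<partial>lborel)"
    by (simp add: E'_def indicator_def)
  define F where "F = proj \<circ> \<phi> \<circ> ?J"
  define F' where "F' x = adjoint Q \<circ> ?D (?J x) \<circ> ?J" for x
  define Jac where "Jac x = \<bar>det (matrix (F' x))\<bar>" for x
  have derF: "(F has_derivative F' x) (at x within E')" if x: "x \<in> E'" for x
  proof -
    have u: "?J x \<in> U" using x EU by (auto simp: E'_def)
    have 1: "(?J has_derivative ?J) (at x)"
      by (rule bounded_linear_imp_has_derivative[OF linear_conv_bounded_linear[THEN iffD1, OF linear_reindex]])
    have 2: "(proj has_derivative adjoint Q) (at y)" for y
      unfolding proj_def
      by (auto intro!: derivative_eq_intros bounded_linear.has_derivative[OF linear_conv_bounded_linear[THEN iffD1, OF linear_adjoint_Q]])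
    have 3: "(\<phi> \<circ> ?J has_derivative ?D (?J x) \<circ> ?J) (at x)"
      by (rule diff_chain_at[OF 1 der[OF u]])
    have "(proj \<circ> (\<phi> \<circ> ?J) has_derivative adjoint Q \<circ> (?D (?J x) \<circ> ?J)) (at x)"
      by (rule diff_chain_at[OF 3 2])
    then show ?thesis unfolding F_def F'_def comp_assoc by (rule has_derivative_at_withinI)
  qed
  have bounds: "Jac x \<le> G (?J x)" "(1 - \<eta>) ^ CARD('e) * G (?J x) \<le> Jac x" if x: "x \<in> E'" for x
  proof -
    define u where "u = ?J x"
    have u: "u \<in> U" "\<phi> u \<in> M \<inter> cball p (3.3 * r)" using x sub by (auto simp: E'_def E_def u_def)
    have lin: "linear (?D u)" using der[OF u(1)] has_derivative_linear by blast
    have ge: "(1 - \<eta>) * norm w \<le> norm (adjoint Q w)" if "w \<in> range (?D u)" for w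
      using adjoint_Q_tangent_ge[OF u(2)] that tangent_space_local_parametrization[OF lp u(1)] by simp
    have c: "0 < 1 - \<eta>" using eta by simp
    note jb = jacobian_bounds[OF lin injD[OF u(1)] linear_Q norm_Q bij c ge adjoint_Q_le]
    show "Jac x \<le> G (?J x)" "(1 - \<eta>) ^ CARD('e) * G (?J x) \<le> Jac x"
      using jb unfolding Jac_def F'_def G_def metric_matrix_def u_def by simp_all
  qed
  have imJ: "?J ` E' = E" unfolding E'_def using bij_reindex[OF bij] by (simp add: bij_def surj_image_vimage_eq)
  have imE: "\<phi> ` E = S" by (auto simp: E_def S_def)
  have imF: "F ` E' = proj ` S" unfolding F_def image_comp[symmetric] imJ imE ..
  have injF: "inj_on F E'" unfolding F_def
  proof (intro comp_inj_on)
    show "inj_on ?J E'" using bij_reindex[OF bij] by (auto simp: bij_def intro: inj_on_subset)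
    show "inj_on \<phi> (?J ` E')" unfolding imJ using inj EU by (rule inj_on_subset)
    show "inj_on proj (\<phi> ` ?J ` E')" unfolding imJ imE
      using sub by (intro inj_on_subset[OF inj_on_proj]) (auto simp: S_def)
  qed
  have E'l: "E' \<in> sets lebesgue" using E' by simp
  have sets: "F ` E' \<in> sets lebesgue"
    using derF by (intro differentiable_image_in_sets_lebesgue E'l) (auto simp: differentiable_on_def differentiable_def)
  \<comment> \<open>Boundedness makes the image of finite measure, as the change of variables with a
    real-valued integral requires.\<close>
  have "bounded (F ` E')" unfolding imF bounded_iff
  proof (intro exI[of _ "3.3 * r"] ballI)
    fix y assume "y \<in> proj ` S"
    then obtain z where "z \<in> cball p (3.3 * r)" "y = proj z" using sub by (auto simp: S_def)
    then show "norm y \<le> 3.3 * r" using proj_le[of z p] by (simp add: proj_p dist_norm norm_minus_commute)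
  qed
  then have lm: "F ` E' \<in> lmeasurable" using sets by (rule bounded_set_imp_lmeasurable)
  then have "(Jac has_integral measure lebesgue (F ` E')) E'"
    unfolding Jac_def using has_measure_differentiable_image[OF E'l derF injF] by blast
  then have "(\<integral>\<^sup>+x. ennreal (indicator E' x * Jac x) \<partial>lborel) = ennreal (measure lebesgue (F ` E'))"
    by (rule nn_integral_has_integral_lebesgue[rotated]) (simp add: Jac_def)
  also have "\<dots> = emeasure lebesgue (F ` E')" using lm by (simp add: emeasure_eq_measure2)
  finally have P: "emeasure lebesgue (proj ` S) = (\<integral>\<^sup>+x. ennreal (indicator E' x * Jac x) \<partial>lborel)"
    by (simp add: imF)
  show "proj ` (B \<inter> \<phi> ` U) \<in> sets lebesgue" using sets by (simp add: imF S_def)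
  have "emeasure lebesgue (proj ` S) \<le> emeasure V S" unfolding P V
    using bounds(1) by (intro nn_integral_mono) (auto simp: indicator_def ennreal_leI)
  then show "emeasure lebesgue (proj ` (B \<inter> \<phi> ` U)) \<le> emeasure V (B \<inter> \<phi> ` U)" by (simp add: S_def)
  have "(\<lambda>x. ennreal (G (?J x)) * indicator E' x) = (\<lambda>u. ennreal (G u) * indicator E u) \<circ> ?J"
    by (auto simp: fun_eq_iff E'_def indicator_def)
  also have "\<dots> \<in> borel_measurable lborel" using meas by (intro measurable_comp[OF _ meas]) auto
  finally have meas': "(\<lambda>x. ennreal (G (?J x)) * indicator E' x) \<in> borel_measurable lborel" .
  have c0: "0 \<le> (1 - \<eta>) ^ CARD('e)" using eta by simp
  have "ennreal ((1 - \<eta>) ^ CARD('e)) * emeasure V S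
      = (\<integral>\<^sup>+x. ennreal ((1 - \<eta>) ^ CARD('e)) * (ennreal (G (?J x)) * indicator E' x) \<partial>lborel)"
    unfolding V by (rule nn_integral_cmult[OF meas', symmetric])
  also have "\<dots> \<le> emeasure lebesgue (proj ` S)" unfolding P
    using bounds(2) c0 by (intro nn_integral_mono) (auto simp: indicator_def ennreal_mult'[symmetric] ennreal_leI)
  finally show "ennreal ((1 - \<eta>) ^ CARD('e)) * emeasure V (B \<inter> \<phi> ` U) \<le> emeasure lebesgue (proj ` (B \<inter> \<phi> ` U))"
    by (simp add: S_def)
qed

text \<open>Charts overlap, so one chart is split off at a time. Injectivity of \<open>proj\<close>
  keeps the images of \<open>B \<inter> T\<close> and \<open>B - T\<close> disjoint, so both
  measures add up.\<close>

lemma volume_proj_finite_cover: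
  assumes rv: "riemannian_volume dty M V" and fin: "finite F"
    and F: "\<And>T. T \<in> F \<Longrightarrow> \<exists>U (\<phi> :: real ^ 'd \<Rightarrow> 'a). local_parametrization M U \<phi> \<and> T = \<phi> ` U"
    and B: "B \<in> sets borel" "B \<subseteq> M \<inter> cball p (3.3 * r)" "B \<subseteq> \<Union>F"
  shows "proj ` B \<in> sets lebesgue \<and> emeasure lebesgue (proj ` B) \<le> emeasure V B \<and>
    ennreal ((1 - \<eta>) ^ CARD('e)) * emeasure V B \<le> emeasure lebesgue (proj ` B)"
  using fin F B
proof (induction arbitrary: B)
  case empty
  then show ?case by simp
next
  case (insert T F)
  obtain U and \<phi> :: "real ^ 'd \<Rightarrow> 'a" where lp: "local_parametrization M U \<phi>" and T: "T = \<phi> ` U"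
    using insert.prems(1)[of T] by blast
  have setsV: "sets V = sets borel" using rv by (simp add: riemannian_volume_def)
  obtain W where W: "open W" "T = M \<inter> W"
    using lp unfolding T local_parametrization_def by (metis openin_open)
  have Tb: "T \<in> sets borel" using W compact_imp_closed[OF compact_M] by auto
  have B1: "proj ` (B \<inter> T) \<in> sets lebesgue"
      "emeasure lebesgue (proj ` (B \<inter> T)) \<le> emeasure V (B \<inter> T)"
      "ennreal ((1 - \<eta>) ^ CARD('e)) * emeasure V (B \<inter> T) \<le> emeasure lebesgue (proj ` (B \<inter> T))"
    using chart_volume[OF rv lp insert.prems(2,3)] unfolding T by blast+
  have "proj ` (B - T) \<in> sets lebesgue \<and>
      emeasure lebesgue (proj ` (B - T)) \<le> emeasure V (B - T) \<and>
      ennreal ((1 - \<eta>) ^ CARD('e)) * emeasure V (B - T) \<le> emeasure lebesgue (proj ` (B - T))"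
    using insert.prems Tb by (intro insert.IH) auto
  then have B2: "proj ` (B - T) \<in> sets lebesgue"
      "emeasure lebesgue (proj ` (B - T)) \<le> emeasure V (B - T)"
      "ennreal ((1 - \<eta>) ^ CARD('e)) * emeasure V (B - T) \<le> emeasure lebesgue (proj ` (B - T))"
    by blast+
  have V: "emeasure V B = emeasure V (B \<inter> T) + emeasure V (B - T)"
    using insert.prems(2) Tb setsV by (subst plus_emeasure) (auto intro!: arg_cong[where f = "emeasure V"])
  have im: "proj ` B = proj ` (B \<inter> T) \<union> proj ` (B - T)" by blast
  have "proj ` (B \<inter> T) \<inter> proj ` (B - T) = proj ` ((B \<inter> T) \<inter> (B - T))"
    using insert.prems(3) by (intro inj_on_image_Int[OF inj_on_proj, symmetric]) auto
  then have P: "emeasure lebesgue (proj ` B) = emeasure lebesgue (proj ` (B \<inter> T)) + emeasure lebesgue (proj ` (B - T))"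
    unfolding im using B1(1) B2(1) by (subst plus_emeasure) auto
  show ?case
  proof (intro conjI)
    show "proj ` B \<in> sets lebesgue" unfolding im using B1(1) B2(1) by (rule sets.Un)
    show "emeasure lebesgue (proj ` B) \<le> emeasure V B" unfolding V P by (intro add_mono B1 B2)
    show "ennreal ((1 - \<eta>) ^ CARD('e)) * emeasure V B \<le> emeasure lebesgue (proj ` B)"
      unfolding V P distrib_left by (intro add_mono B1 B2)
  qed
qed

lemma volume_proj:
  assumes rv: "riemannian_volume dty M V"
    and B: "B \<in> sets borel" "B \<subseteq> M \<inter> cball p (3.3 * r)"
  shows "proj ` B \<in> sets lebesgue"
    and "emeasure lebesgue (proj ` B) \<le> emeasure V B"
    and "ennreal ((1 - \<eta>) ^ CARD('e)) * emeasure V B \<le> emeasure lebesgue (proj ` B)"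
proof -
  define \<C> where "\<C> = {W. open W \<and> (\<exists>U (\<phi> :: real ^ 'd \<Rightarrow> 'a). local_parametrization M U \<phi> \<and> M \<inter> W = \<phi> ` U)}"
  have "M \<subseteq> \<Union>\<C>"
  proof
    fix z assume "z \<in> M"
    then obtain U \<phi> u where lp: "local_parametrization M U (\<phi> :: real ^ 'd \<Rightarrow> 'a)" "u \<in> U" "z = \<phi> u"
      using chart_at by blast
    then obtain W where "open W" "\<phi> ` U = M \<inter> W"
      unfolding local_parametrization_def by (metis openin_open)
    then show "z \<in> \<Union>\<C>" using lp unfolding \<C>_def by blast
  qed
  moreover have "\<And>W. W \<in> \<C> \<Longrightarrow> open W" by (auto simp: \<C>_def)
  ultimately obtain F where F: "F \<subseteq> \<C>" "finite F" "M \<subseteq> \<Union>F"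
    using compactE[OF compact_M] by metis
  have "\<exists>U (\<phi> :: real ^ 'd \<Rightarrow> 'a). local_parametrization M U \<phi> \<and> T = \<phi> ` U" if "T \<in> (\<lambda>W. M \<inter> W) ` F" for T
    using that F(1) unfolding \<C>_def by blast
  moreover have "B \<subseteq> \<Union>((\<lambda>W. M \<inter> W) ` F)" using B(2) F(3) by blast
  ultimately have "proj ` B \<in> sets lebesgue \<and> emeasure lebesgue (proj ` B) \<le> emeasure V B \<and>
    ennreal ((1 - \<eta>) ^ CARD('e)) * emeasure V B \<le> emeasure lebesgue (proj ` B)"
    by (rule volume_proj_finite_cover[OF rv finite_imageI[OF F(2)] _ B])
  then show "proj ` B \<in> sets lebesgue" "emeasure lebesgue (proj ` B) \<le> emeasure V B"
    "ennreal ((1 - \<eta>) ^ CARD('e)) * emeasure V B \<le> emeasure lebesgue (proj ` B)" by blast+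
qed

end

section \<open>Euclidean caps, lenses and incomplete Beta integrals\<close>

section \<open>Volumes of spherical caps and lenses\<close>

text \<open>Up to the volume of the unit ball in dimension d - 1, the volume of the cap of the
  d-dimensional unit ball beyond height \<open>s\<close>: the slice at height t is a ball of radius
  \<open>sqrt (1 - t\<^sup>2)\<close>.\<close>

definition cap_integral :: "nat \<Rightarrow> real \<Rightarrow> real" where
  "cap_integral d s = integral {s..1} (\<lambda>t. sqrt (1 - t\<^sup>2) ^ (d - 1))"

lemma cap_integrand_continuous: "continuous_on S (\<lambda>t::real. sqrt (1 - t\<^sup>2) ^ n)"
  by (intro continuous_intros)

lemma cap_integral_has_integral:
  "((\<lambda>t. sqrt (1 - t\<^sup>2) ^ (d - 1)) has_integral cap_integral d s) {s..1}"
  unfolding cap_integral_def by (intro integrable_integral integrable_continuous_real cap_integrand_continuous)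

text \<open>Slicing orthogonally to \<open>b\<close>.\<close>

lemma emeasure_cap_Basis:
  fixes b :: "'a::euclidean_space"
  assumes b: "b \<in> Basis" and \<tau>: "-1 \<le> \<tau>"
  shows "emeasure lborel {x :: 'a. norm x \<le> 1 \<and> \<tau> < x \<bullet> b}
     = ennreal (unit_ball_vol (real (DIM('a) - 1)) * cap_integral DIM('a) \<tau>)"
proof -
  define A where "A = Basis - {b}"
  have A: "finite A" "b \<notin> A" "Basis = insert b A" "card A = DIM('a) - 1" using b by (auto simp: A_def)
  interpret product_sigma_finite "\<lambda>_. lborel :: real measure" by standard
  let ?P = "\<lambda>I :: 'a set. Pi\<^sub>M I (\<lambda>_. lborel :: real measure)"
  let ?c = "\<lambda>f. \<Sum>i\<in>Basis. f i *\<^sub>R i :: 'a"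
  let ?X = "{x :: 'a. norm x \<le> 1 \<and> \<tau> < x \<bullet> b}"
  let ?S = "\<lambda>y. {f. sqrt (\<Sum>i\<in>A. (f i)\<^sup>2) \<le> sqrt (1 - y\<^sup>2)} \<inter> space (?P A)"
  have inn: "?c f \<bullet> i = f i" if "i \<in> Basis" for f i
    using that by (simp add: inner_sum_left inner_Basis if_distrib sum.delta cong: if_cong)
  have nrm: "norm (?c f) = sqrt (\<Sum>i\<in>Basis. (f i)\<^sup>2)" for f
    by (simp add: norm_eq_sqrt_inner euclidean_inner[of "?c f" "?c f"] inn power2_eq_square)
  have X: "?X \<in> sets borel" by measurable
  have cX: "?c -` ?X \<inter> space (?P Basis) \<in> sets (?P Basis)"
    by (rule measurable_sets[OF _ X]) simp
  have "emeasure lborel ?X = emeasure (?P Basis) (?c -` ?X \<inter> space (?P Basis))"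
    by (subst lborel_eq, subst emeasure_distr) (use X in auto)
  also have "\<dots> = (\<integral>\<^sup>+ f. indicator (?c -` ?X \<inter> space (?P Basis)) f \<partial>?P Basis)"
    by (rule nn_integral_indicator[OF cX, symmetric])
  also have "\<dots> = (\<integral>\<^sup>+ f. indicator ?X (?c f) \<partial>?P Basis)"
    by (intro nn_integral_cong) (auto simp: indicator_def)
  also have "\<dots> = (\<integral>\<^sup>+ y. \<integral>\<^sup>+ f. indicator ?X (?c (f(b := y))) \<partial>?P A \<partial>lborel)"
    unfolding A(3)
    by (rule product_nn_integral_insert_rev[OF A(1,2)])
       (use X in \<open>unfold A(3)[symmetric], measurable\<close>)
  also have "\<dots> = (\<integral>\<^sup>+ y. indicator {\<tau><..1} y * emeasure (?P A) (?S y) \<partial>lborel)"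
  proof (intro nn_integral_cong)
    fix y :: real
    have sum_upd: "(\<Sum>i\<in>Basis. ((f(b := y)) i)\<^sup>2) = y\<^sup>2 + (\<Sum>i\<in>A. (f i)\<^sup>2)" for f
      unfolding A(3) using A(1,2) by (subst sum.insert) (auto intro!: sum.cong)
    have mem: "?c (f(b := y)) \<in> ?X \<longleftrightarrow> y \<in> {\<tau><..1} \<and> sqrt (\<Sum>i\<in>A. (f i)\<^sup>2) \<le> sqrt (1 - y\<^sup>2)" for f
    proof -
      have s: "0 \<le> (\<Sum>i\<in>A. (f i)\<^sup>2)" by (simp add: sum_nonneg)
      have "?c (f(b := y)) \<in> ?X \<longleftrightarrow> sqrt (\<Sum>i\<in>Basis. ((f(b := y)) i)\<^sup>2) \<le> 1 \<and> \<tau> < (f(b := y)) b"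
        unfolding mem_Collect_eq nrm inn[OF b, of "f(b := y)"] ..
      also have "\<dots> \<longleftrightarrow> y\<^sup>2 + (\<Sum>i\<in>A. (f i)\<^sup>2) \<le> 1 \<and> \<tau> < y"
        unfolding sum_upd by simp
      finally have 1: "?c (f(b := y)) \<in> ?X \<longleftrightarrow> y\<^sup>2 + (\<Sum>i\<in>A. (f i)\<^sup>2) \<le> 1 \<and> \<tau> < y" .
      have "y \<le> 1" if "y\<^sup>2 + (\<Sum>i\<in>A. (f i)\<^sup>2) \<le> 1"
      proof -
        have "y\<^sup>2 \<le> 1" using s that by linarith
        then show ?thesis by (simp add: abs_square_le_1)
      qed
      then show ?thesis unfolding 1 by auto
    qed
    have m: "?S y \<in> sets (?P A)" by measurable
    have "(\<integral>\<^sup>+ f. indicator ?X (?c (f(b := y))) \<partial>?P A) = (\<integral>\<^sup>+ f. indicator {\<tau><..1} y * indicator (?S y) f \<partial>?P A)"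
    proof (intro nn_integral_cong)
      fix f assume f: "f \<in> space (?P A)"
      have "indicator ?X (?c (f(b := y))) = (of_bool (?c (f(b := y)) \<in> ?X) :: ennreal)"
        by (simp only: indicator_def)
      also have "\<dots> = indicator {\<tau><..1} y * indicator (?S y) f"
        unfolding mem using f by (simp add: indicator_def)
      finally show "indicator ?X (?c (f(b := y))) = (indicator {\<tau><..1} y * indicator (?S y) f :: ennreal)" .
    qed
    also have "\<dots> = indicator {\<tau><..1} y * emeasure (?P A) (?S y)"
      using m by (subst nn_integral_cmult) auto
    finally show "(\<integral>\<^sup>+ f. indicator ?X (?c (f(b := y))) \<partial>?P A) = \<dots>" .
  qed
  also have "\<dots> = (\<integral>\<^sup>+ y. ennreal (indicator {\<tau>..1} y * (unit_ball_vol (real (DIM('a) - 1)) * sqrt (1 - y\<^sup>2) ^ (DIM('a) - 1))) \<partial>lborel)"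
  proof (intro nn_integral_cong_AE)
    \<comment> \<open>The end heights form a null set. Without them every remaining slice has
      positive radius, and open and closed ends of the interval make no difference.\<close>
    have "AE y in lborel. y \<notin> {-1, 1, \<tau>}" by (intro AE_not_in countable_imp_null_set_lborel) auto
    then show "AE y in lborel. indicator {\<tau><..1} y * emeasure (?P A) (?S y) =
       ennreal (indicator {\<tau>..1} y * (unit_ball_vol (real (DIM('a) - 1)) * sqrt (1 - y\<^sup>2) ^ (DIM('a) - 1)))"
    proof eventually_elim
      case (elim y)
      show ?case
      proof (cases "y \<in> {\<tau><..<1}")
        case True
        then have "y\<^sup>2 < 1" using \<tau> by (auto simp: abs_square_less_1)
        then show ?thesis using True A(4) emeasure_cball_aux[OF A(1), of "sqrt (1 - y\<^sup>2)"] by simp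
      next
        case False
        then show ?thesis using elim by (auto simp: indicator_def)
      qed
    qed
  qed
  also have "\<dots> = ennreal (unit_ball_vol (real (DIM('a) - 1)) * cap_integral DIM('a) \<tau>)"
  proof (rule nn_integral_has_integral_lebesgue)
    show "0 \<le> unit_ball_vol (real (DIM('a) - 1)) * sqrt (1 - y\<^sup>2) ^ (DIM('a) - 1)" if "y \<in> {\<tau>..1}" for y
      using that \<tau> by (auto intro!: mult_nonneg_nonneg zero_le_power simp: abs_square_le_1)
  qed (intro has_integral_mult_right cap_integral_has_integral)
  finally show ?thesis .
qed

lemma measure_orthogonal_image:
  fixes f :: "real ^ 'e::{finite, wellorder} \<Rightarrow> real ^ 'e::_"
  assumes f: "orthogonal_transformation f" and S: "S \<in> lmeasurable"
  shows "measure lebesgue (f ` S) = measure lebesgue S"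
proof -
  have lin: "linear f" and n: "\<And>x. norm (f x) = norm x"
    using f by (auto simp: orthogonal_transformation)
  have "\<bar>det (matrix f)\<bar> = 1" using f by (simp add: orthogonal_transformation_det)
  then show ?thesis using measure_linear_image[OF lin S] by simp
qed

text \<open>The height \<tau> is measured in units of \<open>R\<close>. The strict inequality keeps
  the two caps that make up a lens disjoint.\<close>

definition spherical_cap :: "'a::euclidean_space \<Rightarrow> 'a \<Rightarrow> real \<Rightarrow> real \<Rightarrow> 'a set" where
  "spherical_cap a e R \<tau> = {x. norm (x - a) \<le> R \<and> R * \<tau> < (x - a) \<bullet> e}"

definition cap_volume :: "nat \<Rightarrow> real \<Rightarrow> real" where
  "cap_volume d \<tau> = unit_ball_vol (real (d - 1)) * cap_integral d \<tau>"

text \<open>The unit cap in a coordinate direction is rotated to \<open>e\<close>, then scaled by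
  \<open>R\<close> and translated; only the scaling changes the volume.\<close>

lemma measure_cap:
  fixes a e :: "(real, 'e::{finite, wellorder}) vec"
  assumes e: "norm e = 1" and \<tau>: "-1 \<le> \<tau>" and R: "0 < R"
  shows "spherical_cap a e R \<tau> \<in> lmeasurable"
    and "measure lebesgue (spherical_cap a e R \<tau>) = R ^ CARD('e) * cap_volume CARD('e) \<tau>"
proof -
  define b :: "(real, 'e) vec" where "b = axis undefined 1"
  have b: "b \<in> Basis" "norm b = 1" by (auto simp: b_def Basis_vec_def)
  let ?X = "{x :: (real, 'e) vec. norm x \<le> 1 \<and> \<tau> < x \<bullet> b}"
  have X: "?X \<in> sets borel" by measurable
  have em: "emeasure lborel ?X = ennreal (cap_volume CARD('e) \<tau>)"
    using emeasure_cap_Basis[OF b(1) \<tau>] by (simp add: cap_volume_def)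
  have Xl: "?X \<in> lmeasurable" using X em by (intro fmeasurableI) auto
  have c0: "0 \<le> cap_integral CARD('e) \<tau>"
    using \<tau> by (intro has_integral_nonneg[OF cap_integral_has_integral[of "CARD('e)" \<tau>]])
      (auto intro!: zero_le_power simp: abs_square_le_1)
  have mX: "measure lebesgue ?X = cap_volume CARD('e) \<tau>"
    using em c0 X by (simp add: measure_def cap_volume_def)
  obtain f where f: "orthogonal_transformation f" "f b = e"
    using orthogonal_transformation_exists[of b e] b(2) e by metis
  have lin: "linear f" using f by (simp add: orthogonal_transformation)
  have fn: "norm (f x) = norm x" and fe: "f x \<bullet> e = x \<bullet> b" for x
    using f(1) unfolding f(2)[symmetric] by (auto simp: orthogonal_transformation_def orthogonal_transformation_norm)
  have fX: "f ` ?X = {x. norm x \<le> 1 \<and> \<tau> < x \<bullet> e}"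
  proof (intro equalityI subsetI)
    fix y assume y: "y \<in> {x. norm x \<le> 1 \<and> \<tau> < x \<bullet> e}"
    obtain x where "y = f x" using orthogonal_transformation_surj[OF f(1)] by blast
    then show "y \<in> f ` ?X" using y fn fe by simp
  qed (auto simp: fn fe)
  let ?Y = "{x. norm x \<le> 1 \<and> \<tau> < x \<bullet> e}"
  have Y: "?Y \<in> lmeasurable" "measure lebesgue ?Y = measure lebesgue ?X"
    using measurable_linear_image[OF lin Xl] measure_orthogonal_image[OF f(1) Xl] fX by simp_all
  have im: "spherical_cap a e R \<tau> = (\<lambda>x. a + x) ` ((\<lambda>x. R *\<^sub>R x) ` ?Y)"
    unfolding spherical_cap_def
  proof (intro equalityI subsetI)
    fix x assume x: "x \<in> {x. norm (x - a) \<le> R \<and> R * \<tau> < (x - a) \<bullet> e}"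
    have "(1 / R) *\<^sub>R (x - a) \<in> ?Y"
      using x R by (simp add: pos_less_divide_eq pos_divide_le_eq mult.commute del: scaleR_diff_right scaleR_right_diff_distrib)
    moreover have "x = a + R *\<^sub>R ((1 / R) *\<^sub>R (x - a))" using R by simp
    ultimately show "x \<in> (\<lambda>x. a + x) ` ((\<lambda>x. R *\<^sub>R x) ` ?Y)" by blast
  qed (use R in auto)
  have linR: "linear ((*\<^sub>R) R :: (real, 'e) vec \<Rightarrow> _)" by (rule linear_scaleR)
  show "spherical_cap a e R \<tau> \<in> lmeasurable"
    unfolding im by (intro measurable_translation measurable_linear_image[OF linR] Y)
  have "measure lebesgue ((\<lambda>x. R *\<^sub>R x) ` ?Y) = R ^ CARD('e) * measure lebesgue ?Y"
    using measure_linear_image[OF linR Y(1)] R by simp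
  then show "measure lebesgue (spherical_cap a e R \<tau>) = R ^ CARD('e) * cap_volume CARD('e) \<tau>"
    unfolding im measure_translation using Y(2) mX by simp
qed

lemma cap_integral_split:
  assumes "s \<le> t" "t \<le> 1"
  shows "cap_integral d s = integral {s..t} (\<lambda>u. sqrt (1 - u\<^sup>2) ^ (d - 1)) + cap_integral d t"
  unfolding cap_integral_def
  by (rule Henstock_Kurzweil_Integration.integral_combine[symmetric])
     (use assms in \<open>auto intro: integrable_continuous_real cap_integrand_continuous\<close>)

lemma cap_integral_diff_le:
  assumes "0 \<le> s" "s \<le> t" "t \<le> 1"
  shows "cap_integral d s \<le> cap_integral d t + (t - s)"
proof -
  have "integral {s..t} (\<lambda>u. sqrt (1 - u\<^sup>2) ^ (d - 1)) \<le> integral {s..t} (\<lambda>u. 1)"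
    using assms by (intro integral_le integrable_continuous_real cap_integrand_continuous)
      (auto intro!: power_le_one simp: abs_square_le_1)
  then show ?thesis using cap_integral_split[OF assms(2,3), of d] assms by simp
qed

lemma cap_integral_antimono:
  assumes "-1 \<le> s" "s \<le> t" "t \<le> 1"
  shows "cap_integral d t \<le> cap_integral d s"
proof -
  have "0 \<le> integral {s..t} (\<lambda>u. sqrt (1 - u\<^sup>2) ^ (d - 1))"
    using assms by (intro integral_nonneg integrable_continuous_real cap_integrand_continuous)
      (auto intro!: zero_le_power simp: abs_square_le_1)
  then show ?thesis using cap_integral_split[OF assms(2,3), of d] by simp
qed

lemma cap_integral_minus_1: "cap_integral d (-1) = 2 * cap_integral d 0"
proof -
  have "integral {-1..0} (\<lambda>u. sqrt (1 - u\<^sup>2) ^ (d - 1)) = integral {-0..-(-1)} (\<lambda>u. sqrt (1 - (-u)\<^sup>2) ^ (d - 1))"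
    by (subst Henstock_Kurzweil_Integration.integral_reflect_real) simp
  then show ?thesis using cap_integral_split[of "-1" 0 d] by (simp add: cap_integral_def)
qed

text \<open>The integrand is at least \<open>t * sqrt (1 - t^2) ^ (d - 1)\<close>, which has an elementary primitive.\<close>

lemma cap_integral_ge:
  assumes s: "0 \<le> s" "s \<le> 1" and d: "1 \<le> d"
  shows "sqrt (1 - s\<^sup>2) ^ (d + 1) / (real d + 1) \<le> cap_integral d s"
proof -
  let ?F = "\<lambda>t::real. - (sqrt (1 - t\<^sup>2) ^ (d + 1)) / (real d + 1)"
  have "((\<lambda>t. t * sqrt (1 - t\<^sup>2) ^ (d - 1)) has_integral (?F 1 - ?F s)) {s..1}"
  proof (rule fundamental_theorem_of_calculus_interior)
    show "continuous_on {s..1} ?F" by (intro continuous_intros) auto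
    fix t assume t: "t \<in> {s<..<1}"
    then have "t\<^sup>2 < 1" using s by (simp add: abs_square_less_1)
    then have pos: "0 < 1 - t\<^sup>2" by simp
    define w where "w = sqrt (1 - t\<^sup>2)"
    have w: "0 < w" using pos by (simp add: w_def)
    have "((\<lambda>t. sqrt (1 - t\<^sup>2)) has_real_derivative - t / w) (at t)"
      using pos unfolding w_def by (auto intro!: derivative_eq_intros simp: field_simps)
    from DERIV_cdivide[OF DERIV_minus[OF DERIV_power[OF this, of "d + 1"]], of "real d + 1"]
    have "(?F has_real_derivative - (real (d + 1) * (- t / w * w ^ d)) / (real d + 1)) (at t)"
      unfolding w_def by simp
    also have "- (real (d + 1) * (- t / w * w ^ d)) / (real d + 1) = t / w * w ^ d"
    proof -
      have "real (d + 1) = real d + 1" "real d + 1 \<noteq> 0" by auto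
      then show ?thesis by (metis (no_types, opaque_lifting) minus_divide_left minus_minus mult_minus_left mult_minus_right nonzero_mult_div_cancel_left)
    qed
    also have "\<dots> = t * w ^ (d - 1)"
      using w d by (cases d) auto
    also have "\<dots> = t * sqrt (1 - t\<^sup>2) ^ (d - 1)" by (simp add: w_def)
    finally show "(?F has_vector_derivative t * sqrt (1 - t\<^sup>2) ^ (d - 1)) (at t)"
      by (simp add: has_real_derivative_iff_has_vector_derivative)
  qed (use s in auto)
  moreover have "?F 1 - ?F s = sqrt (1 - s\<^sup>2) ^ (d + 1) / (real d + 1)" by simp
  ultimately have "((\<lambda>t. t * sqrt (1 - t\<^sup>2) ^ (d - 1)) has_integral (sqrt (1 - s\<^sup>2) ^ (d + 1) / (real d + 1))) {s..1}"
    by simp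
  then show ?thesis
    by (rule has_integral_le[OF _ cap_integral_has_integral])
       (use s in \<open>auto intro!: mult_left_le_one_le zero_le_power simp: abs_square_le_1\<close>)
qed

lemma cap_integral_pos: "0 \<le> s \<Longrightarrow> s < 1 \<Longrightarrow> 1 \<le> d \<Longrightarrow> 0 < cap_integral d s"
  by (rule less_le_trans[OF _ cap_integral_ge]) (auto simp: abs_square_less_1 intro!: divide_pos_pos zero_less_power)

text \<open>The substitution t = 1 - u^2. The fundamental theorem is used in its interior form: at t
  = 0 the power convention may spoil the integrand, and for s = 0 it is singular at t = 1.\<close>

lemma inc_Beta_cap_integral:
  assumes s: "0 \<le> s" "s < 1" and d: "1 \<le> d"
  shows "inc_Beta (1 - s\<^sup>2) ((real d + 1) / 2) (1 / 2) = 2 * cap_integral d s"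
proof -
  let ?g = "\<lambda>u::real. sqrt (1 - u\<^sup>2) ^ (d - 1)"
  define \<Phi> where "\<Phi> u = integral {0..u} ?g" for u
  have \<Phi>: "(\<Phi> has_real_derivative ?g u) (at u within {0..1})" if "u \<in> {0..1}" for u
    unfolding \<Phi>_def using that by (intro integral_has_real_derivative cap_integrand_continuous)
  have cont: "continuous_on {0..1} \<Phi>" using \<Phi> by (meson DERIV_continuous_on)
  have "((\<lambda>t. t powr ((real d + 1) / 2 - 1) * (1 - t) powr (1 / 2 - 1)) has_integral
      (- 2 * \<Phi> (sqrt (1 - (1 - s\<^sup>2))) - - 2 * \<Phi> (sqrt (1 - 0)))) {0..1 - s\<^sup>2}"
  proof (rule fundamental_theorem_of_calculus_interior)
    have "t \<le> 1" if "t \<in> {0..1 - s\<^sup>2}" for t using that by (auto intro: order_trans[of t "1 - s\<^sup>2" 1])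
    then show "continuous_on {0..1 - s\<^sup>2} (\<lambda>t. - 2 * \<Phi> (sqrt (1 - t)))"
      by (intro continuous_intros continuous_on_compose2[OF cont]) auto
    fix t assume t: "t \<in> {0<..<1 - s\<^sup>2}"
    then have t01: "0 < t" "t < 1" by (auto intro: less_le_trans simp: le_diff_eq)
    define u where "u = sqrt (1 - t)"
    have u: "0 < u" "u < 1" "u\<^sup>2 = 1 - t" using t01 by (auto simp: u_def)
    have "(\<Phi> has_real_derivative ?g u) (at u)"
      using \<Phi>[of u] u at_within_interior[of u "{0..1}"] by simp
    then have \<Phi>u: "(\<Phi> has_real_derivative ?g u) (at (sqrt (1 - t)))" by (simp add: u_def)
    have "((\<lambda>t. sqrt (1 - t)) has_real_derivative - 1 / (2 * u)) (at t)"
      using t01 unfolding u_def by (auto intro!: derivative_eq_intros simp: field_simps)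
    from DERIV_cmult[OF DERIV_chain2[OF \<Phi>u this], of "- 2"]
    have "((\<lambda>t. - 2 * \<Phi> (sqrt (1 - t))) has_real_derivative - 2 * (?g u * (- 1 / (2 * u)))) (at t)" .
    also have "- 2 * (?g u * (- 1 / (2 * u))) = ?g u / u"
      using u by simp
    also have "?g u / u = sqrt t ^ (d - 1) / sqrt (1 - t)"
      unfolding u(3) by (simp add: u_def)
    also have "\<dots> = t powr ((real d + 1) / 2 - 1) * (1 - t) powr (1 / 2 - 1)"
    proof -
      have "sqrt t ^ (d - 1) = t powr ((real d - 1) / 2)"
        using t01 d by (simp add: powr_half_sqrt[symmetric] powr_realpow[symmetric] powr_powr of_nat_diff)
      moreover have "(1 - t) powr (1 / 2 - 1) = 1 / sqrt (1 - t)"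
        using t01 powr_minus_divide[of "1 - t" "1 / 2"] by (simp add: powr_half_sqrt)
      moreover have "(real d + 1) / 2 - 1 = (real d - 1) / 2" by (simp add: field_simps)
      ultimately show ?thesis by simp
    qed
    finally show "((\<lambda>t. - 2 * \<Phi> (sqrt (1 - t))) has_vector_derivative
        t powr ((real d + 1) / 2 - 1) * (1 - t) powr (1 / 2 - 1)) (at t)"
      by (simp add: has_real_derivative_iff_has_vector_derivative)
  qed (use s in \<open>simp add: abs_square_le_1\<close>)
  then have "inc_Beta (1 - s\<^sup>2) ((real d + 1) / 2) (1 / 2) = 2 * \<Phi> 1 - 2 * \<Phi> s"
    unfolding inc_Beta_def using s by (simp add: integral_unique)
  moreover have "\<Phi> 1 = \<Phi> s + cap_integral d s"
    unfolding \<Phi>_def cap_integral_def using s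
    by (intro Henstock_Kurzweil_Integration.integral_combine[symmetric])
       (auto intro: integrable_continuous_real cap_integrand_continuous)
  ultimately show ?thesis by simp
qed

text \<open>This is intersection over union: a lens consists of two caps at height s / 2, and the
  union is two full balls, that is four half balls, minus the lens.\<close>

lemma vol_coeff_cap_integral:
  assumes s: "0 \<le> s" "s < 2" and d: "1 \<le> d"
  shows "vol_coeff d s = cap_integral d (s / 2) / (2 * cap_integral d 0 - cap_integral d (s / 2))"
proof -
  have "inc_Beta (1 - s\<^sup>2 / 4) ((real d + 1) / 2) (1 / 2) = 2 * cap_integral d (s / 2)"
    using inc_Beta_cap_integral[of "s / 2" d] s d by (simp add: power_divide)
  moreover have "inc_Beta 1 ((real d + 1) / 2) (1 / 2) = 2 * cap_integral d 0"
    using inc_Beta_cap_integral[of 0 d] d by simp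
  moreover have "0 < cap_integral d (s / 2)" using s d by (intro cap_integral_pos) auto
  ultimately show ?thesis by (simp add: vol_coeff_def field_simps)
qed

lemma vol_coeff_bounds:
  assumes s: "0 \<le> s" "s < 2" and d: "1 \<le> d"
  shows "0 < vol_coeff d s" "vol_coeff d s \<le> 1"
proof -
  have "0 < cap_integral d (s / 2)" using s d by (intro cap_integral_pos) auto
  moreover have "cap_integral d (s / 2) \<le> cap_integral d 0" using s by (intro cap_integral_antimono) auto
  ultimately show "0 < vol_coeff d s" "vol_coeff d s \<le> 1"
    unfolding vol_coeff_cap_integral[OF assms] by (auto simp: field_simps)
qed

text \<open>The cap integral changes by at most the change of height, since its integrand is at most
  1; the lower bound for caps at heights up to c / 2 makes this error relative. This is where d + 1
  and the power of 1 - (c/2)^2 in the corrections come from.\<close>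

lemma vol_coeff_perturb:
  assumes s: "0 \<le> s" "s \<le> s'" "s' \<le> c" "c < 2" and d: "1 \<le> d"
  shows "vol_coeff d s \<le> (1 + (s' - s) * (real d + 1) / (1 - (c / 2)\<^sup>2) powr ((real d + 1) / 2)) * vol_coeff d s'"
proof -
  define I0 I I' where "I0 = cap_integral d 0" and "I = cap_integral d (s / 2)" and "I' = cap_integral d (s' / 2)"
  define A where "A = (1 - (c / 2)\<^sup>2) powr ((real d + 1) / 2)"
  have c2: "(c / 2)\<^sup>2 < 1" using s by (simp add: abs_square_less_1)
  have A: "0 < A" using c2 by (simp add: A_def)
  have "A = sqrt (1 - (c / 2)\<^sup>2) ^ (d + 1)"
    using c2 by (simp add: A_def powr_half_sqrt[symmetric] powr_realpow[symmetric] powr_powr add.commute del: power_Suc)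
  also have "\<dots> \<le> sqrt (1 - (s' / 2)\<^sup>2) ^ (d + 1)"
    using s c2 by (intro power_mono real_sqrt_le_mono diff_mono power_mono) auto
  also have "\<dots> = (real d + 1) * (sqrt (1 - (s' / 2)\<^sup>2) ^ (d + 1) / (real d + 1))" by simp
  also have "\<dots> \<le> (real d + 1) * I'"
    unfolding I'_def using s d by (intro mult_left_mono cap_integral_ge) auto
  finally have "A \<le> (real d + 1) * I'" .
  then have AI: "1 \<le> (real d + 1) * I' / A" using A by simp
  define e where "e = (s' - s) / 2 * ((real d + 1) / A)"
  have e: "0 \<le> e" using s A by (simp add: e_def)
  have pos: "0 < I" "0 < I'" "I \<le> I0" "I' \<le> I0"
    unfolding I_def I'_def I0_def using s d by (auto intro!: cap_integral_pos cap_integral_antimono)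
  have "I \<le> I' + (s' - s) / 2"
    unfolding I_def I'_def using cap_integral_diff_le[of "s / 2" "s' / 2" d] s by (simp add: diff_divide_distrib)
  also have "(s' - s) / 2 \<le> (s' - s) / 2 * ((real d + 1) * I' / A)"
    using AI s mult_left_mono[OF AI, of "(s' - s) / 2"] by simp
  also have "\<dots> = e * I'" by (simp add: e_def)
  finally have I: "I \<le> (1 + e) * I'" by (simp add: algebra_simps)
  \<comment> \<open>Cross-multiplied comparison of the two ratios. Changing the denominator as well
    costs a second \<open>e\<close>, which \<open>I \<le> I0\<close> keeps from growing.\<close>
  have "I * (2 * I0 - I') \<le> (1 + 2 * e) * I' * (2 * I0 - I)"
  proof -
    have "I * (2 * I0) \<le> (1 + e) * I' * (2 * I0)" using I pos by (intro mult_right_mono) auto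
    moreover have "e * I' * I \<le> e * I' * I0" using pos e by (intro mult_left_mono) auto
    ultimately show ?thesis by (simp add: algebra_simps)
  qed
  then have "I / (2 * I0 - I) \<le> (1 + 2 * e) * (I' / (2 * I0 - I'))"
    using pos by (simp add: field_simps)
  moreover have "2 * e = (s' - s) * (real d + 1) / A" by (simp add: e_def)
  ultimately show ?thesis
    using vol_coeff_cap_integral[of s d] vol_coeff_cap_integral[of s' d] s d
    by (simp add: I_def I'_def I0_def A_def)
qed

section \<open>Two balls of equal radius\<close>

text \<open>Each half of the lens contains a cap of the opposite ball. Centres closer than
  \<open>2 * R * \<tau>\<close> only enlarge the lens, so a bound on their distance
  suffices.\<close>

lemma measure_lens_ge:
  fixes a a' :: "(real, 'e::{finite, wellorder}) vec"
  assumes R: "0 < R" and \<tau>: "0 \<le> \<tau>" and \<delta>: "norm (a' - a) \<le> 2 * R * \<tau>"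
  shows "2 * (R ^ CARD('e) * cap_volume CARD('e) \<tau>)
     \<le> measure lebesgue (cball a R \<inter> cball a' R)"
proof -
  obtain e where e: "norm e = 1" "a' - a = norm (a' - a) *\<^sub>R e"
  proof (cases "a' = a")
    case True
    then show ?thesis using that[of "axis undefined 1"] by simp
  next
    case False
    then show ?thesis using that[of "(1 / norm (a' - a)) *\<^sub>R (a' - a)"] by simp
  qed
  define \<delta> where "\<delta> = norm (a' - a)"
  have a': "a' = a + \<delta> *\<^sub>R e" using e(2) by (simp add: \<delta>_def algebra_simps)
  have \<delta>: "0 \<le> \<delta>" "\<delta> \<le> 2 * R * \<tau>" using assms by (auto simp: \<delta>_def)
  have ee: "e \<bullet> e = 1" using e(1) by (simp add: norm_eq_1)
  let ?C1 = "spherical_cap a e R \<tau>"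
  let ?C2 = "spherical_cap a' (- e) R \<tau>"
  \<comment> \<open>Moving \<open>y\<close> back along \<open>w\<close> by at most twice its
    component in that direction does not increase its norm.\<close>
  have shift: "norm (y - v) \<le> R"
    if y: "norm y \<le> R" and v: "v = t *\<^sub>R w" "norm w = 1" "0 \<le> t" "t \<le> 2 * (y \<bullet> w)" for y v w :: "(real, 'e) vec" and t
  proof -
    have "(norm (y - v))\<^sup>2 = (norm y)\<^sup>2 + t * (t - 2 * (y \<bullet> w))"
      using v(2) by (simp add: power2_norm_eq_inner v(1) algebra_simps inner_commute norm_eq_1)
    also have "\<dots> \<le> (norm y)\<^sup>2" using v by (simp add: mult_le_0_iff)
    finally show ?thesis using y R by (meson norm_ge_zero order_trans power2_le_imp_le)
  qed
  have C1: "?C1 \<subseteq> cball a R \<inter> cball a' R"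
  proof
    fix x assume x: "x \<in> ?C1"
    have "norm ((x - a) - \<delta> *\<^sub>R e) \<le> R"
      by (rule shift[where w = e and t = \<delta>]) (use x \<delta> e in \<open>auto simp: spherical_cap_def\<close>)
    then show "x \<in> cball a R \<inter> cball a' R" using x a' by (auto simp: spherical_cap_def dist_norm norm_minus_commute algebra_simps)
  qed
  have C2: "?C2 \<subseteq> cball a R \<inter> cball a' R"
  proof
    fix x assume x: "x \<in> ?C2"
    have "norm ((x - a') - \<delta> *\<^sub>R (- e)) \<le> R"
      by (rule shift[where w = "- e" and t = \<delta>]) (use x \<delta> e in \<open>auto simp: spherical_cap_def\<close>)
    then show "x \<in> cball a R \<inter> cball a' R" using x a' by (auto simp: spherical_cap_def dist_norm norm_minus_commute algebra_simps)
  qed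
  have "?C1 \<inter> ?C2 = {}"
  proof -
    have False if "R * \<tau> < (x - a) \<bullet> e" "R * \<tau> < (x - a') \<bullet> (- e)" for x
      using that \<delta> ee by (simp add: a' algebra_simps inner_commute)
    then show ?thesis unfolding spherical_cap_def by blast
  qed
  then have "measure lebesgue (?C1 \<union> ?C2) = measure lebesgue ?C1 + measure lebesgue ?C2"
    using measure_cap(1)[of e \<tau> R a] measure_cap(1)[of "- e" \<tau> R a'] e R \<tau>
    by (subst measure_Un3) auto
  also have "\<dots> = 2 * (R ^ CARD('e) * cap_volume CARD('e) \<tau>)"
    using measure_cap(2)[of e \<tau> R a] measure_cap(2)[of "- e" \<tau> R a'] e R \<tau> by simp
  finally have "measure lebesgue (?C1 \<union> ?C2)
    = 2 * (R ^ CARD('e) * cap_volume CARD('e) \<tau>)" .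
  moreover have "measure lebesgue (?C1 \<union> ?C2) \<le> measure lebesgue (cball a R \<inter> cball a' R)"
    using C1 C2 measure_cap(1)[of e \<tau> R a] measure_cap(1)[of "- e" \<tau> R a'] e R \<tau>
    by (intro measure_mono_fmeasurable) auto
  ultimately show ?thesis by linarith
qed

text \<open>The cap at height -1 is the ball without the single point
  \<open>a - R *\<^sub>R e\<close>, and by symmetry its integral is twice that of a half
  ball.\<close>

lemma measure_cball_le_cap_volume:
  fixes a :: "(real, 'e::{finite, wellorder}) vec"
  assumes R: "0 < R"
  shows "measure lebesgue (cball a R)
     \<le> R ^ CARD('e) * (2 * cap_volume CARD('e) 0)"
proof -
  define e :: "(real, 'e) vec" where "e = axis undefined 1"
  have e: "norm e = 1" "e \<bullet> e = 1" by (auto simp: e_def norm_eq_1[symmetric])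
  let ?C = "spherical_cap a e R (-1)"
  have C: "?C \<in> lmeasurable" using measure_cap(1)[OF e(1) _ R, of "-1" a] by simp
  have "cball a R \<subseteq> ?C \<union> {a - R *\<^sub>R e}"
  proof
    fix x assume x: "x \<in> cball a R"
    show "x \<in> ?C \<union> {a - R *\<^sub>R e}"
    proof (rule ccontr)
      assume n: "x \<notin> ?C \<union> {a - R *\<^sub>R e}"
      have x1: "norm (x - a) \<le> R" using x by (simp add: dist_norm norm_minus_commute)
      with n have x2: "(x - a) \<bullet> e \<le> - R" by (auto simp: spherical_cap_def)
      have "(norm (x - a + R *\<^sub>R e))\<^sup>2 = (norm (x - a))\<^sup>2 + 2 * R * ((x - a) \<bullet> e) + R\<^sup>2"
        using e(2) unfolding power2_norm_eq_inner
        by (simp add: inner_add_left inner_add_right inner_commute power2_eq_square del: inner_diff_left inner_diff_right)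
      also have "\<dots> \<le> R\<^sup>2 + 2 * R * (- R) + R\<^sup>2"
        using x1 x2 R by (intro add_mono mult_left_mono power_mono) auto
      also have "\<dots> = 0" by (simp add: power2_eq_square)
      finally have "x - a + R *\<^sub>R e = 0" by simp
      moreover have "x = (x - a + R *\<^sub>R e) + (a - R *\<^sub>R e)" by simp
      ultimately have "x = a - R *\<^sub>R e" by (metis add_0)
      then show False using n by simp
    qed
  qed
  then have "measure lebesgue (cball a R) \<le> measure lebesgue (?C \<union> {a - R *\<^sub>R e})"
    by (intro measure_mono_fmeasurable fmeasurable.Un C negligible_imp_measurable) auto
  also have "\<dots> \<le> measure lebesgue ?C + measure lebesgue {a - R *\<^sub>R e}"
    using C by (intro measure_Un_le) auto
  also have "measure lebesgue {a - R *\<^sub>R e} = 0" by simp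
  finally show ?thesis
    using measure_cap(2)[OF e(1) _ R, of "-1" a] by (simp add: cap_volume_def cap_integral_minus_1 mult_ac)
qed

lemma measure_two_cballs_le:
  fixes a a' :: "(real, 'e::{finite, wellorder}) vec"
  assumes R: "0 < R" and \<tau>: "0 \<le> \<tau>" and \<delta>: "norm (a' - a) \<le> 2 * R * \<tau>"
  shows "measure lebesgue (cball a R \<union> cball a' R)
     \<le> 2 * (R ^ CARD('e) * (2 * cap_volume CARD('e) 0 - cap_volume CARD('e) \<tau>))"
proof -
  have "measure lebesgue (cball a R \<union> cball a' R)
     = measure lebesgue (cball a R) + measure lebesgue (cball a' R) - measure lebesgue (cball a R \<inter> cball a' R)"
    by (rule measure_Un3) auto
  then show ?thesis
    using measure_lens_ge[OF assms] measure_cball_le_cap_volume[OF R, of a] measure_cball_le_cap_volume[OF R, of a']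
    by (simp add: algebra_simps)
qed

section \<open>Exponential bound for the statistic given two sample points\<close>

section \<open>A Chernoff bound with a random number of trials\<close>

lemma KL_Bernoulli_nonneg:
  assumes "0 \<le> \<alpha>" "\<alpha> \<le> 1" "0 < \<beta>" "\<beta> < 1"
  shows "0 \<le> KL_Bernoulli \<alpha> \<beta>"
proof -
  have *: "x - y \<le> x * ln (x / y)" if "0 \<le> x" "0 < y" for x y :: real
  proof (cases "x = 0")
    case False
    then have "ln (y / x) \<le> y / x - 1" using that by (intro ln_le_minus_one) auto
    then have "x * ln (y / x) \<le> x * (y / x - 1)" using that by (intro mult_left_mono) auto
    also have "\<dots> = y - x" using False by (simp add: field_simps)
    finally show ?thesis using that False by (simp add: ln_div algebra_simps)
  qed (use that in simp)
  show ?thesis using *[of \<alpha> \<beta>] *[of "1 - \<alpha>" "1 - \<beta>"] assms by (simp add: KL_Bernoulli_def)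
qed

text \<open>The divergence is the logarithm, per trial, of the likelihood ratio at the empirical
  frequency \<alpha>. For \<open>s = 0\<close> the power is 1, in accordance with 0 log 0 =
  0.\<close>

lemma exp_KL_Bernoulli:
  assumes m: "0 < m" and s: "s \<le> m" and lt: "real s / real m < q" and q: "0 < q" "q < 1"
  defines "\<alpha> \<equiv> real s / real m"
  shows "(\<alpha> / q) ^ s * ((1 - \<alpha>) / (1 - q)) ^ (m - s) = exp (real m * KL_Bernoulli \<alpha> q)"
proof -
  have \<alpha>: "0 \<le> \<alpha>" "\<alpha> < q" using lt by (auto simp: \<alpha>_def)
  have ms: "real m * \<alpha> = real s" "real m * (1 - \<alpha>) = real (m - s)"
    using m s by (auto simp: \<alpha>_def of_nat_diff algebra_simps)
  have 1: "(\<alpha> / q) ^ s = exp (real s * ln (\<alpha> / q))"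
  proof (cases "s = 0")
    case False
    then have "0 < \<alpha> / q" using m q by (simp add: \<alpha>_def)
    then show ?thesis by (simp add: exp_of_nat_mult)
  qed simp
  have 2: "((1 - \<alpha>) / (1 - q)) ^ (m - s) = exp (real (m - s) * ln ((1 - \<alpha>) / (1 - q)))"
    using \<alpha> q by (simp add: exp_of_nat_mult)
  show ?thesis unfolding 1 2 KL_Bernoulli_def exp_add[symmetric]
    by (simp only: distrib_left mult.assoc[symmetric] ms)
qed

text \<open>Given the set \<open>A\<close> of indices falling into \<open>U\<close>, the event fixes \<open>\<alpha> = s / card A\<close> with \<open>s\<close> the largest
  admissible count; the likelihood ratio of \<open>Bin(card A, \<alpha>)\<close> against \<open>Bin(card A, q)\<close> is at
  least \<open>exp \<lambda>\<close> on the event and has expectation at most 1.\<close>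

lemma chernoff_random_trials:
  fixes P :: "'a measure" and R :: "'i set"
  assumes P: "prob_space P" and R: "finite R"
    and sets [measurable]: "I \<in> sets P" "U \<in> sets P" and IU: "I \<subseteq> U"
    and q: "0 < q" "q < 1" and le: "q * measure P U \<le> measure P I"
  defines "N \<equiv> (\<lambda>y. card {l \<in> R. y l \<in> U})" and "S \<equiv> (\<lambda>y. card {l \<in> R. y l \<in> I})"
  assumes ev: "\<And>y. y \<in> E \<Longrightarrow> N y \<noteq> 0 \<and> real (S y) / real (N y) < q \<and>
      lam < real (N y) * KL_Bernoulli (real (S y) / real (N y)) q"
    and E: "E \<in> sets (Pi\<^sub>M R (\<lambda>_. P))"
  shows "emeasure (Pi\<^sub>M R (\<lambda>_. P)) E \<le> ennreal (exp (- lam))"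
proof -
  interpret P: prob_space P by fact
  interpret product_sigma_finite "\<lambda>_. P" by standard
  define good where "good m = {s. s \<le> m \<and> m \<noteq> 0 \<and> real s / real m < q \<and>
      lam < real m * KL_Bernoulli (real s / real m) q}" for m
  \<comment> \<open>If no count is admissible, the value \<open>q\<close> makes the likelihood ratio
    on \<open>U\<close> identically 1, so the bounds on \<alpha> and the integral estimate hold
    without case distinctions.\<close>
  define \<alpha> where "\<alpha> m = (if good m = {} then q else real (Max (good m)) / real m)" for m
  have fin: "finite (good m)" for m by (rule finite_subset[of _ "{..m}"]) (auto simp: good_def)
  have \<alpha>: "0 \<le> \<alpha> m" "\<alpha> m \<le> q" for m
    using Max_in[OF fin, of m] q by (auto simp: \<alpha>_def good_def less_imp_le)
  \<comment> \<open>Likelihood ratio of one trial inside \<open>U\<close>, with success meaning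
    \<open>I\<close>; it vanishes outside \<open>U\<close>.\<close>
  define g where "g m z = indicator I z * (\<alpha> m / q) + indicator (U - I) z * ((1 - \<alpha> m) / (1 - q))" for m z
  have g0: "0 \<le> g m z" for m z using \<alpha> q by (auto simp: g_def indicator_def order_trans[of "\<alpha> m" q 1])
  \<comment> \<open>The likelihood ratio of all trials on the event that exactly the indices in
    \<open>A\<close> fall into \<open>U\<close>; the factors are functions of single coordinates, so
    its integral is a product.\<close>
  define G where "G A y = (\<Prod>l\<in>R. if l \<in> A then ennreal (g (card A) (y l)) else indicator (space P - U) (y l))" for A y
  have int_g: "(\<integral>\<^sup>+z. ennreal (g m z) \<partial>P) \<le> ennreal (measure P U)" for m
  proof -
    have "(\<integral>\<^sup>+z. ennreal (g m z) \<partial>P)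
       = (\<integral>\<^sup>+z. ennreal (\<alpha> m / q) * indicator I z + ennreal ((1 - \<alpha> m) / (1 - q)) * indicator (U - I) z \<partial>P)"
      by (intro nn_integral_cong) (auto simp: g_def indicator_def)
    also have "\<dots> = ennreal (\<alpha> m / q) * emeasure P I + ennreal ((1 - \<alpha> m) / (1 - q)) * emeasure P (U - I)"
      by (subst nn_integral_add) (auto simp: nn_integral_cmult_indicator)
    also have "\<dots> = ennreal (\<alpha> m / q * measure P I + (1 - \<alpha> m) / (1 - q) * measure P (U - I))"
      using \<alpha>[of m] q unfolding P.emeasure_eq_measure
      by (subst ennreal_plus) (auto simp: ennreal_mult simp del: times_divide_eq_left)
    also have "measure P (U - I) = measure P U - measure P I"
      using IU by (intro P.finite_measure_Diff) auto
    also have "\<alpha> m / q * measure P I + (1 - \<alpha> m) / (1 - q) * (measure P U - measure P I) \<le> measure P U"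
    proof -
      \<comment> \<open>The only place where the volume comparison enters: the true success
        probability is at least \<open>q\<close>, whereas \<alpha> is tilted below
        \<open>q\<close>.\<close>
      have "(\<alpha> m - q) * (measure P I - q * measure P U) \<le> 0"
        using \<alpha>[of m] le by (intro mult_nonpos_nonneg) auto
      moreover have "\<alpha> m / q * measure P I + (1 - \<alpha> m) / (1 - q) * (measure P U - measure P I) - measure P U
          = (\<alpha> m - q) * (measure P I - q * measure P U) / (q * (1 - q))"
        using q by (simp add: field_simps)
      ultimately have "\<alpha> m / q * measure P I + (1 - \<alpha> m) / (1 - q) * (measure P U - measure P I) - measure P U \<le> 0"
        using q by (simp add: divide_nonpos_pos)
      then show ?thesis by simp
    qed
    finally show ?thesis by (simp add: ennreal_leI)
  qed
  have meas_g [measurable]: "(\<lambda>z. ennreal (g m z)) \<in> borel_measurable P" for m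
    unfolding g_def by measurable
  have meas_f: "(\<lambda>z. if l \<in> A then ennreal (g (card A) z) else indicator (space P - U) z) \<in> borel_measurable P" for l A
    by (cases "l \<in> A") auto
  have meas_G: "G A \<in> borel_measurable (Pi\<^sub>M R (\<lambda>_. P))" for A
    unfolding G_def
  proof (intro borel_measurable_prod_ennreal)
    fix l assume "l \<in> R"
    then show "(\<lambda>y. if l \<in> A then ennreal (g (card A) (y l)) else indicator (space P - U) (y l)) \<in> borel_measurable (Pi\<^sub>M R (\<lambda>_. P))"
      using measurable_compose[OF measurable_component_singleton[of l R "\<lambda>_. P"] meas_f[of l A]] by simp
  qed
  have int_G: "(\<integral>\<^sup>+y. G A y \<partial>Pi\<^sub>M R (\<lambda>_. P))
      \<le> (\<Prod>l\<in>A. ennreal (measure P U)) * (\<Prod>l\<in>R - A. ennreal (1 - measure P U))" if "A \<subseteq> R" for A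
  proof -
    have "(\<integral>\<^sup>+y. G A y \<partial>Pi\<^sub>M R (\<lambda>_. P))
       = (\<Prod>l\<in>R. \<integral>\<^sup>+z. (if l \<in> A then ennreal (g (card A) z) else indicator (space P - U) z) \<partial>P)"
      unfolding G_def by (rule product_nn_integral_prod[OF R meas_f])
    also have "\<dots> \<le> (\<Prod>l\<in>R. if l \<in> A then ennreal (measure P U) else ennreal (1 - measure P U))"
      by (intro prod_mono_ennreal) (auto simp: int_g P.emeasure_eq_measure P.prob_compl)
    also have "\<dots> = (\<Prod>l\<in>A. ennreal (measure P U)) * (\<Prod>l\<in>R - A. ennreal (1 - measure P U))"
      using that R by (subst prod.If_cases) (auto simp: Int_absorb1 Diff_eq)
    finally show ?thesis .
  qed
  have key: "indicator E y \<le> ennreal (exp (- lam)) * (\<Sum>A\<in>Pow R. G A y)" if y: "y \<in> space (Pi\<^sub>M R (\<lambda>_. P))" for y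
  proof (cases "y \<in> E")
    case True
    define A where "A = {l \<in> R. y l \<in> U}"
    define m where "m = card A"
    define s where "s = card {l \<in> R. y l \<in> I}"
    have A: "A \<subseteq> R" "finite A" using R by (auto simp: A_def)
    have sm: "s \<le> m" unfolding s_def m_def A_def using R IU by (intro card_mono) auto
    have s: "s \<in> good m" using ev[OF True] sm by (simp add: good_def N_def S_def s_def m_def A_def)
    define M where "M = Max (good m)"
    have M: "M \<in> good m" "s \<le> M" unfolding M_def using Max_in[OF fin, of m] Max_ge[OF fin s] s by auto
    have \<alpha>M: "\<alpha> m = real M / real m" using s by (auto simp: \<alpha>_def M_def)
    have m: "0 < m" "M \<le> m" "real M / real m < q" "lam < real m * KL_Bernoulli (\<alpha> m) q"
      using M(1) \<alpha>M by (auto simp: good_def)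
    have IA: "{l \<in> R. y l \<in> I} = {l \<in> A. y l \<in> I}" using IU by (auto simp: A_def)
    have cI: "card (A \<inter> {l. y l \<in> I}) = s" "card (A \<inter> - {l. y l \<in> I}) = m - s"
    proof -
      show "card (A \<inter> {l. y l \<in> I}) = s" unfolding s_def IA by (simp add: Int_def)
      then show "card (A \<inter> - {l. y l \<in> I}) = m - s"
        using card_Diff_subset_Int[of A "{l. y l \<in> I}"] A(2) by (simp add: m_def Diff_eq)
    qed
    have "G A y = (\<Prod>l\<in>R. if l \<in> A then ennreal (g m (y l)) else 1)" unfolding G_def m_def
    proof (intro prod.cong refl)
      fix l assume l: "l \<in> R"
      have "y l \<in> space P" using y l by (auto simp: space_PiM)
      then show "(if l \<in> A then ennreal (g (card A) (y l)) else indicator (space P - U) (y l))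
         = (if l \<in> A then ennreal (g (card A) (y l)) else 1)"
        using l by (auto simp: A_def)
    qed
    also have "\<dots> = (\<Prod>l\<in>A. ennreal (g m (y l)))"
      using A R by (simp add: prod.If_cases Int_absorb1)
    also have "\<dots> = ennreal (\<Prod>l\<in>A. g m (y l))" by (rule prod_ennreal) (rule g0)
    also have "(\<Prod>l\<in>A. g m (y l)) = (\<Prod>l\<in>A. if l \<in> {l. y l \<in> I} then \<alpha> m / q else (1 - \<alpha> m) / (1 - q))"
      by (intro prod.cong) (auto simp: g_def A_def)
    also have "\<dots> = (\<alpha> m / q) ^ s * ((1 - \<alpha> m) / (1 - q)) ^ (m - s)"
      using A(2) by (subst prod.If_cases) (auto simp: cI)
    finally have G: "G A y = ennreal ((\<alpha> m / q) ^ s * ((1 - \<alpha> m) / (1 - q)) ^ (m - s))" .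
    have "exp lam \<le> exp (real m * KL_Bernoulli (\<alpha> m) q)" using m by simp
    also have "\<dots> = (\<alpha> m / q) ^ M * ((1 - \<alpha> m) / (1 - q)) ^ (m - M)"
      using exp_KL_Bernoulli[OF m(1-3) q] by (simp add: \<alpha>M)
    \<comment> \<open>As \<alpha> is at most \<open>q\<close>, a success lowers the likelihood ratio
      and a failure raises it. So the ratio decreases in the count, and its value at the largest
      admissible count bounds it below at all smaller ones.\<close>
    also have "\<dots> \<le> (\<alpha> m / q) ^ s * ((1 - \<alpha> m) / (1 - q)) ^ (m - s)"
      using \<alpha>[of m] q M(2) by (intro mult_mono power_decreasing power_increasing) (auto intro!: zero_le_power)
    finally have "ennreal (exp lam) \<le> G A y" unfolding G by (rule ennreal_leI)
    also have "\<dots> \<le> (\<Sum>A\<in>Pow R. G A y)" using A R by (intro member_le_sum) auto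
    finally have "ennreal (exp (- lam)) * ennreal (exp lam) \<le> ennreal (exp (- lam)) * (\<Sum>A\<in>Pow R. G A y)"
      by (rule mult_left_mono) simp
    moreover have "ennreal (exp (- lam)) * ennreal (exp lam) = 1"
      by (simp add: ennreal_mult[symmetric] exp_add[symmetric])
    ultimately show ?thesis using True by simp
  qed simp
  have "emeasure (Pi\<^sub>M R (\<lambda>_. P)) E = (\<integral>\<^sup>+y. indicator E y \<partial>Pi\<^sub>M R (\<lambda>_. P))" using E by simp
  also have "\<dots> \<le> (\<integral>\<^sup>+y. ennreal (exp (- lam)) * (\<Sum>A\<in>Pow R. G A y) \<partial>Pi\<^sub>M R (\<lambda>_. P))"
    by (intro nn_integral_mono key)
  also have "\<dots> = ennreal (exp (- lam)) * (\<Sum>A\<in>Pow R. \<integral>\<^sup>+y. G A y \<partial>Pi\<^sub>M R (\<lambda>_. P))"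
    using meas_G by (subst nn_integral_cmult) (auto simp: nn_integral_sum)
  also have "\<dots> \<le> ennreal (exp (- lam)) * (\<Sum>A\<in>Pow R. (\<Prod>l\<in>A. ennreal (measure P U)) * (\<Prod>l\<in>R - A. ennreal (1 - measure P U)))"
    by (intro mult_left_mono sum_mono int_G) auto
  \<comment> \<open>Binomial expansion: the sum over all index sets is the product over
    \<open>R\<close> of the total probability of hitting or missing \<open>U\<close>.\<close>
  also have "(\<Sum>A\<in>Pow R. (\<Prod>l\<in>A. ennreal (measure P U)) * (\<Prod>l\<in>R - A. ennreal (1 - measure P U)))
      = (\<Prod>l\<in>R. ennreal (measure P U) + ennreal (1 - measure P U))"
    by (rule prod_add[OF R, symmetric])
  also have "\<dots> = 1"
    by (simp add: ennreal_plus[symmetric] P.prob_le_1 del: ennreal_plus)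
  finally show ?thesis by simp
qed

section \<open>Conditioning on two sample points\<close>

text \<open>Clusters are sets of values, but coinciding sample values share their distances, so
  membership is the same as lying in the ball. A statistic above the nonnegative threshold excludes
  the branches where it is 0 or, as the divergence is nonnegative, at most 0.\<close>

lemma test_stat_no_gap:
  fixes x :: "nat \<Rightarrow> 'a::euclidean_space"
  assumes ij: "i \<in> {1..n}" "j \<in> {1..n}" and r: "0 \<le> r" and lam: "0 \<le> lam"
    and q: "0 < q" "q < 1" and T: "lam < test_stat n x (no_gap_weights r x) q i j"
  defines "R \<equiv> {1..n} - {i, j}"
  defines "N \<equiv> card {l \<in> R. x l \<in> cball (x i) r \<union> cball (x j) r}"
    and "S \<equiv> card {l \<in> R. x l \<in> cball (x i) r \<inter> cball (x j) r}"
  shows "N \<noteq> 0 \<and> real S / real N < q \<and> lam < real N * KL_Bernoulli (real S / real N) q"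
proof -
  have R: "finite R" by (simp add: R_def)
  have mem: "x l \<in> cluster n x (no_gap_weights r x) k \<longleftrightarrow> x l \<in> cball (x k) r" if "l \<in> R" for l k
    using that by (auto simp: cluster_def no_gap_weights_def R_def dist_norm)
  have N: "N_union n x (no_gap_weights r x) i j = real N"
  proof -
    have "N_union n x (no_gap_weights r x) i j = (\<Sum>l\<in>R. indicator {l. x l \<in> cball (x i) r \<union> cball (x j) r} l)"
      unfolding N_union_def R_def[symmetric] by (intro sum.cong refl) (auto simp: mem indicator_def)
    also have "\<dots> = real N" using R by (simp add: N_def sum.If_cases indicator_def of_bool_def Int_def)
    finally show ?thesis .
  qed
  have "(\<Sum>l\<in>R. indicator (cluster n x (no_gap_weights r x) i \<inter> cluster n x (no_gap_weights r x) j) (x l))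
      = (\<Sum>l\<in>R. indicator {l. x l \<in> cball (x i) r \<inter> cball (x j) r} l :: real)"
    by (intro sum.cong refl) (auto simp: mem indicator_def)
  also have "\<dots> = real S" using R by (simp add: S_def sum.If_cases indicator_def of_bool_def Int_def)
  finally have \<theta>: "theta n x (no_gap_weights r x) i j = real S / real N"
    unfolding theta_def N R_def[symmetric] by simp
  have SN: "S \<le> N" unfolding S_def N_def using R by (intro card_mono) auto
  show ?thesis
  proof (cases "N = 0")
    case True
    then show ?thesis using T lam by (simp add: test_stat_def N)
  next
    case False
    have "real S / real N < q"
    proof (rule ccontr)
      assume "\<not> ?thesis"
      then have "test_stat n x (no_gap_weights r x) q i j = - (real N * KL_Bernoulli (real S / real N) q)"
        using False by (simp add: test_stat_def N \<theta>)
      moreover have "0 \<le> real N * KL_Bernoulli (real S / real N) q"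
        using SN False q by (intro mult_nonneg_nonneg KL_Bernoulli_nonneg) auto
      ultimately show False using T lam by simp
    qed
    then show ?thesis using T False by (simp add: test_stat_def N \<theta>)
  qed
qed

text \<open>By Fubini the two points \<open>x i\<close> and \<open>x j\<close> are integrated last.
  For almost every admissible pair the remaining points obey the Chernoff bound with the fixed
  number \<open>q a b\<close>; integrating over the pairs within distance \<open>h\<close> restores
  the probability of the condition.\<close>

lemma cond_prob_test_stat_le:
  fixes P :: "'a::euclidean_space measure" and q :: "'a \<Rightarrow> 'a \<Rightarrow> real"
  assumes P: "prob_space P" and sets_P: "sets P = sets borel"
    and ij: "i \<in> {1..n}" "j \<in> {1..n}" "i \<noteq> j" and r: "0 \<le> r" and lam: "0 \<le> lam"
    and G: "AE a in P. a \<in> G"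
    and main: "\<And>a b. a \<in> G \<Longrightarrow> b \<in> G \<Longrightarrow> norm (a - b) \<le> h \<Longrightarrow> 0 < q a b \<and> q a b < 1 \<and>
       q a b * measure P (cball a r \<union> cball b r) \<le> measure P (cball a r \<inter> cball b r)"
  shows "cond_prob (Pi\<^sub>M {1..n} (\<lambda>_. P)) (\<lambda>x. lam < test_stat n x (no_gap_weights r x) (q (x i) (x j)) i j)
           (\<lambda>x. norm (x i - x j) \<le> h) \<le> exp (- lam)"
proof -
  interpret P: prob_space P by fact
  interpret PS: product_sigma_finite "\<lambda>_. P" by standard
  define R where "R = {1..n} - {i, j}"
  let ?\<mu> = "Pi\<^sub>M {1..n} (\<lambda>_. P)" and ?\<nu> = "Pi\<^sub>M R (\<lambda>_. P)"
  let ?T = "\<lambda>x. test_stat n x (no_gap_weights r x) (q (x i) (x j)) i j"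
  interpret M: prob_space ?\<mu> by (rule prob_space_PiM) (rule P)
  interpret N: prob_space ?\<nu> by (rule prob_space_PiM) (rule P)
  have R: "finite R" "j \<notin> R" "i \<notin> insert j R" and nR: "{1..n} = insert i (insert j R)"
    using ij by (auto simp: R_def)
  define A where "A = {x \<in> space ?\<mu>. lam < ?T x \<and> norm (x i - x j) \<le> h}"
  define B where "B = {x \<in> space ?\<mu>. norm (x i - x j) \<le> h}"
  have cp: "cond_prob ?\<mu> (\<lambda>x. lam < ?T x) (\<lambda>x. norm (x i - x j) \<le> h) = measure ?\<mu> A / measure ?\<mu> B"
    unfolding cond_prob_def A_def B_def ..
  have comp [measurable]: "(\<lambda>x. x k) \<in> borel_measurable ?\<mu>" if "k \<in> {1..n}" for k
    using measurable_component_singleton[OF that, of "\<lambda>_. P"] measurable_cong_sets[OF refl sets_P] by blast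
  have B: "B \<in> sets ?\<mu>"
    unfolding B_def using comp[OF ij(1)] comp[OF ij(2)] by measurable
  have fubini: "emeasure ?\<mu> D = (\<integral>\<^sup>+a. \<integral>\<^sup>+b. \<integral>\<^sup>+y. indicator D ((y(j := b))(i := a)) \<partial>?\<nu> \<partial>P \<partial>P)" if D: "D \<in> sets ?\<mu>" for D
  proof -
    have f: "(indicator D :: _ \<Rightarrow> ennreal) \<in> borel_measurable (Pi\<^sub>M (insert i (insert j R)) (\<lambda>_. P))"
      using D unfolding nR by measurable
    have "emeasure ?\<mu> D = (\<integral>\<^sup>+x. indicator D x \<partial>Pi\<^sub>M (insert i (insert j R)) (\<lambda>_. P))"
      using D nR by simp
    also have "\<dots> = (\<integral>\<^sup>+a. \<integral>\<^sup>+x. indicator D (x(i := a)) \<partial>Pi\<^sub>M (insert j R) (\<lambda>_. P) \<partial>P)"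
      by (rule PS.product_nn_integral_insert_rev[OF _ R(3) f]) (use R in simp)
    also have "\<dots> = (\<integral>\<^sup>+a. \<integral>\<^sup>+b. \<integral>\<^sup>+y. indicator D ((y(j := b))(i := a)) \<partial>?\<nu> \<partial>P \<partial>P)"
    proof (intro nn_integral_cong PS.product_nn_integral_insert_rev[OF R(1,2)])
      fix a assume a: "a \<in> space P"
      have "(\<lambda>x. x(i := a)) \<in> measurable (Pi\<^sub>M (insert j R) (\<lambda>_. P)) (Pi\<^sub>M (insert i (insert j R)) (\<lambda>_. P))"
        using a by measurable
      from measurable_compose[OF this f]
      show "(\<lambda>x. indicator D (x(i := a)) :: ennreal) \<in> borel_measurable (Pi\<^sub>M (insert j R) (\<lambda>_. P))" .
    qed
    finally show ?thesis .
  qed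
  have spP: "space P = UNIV" using sets_eq_imp_space_eq[OF sets_P] by simp
  show ?thesis
  \<comment> \<open>Measurability in the two distinguished points is not supplied by the arbitrary
    function \<open>q\<close>. If the event is not measurable, its \<open>measure\<close> is 0 by
    convention and the bound is trivial.\<close>
  proof (cases "A \<in> sets ?\<mu>")
    case False
    then show ?thesis unfolding cp by (simp add: measure_notin_sets)
  next
    case True
    define W :: "'a \<Rightarrow> 'a \<Rightarrow> ennreal" where "W a b = indicator {z. norm (fst z - snd z) \<le> h} (a, b)" for a b
    have upd: "(y(j := b))(i := a) \<in> space ?\<mu>" if "y \<in> space ?\<nu>" for y a b
      using that unfolding nR by (auto simp: space_PiM spP PiE_def extensional_def)
    have "closed {z :: 'a \<times> 'a. norm (fst z - snd z) \<le> h}"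
      by (intro closed_Collect_le continuous_intros)
    then have "{z :: 'a \<times> 'a. norm (fst z - snd z) \<le> h} \<in> sets (borel \<Otimes>\<^sub>M borel)"
      unfolding borel_prod by simp
    then have W: "(\<lambda>(a, b). W a b) \<in> borel_measurable (P \<Otimes>\<^sub>M P)"
      unfolding W_def case_prod_eta[of "indicator _"] using sets_P
      by (subst measurable_cong_sets[OF sets_pair_measure_cong[OF sets_P sets_P] refl]) (simp add: case_prod_unfold)
    have innerB: "(\<integral>\<^sup>+y. indicator B ((y(j := b))(i := a)) \<partial>?\<nu>) = W a b" for a b
    proof -
      have "(\<integral>\<^sup>+y. indicator B ((y(j := b))(i := a)) \<partial>?\<nu>) = (\<integral>\<^sup>+y. W a b \<partial>?\<nu>)"
        by (intro nn_integral_cong) (use upd ij in \<open>auto simp: B_def W_def indicator_def\<close>)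
      then show ?thesis by (simp add: N.emeasure_space_1)
    qed
    have inner: "(\<integral>\<^sup>+y. indicator A ((y(j := b))(i := a)) \<partial>?\<nu>) \<le> ennreal (exp (- lam)) * W a b"
      if a: "a \<in> G" and b: "b \<in> G" for a b
    proof (cases "norm (a - b) \<le> h")
      case False
      then have "indicator A ((y(j := b))(i := a)) = (0 :: ennreal)" for y
        using ij by (auto simp: A_def indicator_def)
      then show ?thesis by simp
    next
      case True
      let ?u = "\<lambda>y. (y(j := b))(i := a)"
      define D where "D = ?u -` A \<inter> space ?\<nu>"
      have "(\<lambda>y. y(j := b)) \<in> measurable ?\<nu> (Pi\<^sub>M (insert j R) (\<lambda>_. P))"
        by measurable (simp add: spP)
      moreover have "(\<lambda>x. x(i := a)) \<in> measurable (Pi\<^sub>M (insert j R) (\<lambda>_. P)) (Pi\<^sub>M (insert i (insert j R)) (\<lambda>_. P))"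
        by measurable (simp add: spP)
      ultimately have "?u \<in> measurable ?\<nu> ?\<mu>"
        unfolding nR using measurable_compose by blast
      then have D: "D \<in> sets ?\<nu>" unfolding D_def using \<open>A \<in> sets ?\<mu>\<close> by (rule measurable_sets)
      have "(\<integral>\<^sup>+y. indicator A (?u y) \<partial>?\<nu>) = (\<integral>\<^sup>+y. indicator D y \<partial>?\<nu>)"
        by (intro nn_integral_cong) (auto simp: D_def indicator_def)
      also have "\<dots> = emeasure ?\<nu> D" using D by simp
      also have "\<dots> \<le> ennreal (exp (- lam))"
      proof (rule chernoff_random_trials[OF P R(1), where I = "cball a r \<inter> cball b r"
            and U = "cball a r \<union> cball b r" and q = "q a b"])
        fix y assume y: "y \<in> D"
        then have "lam < ?T (?u y)" by (auto simp: D_def A_def)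
        then have T: "lam < test_stat n (?u y) (no_gap_weights r (?u y)) (q a b) i j" using ij(3) by simp
        have eq: "{l \<in> {1..n} - {i, j}. ?u y l \<in> Z} = {l \<in> R. y l \<in> Z}" for Z
          unfolding R_def by auto
        have "0 < q a b" "q a b < 1" using main[OF a b True] by auto
        from test_stat_no_gap[OF ij(1,2) r lam this T, unfolded eq]
        show "card {l \<in> R. y l \<in> cball a r \<union> cball b r} \<noteq> 0 \<and>
           real (card {l \<in> R. y l \<in> cball a r \<inter> cball b r}) / real (card {l \<in> R. y l \<in> cball a r \<union> cball b r}) < q a b \<and>
           lam < real (card {l \<in> R. y l \<in> cball a r \<union> cball b r}) *
             KL_Bernoulli (real (card {l \<in> R. y l \<in> cball a r \<inter> cball b r}) / real (card {l \<in> R. y l \<in> cball a r \<union> cball b r})) (q a b)"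
          using ij(3) by simp
      qed (use main[OF a b True] sets_P D in auto)
      finally show ?thesis using True by (simp add: W_def)
    qed
    have "emeasure ?\<mu> A \<le> (\<integral>\<^sup>+a. \<integral>\<^sup>+b. ennreal (exp (- lam)) * W a b \<partial>P \<partial>P)"
      unfolding fubini[OF True]
    proof (intro nn_integral_mono_AE)
      show "AE a in P. (\<integral>\<^sup>+b. \<integral>\<^sup>+y. indicator A ((y(j := b))(i := a)) \<partial>?\<nu> \<partial>P)
          \<le> (\<integral>\<^sup>+b. ennreal (exp (- lam)) * W a b \<partial>P)"
        using G
      proof eventually_elim
        case (elim a)
        show ?case
          using G by (intro nn_integral_mono_AE) (auto elim!: eventually_mono intro: inner[OF elim])
      qed
    qed
    also have "\<dots> = (\<integral>\<^sup>+a. ennreal (exp (- lam)) * (\<integral>\<^sup>+b. W a b \<partial>P) \<partial>P)"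
    proof (intro nn_integral_cong nn_integral_cmult)
      fix a assume "a \<in> space P"
      then show "W a \<in> borel_measurable P"
        using measurable_compose[OF measurable_Pair1' W, of a] by simp
    qed
    also have "\<dots> = ennreal (exp (- lam)) * (\<integral>\<^sup>+a. \<integral>\<^sup>+b. W a b \<partial>P \<partial>P)"
      using P.borel_measurable_nn_integral[OF W] by (rule nn_integral_cmult)
    also have "(\<integral>\<^sup>+a. \<integral>\<^sup>+b. W a b \<partial>P \<partial>P) = emeasure ?\<mu> B"
      unfolding fubini[OF B] innerB ..
    finally have "emeasure ?\<mu> A \<le> ennreal (exp (- lam)) * emeasure ?\<mu> B" .
    then have "measure ?\<mu> A \<le> exp (- lam) * measure ?\<mu> B"
      unfolding M.emeasure_eq_measure by (simp add: ennreal_mult[symmetric])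
    then show ?thesis unfolding cp
      by (cases "measure ?\<mu> B = 0") (auto simp: field_simps zero_less_measure_iff)
  qed
qed

section \<open>Volume ratio, bookkeeping of constants, and the final bound\<close>

section \<open>The ratio of volumes on the manifold\<close>

context tangent_projection
begin

text \<open>Both sets are projected to the tangent space at \<open>p\<close>. The image of the
  intersection contains a Euclidean lens whose radius is shrunk by 1 - \<eta>, and the image of the
  union lies in two Euclidean balls of unshrunk radius. One factor 1 - \<eta> per dimension comes
  from that shrinking, the other from comparing the volume of the union with that of its
  image.\<close>

lemma volume_ratio:
  assumes rv: "riemannian_volume dty M V" and y0: "y0 \<in> M" and x: "0 \<le> x" "x \<le> 1 / 20"
    and s': "0 \<le> s'" "s' < 2" and near: "norm (y0 - p) \<le> 2.1 * r"
    and dist: "norm (y0 - p) \<le> (1 - \<eta>) * ((1 - 2 * x) * r) * s'"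
  shows "ennreal (((1 - \<eta>)\<^sup>2 * ((1 - 2 * x) / (1 + 2 * x))) ^ CARD('e) * vol_coeff CARD('e) s')
       * emeasure V (M \<inter> (cball p ((1 + 2 * x) * r) \<union> cball y0 ((1 + 2 * x) * r)))
     \<le> emeasure V (M \<inter> (cball p ((1 - 2 * x) * r) \<inter> cball y0 ((1 - 2 * x) * r)))"
proof -
  define R1 R2 where "R1 = (1 - 2 * x) * r" and "R2 = (1 + 2 * x) * r"
  have R: "0 < R1" "R1 \<le> r" "r \<le> R2" "R2 \<le> 1.1 * r"
    using x r_pos by (auto simp: R1_def R2_def mult_le_cancel_right1 algebra_simps)
  define c where "c = 1 - \<eta>"
  have c: "0 < c" "c \<le> 1" using eta by (auto simp: c_def)
  let ?d = "CARD('e)"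
  define \<omega> where "\<omega> = unit_ball_vol (real (?d - 1))"
  have \<omega>: "0 < \<omega>" by (simp add: \<omega>_def)
  define I0 I where "I0 = cap_integral ?d 0" and "I = cap_integral ?d (s' / 2)"
  have d1: "1 \<le> ?d" by (simp add: Suc_leI)
  have I: "0 < I" "I \<le> I0"
    unfolding I_def I0_def using s' d1 by (auto intro!: cap_integral_pos cap_integral_antimono)
  define Lens where "Lens = M \<inter> (cball p R1 \<inter> cball y0 R1)"
  define Uni where "Uni = M \<inter> (cball p R2 \<union> cball y0 R2)"
  have y0': "y0 \<in> M \<inter> cball p (3.3 * r)" using y0 near r_pos by (auto simp: dist_norm norm_minus_commute)
  have bI: "Lens \<in> sets borel" and bU: "Uni \<in> sets borel"
    unfolding Lens_def Uni_def using compact_imp_closed[OF compact_M] by auto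
  have sI: "Lens \<subseteq> M \<inter> cball p (3.3 * r)" using R r_pos by (auto simp: Lens_def)
  have sU: "Uni \<subseteq> M \<inter> cball p (3.3 * r)"
  proof
    fix z assume z: "z \<in> Uni"
    have "dist p z \<le> 3.3 * r" if "z \<in> cball y0 R2"
    proof -
      have "dist p z \<le> dist p y0 + dist y0 z" by (rule dist_triangle)
      also have "\<dots> \<le> 2.1 * r + 1.1 * r"
        using that near R by (intro add_mono) (auto simp: dist_norm norm_minus_commute)
      finally show ?thesis using r_pos by simp
    qed
    then show "z \<in> M \<inter> cball p (3.3 * r)" using z R r_pos by (auto simp: Uni_def)
  qed
  let ?a' = "proj y0"
  have a': "norm (?a' - 0) \<le> c * R1 * s'"
    using proj_le[of y0 p] dist by (simp add: proj_p c_def R1_def)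
  have lens: "cball 0 (c * R1) \<inter> cball ?a' (c * R1) \<subseteq> proj ` Lens"
  proof
    fix v assume v: "v \<in> cball 0 (c * R1) \<inter> cball ?a' (c * R1)"
    \<comment> \<open>Any radius above \<open>R1\<close> and within 3.3 r would do: surjectivity is
      known on open balls, while the lens is closed.\<close>
    have "c * R1 < c * (1.5 * r)" using c R r_pos by simp
    then have "v \<in> ball 0 ((1 - \<eta>) * (1.5 * r))" using v by (simp add: c_def)
    then obtain z where z: "z \<in> M" "z \<in> ball p (1.5 * r)" "v = proj z"
      using proj_surj[of "1.5 * r"] r_pos by auto
    have z': "z \<in> M \<inter> cball p (3.3 * r)" using z r_pos by auto
    have "c * norm (z - p) \<le> norm (proj z - proj p)"
      using proj_ge[OF z', of p] pM r_pos by (simp add: c_def)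
    also have "\<dots> \<le> c * R1" using v z(3) by (simp add: proj_p)
    finally have 1: "norm (z - p) \<le> R1" using c by simp
    have "c * norm (z - y0) \<le> norm (proj z - proj y0)" using proj_ge[OF z' y0'] by (simp add: c_def)
    also have "\<dots> \<le> c * R1" using v z(3) by (simp add: dist_norm norm_minus_commute)
    finally have 2: "norm (z - y0) \<le> R1" using c by simp
    show "v \<in> proj ` Lens" using z 1 2 by (auto simp: Lens_def dist_norm norm_minus_commute)
  qed
  have un: "proj ` Uni \<subseteq> cball 0 R2 \<union> cball ?a' R2"
  proof
    fix v assume "v \<in> proj ` Uni"
    then obtain z where z: "v = proj z" "norm (z - p) \<le> R2 \<or> norm (z - y0) \<le> R2"
      by (auto simp: Uni_def dist_norm norm_minus_commute)
    then show "v \<in> cball 0 R2 \<union> cball ?a' R2"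
      using proj_le[of z p] proj_le[of z y0] by (auto simp: proj_p dist_norm norm_minus_commute)
  qed
  define L where "L = 2 * ((c * R1) ^ ?d * (\<omega> * I))"
  define N where "N = 2 * (R2 ^ ?d * (\<omega> * (2 * I0 - I)))"
  have L: "L \<le> measure lebesgue (cball (0 :: (real, 'e) vec) (c * R1) \<inter> cball ?a' (c * R1))"
    using measure_lens_ge[of "c * R1" "s' / 2" ?a' 0] c R s' a' by (simp add: L_def \<omega>_def I_def cap_volume_def)
  \<comment> \<open>The ratio \<open>s'\<close> is exact for the shrunken lens only; for the larger
    radius it overestimates the distance of the centres, which is the safe direction for the
    union.\<close>
  have "c * R1 * s' \<le> 1 * R2 * s'" using c R s' by (intro mult_right_mono mult_mono) auto
  then have N: "measure lebesgue (cball (0 :: (real, 'e) vec) R2 \<union> cball ?a' R2) \<le> N"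
    using measure_two_cballs_le[of R2 "s' / 2" ?a' 0] R s' a' r_pos
    by (simp add: N_def \<omega>_def I_def I0_def cap_volume_def right_diff_distrib mult_ac)
  have "ennreal L \<le> emeasure lebesgue (cball (0 :: (real, 'e) vec) (c * R1) \<inter> cball ?a' (c * R1))"
    using L by (subst emeasure_eq_measure2) (auto simp: ennreal_leI)
  also have "\<dots> \<le> emeasure lebesgue (proj ` Lens)"
    using lens volume_proj(1)[OF rv bI sI] by (rule emeasure_mono)
  also have "\<dots> \<le> emeasure V Lens" by (rule volume_proj(2)[OF rv bI sI])
  finally have VI: "ennreal L \<le> emeasure V Lens" .
  have "ennreal (c ^ ?d) * emeasure V Uni \<le> emeasure lebesgue (proj ` Uni)"
    unfolding c_def by (rule volume_proj(3)[OF rv bU sU])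
  also have "\<dots> \<le> emeasure lebesgue (cball (0 :: (real, 'e) vec) R2 \<union> cball ?a' R2)"
    using un by (intro emeasure_mono) auto
  also have "\<dots> \<le> ennreal N" using N by (subst emeasure_eq_measure2) (auto simp: ennreal_leI)
  finally have VU: "ennreal (c ^ ?d) * emeasure V Uni \<le> ennreal N" .
  define \<rho> where "\<rho> = ((1 - \<eta>)\<^sup>2 * ((1 - 2 * x) / (1 + 2 * x))) ^ ?d * vol_coeff ?d s'"
  define t where "t = (c * R1 / R2) ^ ?d * (I / (2 * I0 - I))"
  have t0: "0 \<le> t" using c R I r_pos by (auto simp: t_def intro!: mult_nonneg_nonneg divide_nonneg_nonneg)
  have "R1 / R2 = (1 - 2 * x) / (1 + 2 * x)" using r_pos by (simp add: R1_def R2_def)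
  then have "(1 - \<eta>)\<^sup>2 * ((1 - 2 * x) / (1 + 2 * x)) = c * (c * (R1 / R2))"
    by (simp only: c_def power2_eq_square mult.assoc)
  then have "(1 - \<eta>)\<^sup>2 * ((1 - 2 * x) / (1 + 2 * x)) = c * (c * R1 / R2)" by simp
  then have \<rho>: "\<rho> = t * c ^ ?d"
    using vol_coeff_cap_integral[OF s' d1] unfolding \<rho>_def t_def I_def I0_def
    by (simp only: power_mult_distrib mult_ac)
  have "t * N = L"
  proof -
    have "t * N = 2 * ((c * R1 / R2) ^ ?d * R2 ^ ?d * (\<omega> * (I / (2 * I0 - I) * (2 * I0 - I))))"
      by (simp add: t_def N_def mult_ac)
    also have "(c * R1 / R2) ^ ?d * R2 ^ ?d = (c * R1) ^ ?d"
      using R r_pos by (simp add: power_mult_distrib[symmetric])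
    also have "I / (2 * I0 - I) * (2 * I0 - I) = I" using I by simp
    finally show ?thesis by (simp add: L_def)
  qed
  have N0: "0 \<le> N" using N measure_nonneg order_trans by blast
  have "ennreal \<rho> * emeasure V Uni = ennreal t * (ennreal (c ^ ?d) * emeasure V Uni)"
    unfolding \<rho> using t0 c by (simp add: ennreal_mult mult.assoc)
  also have "\<dots> \<le> ennreal t * ennreal N" by (rule mult_left_mono[OF VU]) simp
  also have "\<dots> = ennreal (t * N)" using t0 N0 by (simp add: ennreal_mult)
  finally have "ennreal \<rho> * emeasure V Uni \<le> emeasure V Lens"
    using VI \<open>t * N = L\<close> by (auto intro: order_trans)
  then show ?thesis by (simp add: \<rho>_def Uni_def Lens_def R1_def R2_def)
qed

end

lemma power_1_plus_le:
  fixes u :: real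
  assumes "0 \<le> u" "real n * u \<le> 1"
  shows "(1 + u) ^ n \<le> 1 + 2 * (real n * u)"
proof -
  have "(1 + u) ^ n \<le> exp u ^ n" using assms by (intro power_mono exp_ge_add_one_self) auto
  also have "\<dots> = exp (real n * u)" by (simp add: exp_of_nat_mult)
  also have "\<dots> \<le> 1 + real n * u + (real n * u)\<^sup>2" using assms by (intro exp_bound) auto
  also have "(real n * u)\<^sup>2 \<le> real n * u"
    using assms mult_left_mono[of "real n * u" 1 "real n * u"] by (simp add: power2_eq_square)
  finally show ?thesis by linarith
qed

text \<open>The distance ratio is distorted to \<open>s'\<close> by the noise (\<open>x = r\<xi> / r\<close>) and by the curvature
  (\<open>k = (\<kappa> r)^2\<close>); assumption (vi) keeps it below \<open>b'\<close>.\<close>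

lemma adjusted_coefficient_le:
  fixes d :: nat
  assumes d: "1 \<le> d" and s: "0 \<le> s" "s \<le> b" and b: "1 < b" "b \<le> b' / ((1 + 360 * k) * (1 + 5 * x))" "b' < 2"
    and x: "0 \<le> x" "x \<le> 1 / 20" "5 * real d * x \<le> 1"
    and k: "0 \<le> k" "k \<le> 1 / 14400" "720 * real d * k \<le> 1"
  defines "\<eta> \<equiv> 300 * k"
  defines "s' \<equiv> (s + 2 * x) / ((1 - \<eta>) * (1 - 2 * x))"
    and "A \<equiv> (1 - (b' / 2)\<^sup>2) powr ((real d + 1) / 2)"
  shows "s \<le> s'" "s' \<le> b'"
    and "vol_coeff d s \<le> (1 + 9600 * (real d + 1) * k / A) * (1 + 80 * (real d + 1) * x / A)
       * (((1 - \<eta>)\<^sup>2 * ((1 - 2 * x) / (1 + 2 * x))) ^ d * vol_coeff d s')"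
proof -
  have \<eta>: "0 \<le> \<eta>" "\<eta> \<le> 1 / 48" using k by (auto simp: \<eta>_def)
  \<comment> \<open>\<open>y\<close> and \<open>z\<close> are the relative excesses from curvature
    and noise. The estimates \<open>y \<le> 360 * k\<close> (300 * 48 / 47 is below 360) and
    \<open>(1 + 2 * x) * (1 + z) \<le> 1 + 5 * x\<close> below match the two factors in assumption
    (vi).\<close>
  define y where "y = 1 / (1 - \<eta>) - 1"
  have y1: "1 + y = 1 / (1 - \<eta>)" by (simp add: y_def)
  have y: "0 \<le> y" "y \<le> 360 * k"
  proof -
    have "y = \<eta> / (1 - \<eta>)" using \<eta> by (simp add: y_def field_simps)
    moreover have "\<eta> / (1 - \<eta>) \<le> \<eta> / (47 / 48)" using \<eta> by (intro divide_left_mono) auto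
    ultimately show "0 \<le> y" "y \<le> 360 * k" using \<eta> k by (auto simp: \<eta>_def)
  qed
  have y25: "y \<le> 1 / 40" using y k by simp
  define z where "z = 1 / (1 - 2 * x) - 1"
  have z1: "1 + z = 1 / (1 - 2 * x)" by (simp add: z_def)
  have z: "0 \<le> z" "z \<le> 2.3 * x"
  proof -
    have "z = 2 * x / (1 - 2 * x)" using x by (simp add: z_def field_simps)
    moreover have "2 * x / (1 - 2 * x) \<le> 2 * x / (9 / 10)" using x by (intro divide_left_mono) auto
    ultimately show "0 \<le> z" "z \<le> 2.3 * x" using x by auto
  qed
  have s'_eq: "s' = (s + 2 * x) * ((1 + y) * (1 + z))"
    unfolding s'_def y1 z1 by simp
  have w: "(1 + 2 * x) * (1 + z) \<le> 1 + 5 * x"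
  proof -
    have "(1 + 2 * x) * (1 + z) \<le> (1 + 2 * x) * (1 + 2.3 * x)" using z x by (intro mult_left_mono) auto
    also have "\<dots> = 1 + 4.3 * x + 4.6 * (x * x)" by (simp add: field_simps)
    also have "4.6 * (x * x) \<le> 0.7 * x" using mult_right_mono[of x "1 / 20" x] x by simp
    finally show ?thesis by simp
  qed
  have pos: "0 < (1 + 360 * k) * (1 + 5 * x)" using k x by (intro mult_pos_pos) auto
  have bb': "b * ((1 + 360 * k) * (1 + 5 * x)) \<le> b'" using b(2) pos by (simp add: pos_le_divide_eq)
  have "1 * 1 \<le> (1 + 360 * k) * (1 + 5 * x)" using k x by (intro mult_mono) auto
  then have "b * 1 \<le> b * ((1 + 360 * k) * (1 + 5 * x))" using b by (intro mult_left_mono) auto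
  then have "b \<le> b'" using bb' by simp
  then have s2: "s \<le> 2" using s b by simp
  have "s * 1 \<le> (s + 2 * x) * ((1 + y) * (1 + z))"
    using s x y z mult_mono[of 1 "1 + y" 1 "1 + z"] by (intro mult_mono) auto
  then show ss': "s \<le> s'" by (simp add: s'_eq)
  have "s' \<le> (b * (1 + 2 * x)) * ((1 + y) * (1 + z))"
    unfolding s'_eq using s b x y z mult_right_mono[of 1 b "2 * x"]
    by (intro mult_right_mono) (auto simp: algebra_simps)
  also have "\<dots> = b * ((1 + y) * ((1 + 2 * x) * (1 + z)))" by simp
  also have "\<dots> \<le> b * ((1 + 360 * k) * (1 + 5 * x))"
    using w y k b x z by (intro mult_left_mono mult_mono) auto
  also have "\<dots> \<le> b'" by (rule bb')
  finally show s'b': "s' \<le> b'" .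
  have "0 < 1 - (b' / 2)\<^sup>2" using b \<open>b \<le> b'\<close> by (simp add: abs_square_less_1)
  then have A: "0 < A" "A \<le> 1" by (auto simp: A_def intro!: powr_le1)
  define D where "D = (real d + 1) / A"
  have D: "real d \<le> D" "0 \<le> D"
  proof -
    have "(real d + 1) / 1 \<le> D" unfolding D_def using A by (intro divide_left_mono) auto
    then show "real d \<le> D" "0 \<le> D" by auto
  qed
  \<comment> \<open>Uses \<open>s \<le> 2\<close>: the multiplicative distortion counts twice, and
    the additive shift \<open>2 * x\<close> contributes at most 3 x.\<close>
  have diff: "s' - s \<le> 2 * y + 8 * x"
  proof -
    have yz: "(1 + y) * (1 + z) \<le> 1 + y + 2.4 * x"
    proof -
      have "(1 + y) * z \<le> (1 + 1 / 40) * (2.3 * x)" using y y25 z by (intro mult_mono) auto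
      then show ?thesis using x by (simp add: algebra_simps)
    qed
    have "s' - s = s * ((1 + y) * (1 + z) - 1) + 2 * x * ((1 + y) * (1 + z))"
      by (simp add: s'_eq algebra_simps)
    also have "s * ((1 + y) * (1 + z) - 1) \<le> 2 * (y + 2.4 * x)"
      using s s2 yz mult_mono[of 1 "1 + y" 1 "1 + z"] y z by (intro mult_mono) auto
    also have "2 * x * ((1 + y) * (1 + z)) \<le> 2 * x * 1.5"
      using yz y25 x by (intro mult_left_mono) auto
    finally show ?thesis using x by simp
  qed
  have perturb: "vol_coeff d s \<le> (1 + (s' - s) * (real d + 1) / A) * vol_coeff d s'"
    unfolding A_def by (rule vol_coeff_perturb) (use s ss' s'b' b d in auto)
  define q where "q = (1 - \<eta>)\<^sup>2 * ((1 - 2 * x) / (1 + 2 * x))"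
  have q0: "0 < q" using \<eta> x by (auto simp: q_def)
  have "(1 + (s' - s) * (real d + 1) / A) * (1 / q) ^ d \<le> (1 + 9600 * (real d + 1) * k / A) * (1 + 80 * (real d + 1) * x / A)"
  proof -
    have iq: "1 / q = (1 + y)\<^sup>2 * ((1 + 2 * x) * (1 + z))"
      unfolding q_def y1 z1 using \<eta> x by (simp add: field_simps power2_eq_square)
    have "(1 / q) ^ d \<le> ((1 + y)\<^sup>2 * (1 + 5 * x)) ^ d"
      unfolding iq using w x z y by (intro power_mono mult_left_mono) auto
    also have "\<dots> = (1 + y) ^ (2 * d) * (1 + 5 * x) ^ d" by (simp add: power_mult_distrib power_mult)
    finally have 1: "(1 / q) ^ d \<le> (1 + y) ^ (2 * d) * (1 + 5 * x) ^ d" .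
    have dy: "2 * real d * y \<le> 1"
    proof -
      have "2 * real d * y \<le> 2 * real d * (360 * k)" using y by (intro mult_left_mono) auto
      also have "\<dots> = 720 * real d * k" by simp
      also have "\<dots> \<le> 1" by (rule k(3))
      finally show ?thesis .
    qed
    have 2: "(1 + y) ^ (2 * d) \<le> 1 + 4 * (real d * y)"
      using power_1_plus_le[of y "2 * d"] y dy by simp
    have 3: "(1 + 5 * x) ^ d \<le> 1 + 10 * (real d * x)"
      using power_1_plus_le[of "5 * x" d] x by (simp add: mult_ac)
    \<comment> \<open>Splitting the sum into a product separates curvature from noise, in the form
      of the two corrections; the cross term is nonnegative.\<close>
    have 4: "1 + (s' - s) * (real d + 1) / A \<le> (1 + 2 * y * D) * (1 + 8 * x * D)"
    proof -
      have "(s' - s) * D \<le> (2 * y + 8 * x) * D" using diff D by (intro mult_right_mono) auto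
      moreover have "0 \<le> (2 * y * D) * (8 * x * D)" using y x D by simp
      moreover have "(s' - s) * (real d + 1) / A = (s' - s) * D" by (simp add: D_def)
      ultimately show ?thesis by (simp add: algebra_simps)
    qed
    \<comment> \<open>The curvature budget is 10 y D, hence at most 3600 k D, against the allowed
      9600. The quadratic term is tamed by \<open>2 * real d * y \<le> 1\<close>, which is the
      square-root half of assumption (v).\<close>
    have Ky: "(1 + 2 * y * D) * (1 + 4 * (real d * y)) \<le> 1 + 9600 * (k * D)"
    proof -
      have a: "real d * y \<le> D * y" using D y by (intro mult_right_mono) auto
      have "(2 * y * D) * (4 * (real d * y)) = (4 * (y * D)) * (2 * real d * y)" by simp
      also have "\<dots> \<le> (4 * (y * D)) * 1" using dy y D by (intro mult_left_mono) auto
      finally have c: "(2 * y * D) * (4 * (real d * y)) \<le> 4 * (y * D)" by simp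
      have e: "y * D \<le> 360 * (k * D)" using mult_right_mono[OF y(2) D(2)] by simp
      have "(1 + 2 * y * D) * (1 + 4 * (real d * y)) = 1 + 2 * (y * D) + 4 * (real d * y) + (2 * y * D) * (4 * (real d * y))"
        by (simp add: algebra_simps)
      also have "\<dots> \<le> 1 + 10 * (y * D)" using a c by (simp add: mult.commute)
      also have "\<dots> \<le> 1 + 9600 * (k * D)" using e mult_nonneg_nonneg[OF k(1) D(2)] by linarith
      finally show ?thesis .
    qed
    \<comment> \<open>The noise budget is 8 + 10 + 16 = 34 against the allowed 80; the last summand
      uses \<open>5 * real d * x \<le> 1\<close>.\<close>
    have Kx: "(1 + 8 * x * D) * (1 + 10 * (real d * x)) \<le> 1 + 80 * (x * D)"
    proof -
      have a: "real d * x \<le> D * x" using D x by (intro mult_right_mono) auto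
      have "(8 * x * D) * (10 * (real d * x)) = (16 * (x * D)) * (5 * real d * x)" by simp
      also have "\<dots> \<le> (16 * (x * D)) * 1" using x D by (intro mult_left_mono) auto
      finally have c: "(8 * x * D) * (10 * (real d * x)) \<le> 16 * (x * D)" by simp
      have "(1 + 8 * x * D) * (1 + 10 * (real d * x)) = 1 + 8 * (x * D) + 10 * (real d * x) + (8 * x * D) * (10 * (real d * x))"
        by (simp add: algebra_simps)
      also have "\<dots> \<le> 1 + 34 * (x * D)" using a c by (simp add: mult.commute)
      also have "\<dots> \<le> 1 + 80 * (x * D)" using mult_nonneg_nonneg[OF x(1) D(2)] by linarith
      finally show ?thesis .
    qed
    have "(1 + (s' - s) * (real d + 1) / A) * (1 / q) ^ d
        \<le> ((1 + 2 * y * D) * (1 + 8 * x * D)) * ((1 + 4 * (real d * y)) * (1 + 10 * (real d * x)))"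
      using 4 q0 y x D
      by (intro mult_mono order_trans[OF 1] 2 3) (auto intro!: mult_nonneg_nonneg add_nonneg_nonneg)
    also have "\<dots> = ((1 + 2 * y * D) * (1 + 4 * (real d * y))) * ((1 + 8 * x * D) * (1 + 10 * (real d * x)))"
      by (simp only: mult_ac)
    also have "\<dots> \<le> (1 + 9600 * (k * D)) * (1 + 80 * (x * D))"
      using x y k D by (intro mult_mono Ky Kx) (auto intro!: mult_nonneg_nonneg add_nonneg_nonneg)
    finally show ?thesis by (simp add: D_def mult_ac)
  qed
  then have "(1 + (s' - s) * (real d + 1) / A) * (1 / q) ^ d * q ^ d
     \<le> (1 + 9600 * (real d + 1) * k / A) * (1 + 80 * (real d + 1) * x / A) * q ^ d"
    using q0 by (intro mult_right_mono) auto
  moreover have "(1 / q) ^ d * q ^ d = 1" using q0 by (simp add: power_mult_distrib[symmetric])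
  ultimately have coef: "1 + (s' - s) * (real d + 1) / A
     \<le> (1 + 9600 * (real d + 1) * k / A) * (1 + 80 * (real d + 1) * x / A) * q ^ d"
    by (simp only: mult.assoc mult_1_right)
  have "0 \<le> vol_coeff d s'" using vol_coeff_bounds(1)[of s' d] s ss' s'b' b d by simp
  from perturb mult_right_mono[OF coef this]
  show "vol_coeff d s \<le> (1 + 9600 * (real d + 1) * k / A) * (1 + 80 * (real d + 1) * x / A)
       * (((1 - \<eta>)\<^sup>2 * ((1 - 2 * x) / (1 + 2 * x))) ^ d * vol_coeff d s')"
    unfolding q_def by (simp only: mult.assoc)
qed

section \<open>A well-ordered copy of a finite type\<close>

typedef 'd idx = "{..<CARD('d::finite)}"
  by (rule exI[of _ 0]) simp

lemma card_idx: "CARD('d::finite idx) = CARD('d)"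
  using type_definition.card[OF type_definition_idx] by simp

instantiation idx :: (finite) linorder
begin
definition "x \<le> y \<longleftrightarrow> Rep_idx x \<le> Rep_idx y"
definition "x < y \<longleftrightarrow> Rep_idx x < Rep_idx y"
instance by standard (auto simp: less_eq_idx_def less_idx_def Rep_idx_inject)
end

instance idx :: (finite) wellorder
proof
  fix P :: "'a idx \<Rightarrow> bool" and a
  assume step: "\<And>x. (\<And>y. y < x \<Longrightarrow> P y) \<Longrightarrow> P x"
  show "P a"
    by (induction a rule: measure_induct_rule[of Rep_idx]) (auto intro: step simp: less_idx_def)
qed

instance idx :: (finite) finite
proof
  have "(UNIV :: 'a idx set) = Abs_idx ` {..<CARD('a)}"
    by (rule type_definition.univ[OF type_definition_idx])
  then show "finite (UNIV :: 'a idx set)" by (metis finite_imageI finite_lessThan)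
qed

section \<open>The theorem\<close>

text \<open>Strictness at 1 comes from the positive curvature correction; the volume coefficient
  alone can be 1, and the likelihood ratios divide by \<open>1 - q\<close>.\<close>

lemma adj_vol_coeff_bounds:
  assumes "0 < \<kappa>" "0 < r" "0 \<le> r\<xi>" "0 < 1 - (b' / 2)\<^sup>2" "0 \<le> s" "s < 2" "1 \<le> d"
  shows "0 < adj_vol_coeff d \<kappa> r\<xi> b' r s" "adj_vol_coeff d \<kappa> r\<xi> b' r s < 1"
proof -
  have M: "0 < eps_M d \<kappa> b' r" using assms by (auto simp: eps_M_def intro!: mult_pos_pos divide_pos_pos)
  have xi: "0 \<le> eps_xi d r\<xi> b' r" using assms by (auto simp: eps_xi_def intro!: mult_nonneg_nonneg divide_nonneg_nonneg)
  have q: "0 < vol_coeff d s" "vol_coeff d s \<le> 1" using vol_coeff_bounds assms by auto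
  show "0 < adj_vol_coeff d \<kappa> r\<xi> b' r s"
    unfolding adj_vol_coeff_def using M xi q by (intro mult_pos_pos) auto
  have "adj_vol_coeff d \<kappa> r\<xi> b' r s \<le> inverse (1 + eps_M d \<kappa> b' r) * 1 * 1"
    unfolding adj_vol_coeff_def using M xi q by (intro mult_mono) (auto simp: inverse_le_1_iff)
  also have "\<dots> < 1" using M by (simp add: inverse_less_1_iff)
  finally show "adj_vol_coeff d \<kappa> r\<xi> b' r s < 1" .
qed

lemma assumptions_A_AE:
  fixes \<Omega> :: "'w measure" and X \<xi> :: "'w \<Rightarrow> 'a::euclidean_space"
  assumes A: "assumptions_A TYPE('d::finite) \<Omega> X \<xi> P M V f \<kappa> r\<xi> b b' r0 r1"
  shows "AE \<omega> in \<Omega>. X \<omega> \<in> M \<and> norm (\<xi> \<omega>) \<le> r\<xi>"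
proof -
  have X [measurable]: "X \<in> borel_measurable \<Omega>" and comp: "compact M"
    and dist: "distributed \<Omega> V X (\<lambda>x. ennreal (f x))" and noise: "AE \<omega> in \<Omega>. norm (\<xi> \<omega>) \<le> r\<xi>"
    and setsV: "sets V = sets borel" and VM: "emeasure V (- M) = 0"
    using A by (auto simp: assumptions_A_def riemannian_volume_def)
  have Mb: "M \<in> sets borel" using comp by (simp add: compact_imp_closed)
  have "AE \<omega> in \<Omega>. X \<omega> \<in> M"
  proof -
    have "emeasure \<Omega> (X -` (- M) \<inter> space \<Omega>) = (\<integral>\<^sup>+z. ennreal (f z) * indicator (- M) z \<partial>V)"
      using dist Mb setsV by (intro distributed_emeasure) auto
    also have "\<dots> = 0"
    proof -
      have "- M \<in> null_sets V" using VM Mb setsV by (intro null_setsI) auto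
      then have "AE z in V. z \<notin> - M" by (rule AE_not_in)
      then have "AE z in V. ennreal (f z) * indicator (- M) z = 0" by eventually_elim auto
      then show ?thesis using nn_integral_cong_AE[of "\<lambda>z. ennreal (f z) * indicator (- M) z" "\<lambda>_. 0" V] by simp
    qed
    finally have "emeasure \<Omega> (X -` (- M) \<inter> space \<Omega>) = 0" .
    moreover have "X -` (- M) \<inter> space \<Omega> \<in> sets \<Omega>" using Mb by measurable
    ultimately show ?thesis by (intro AE_I[of _ _ "X -` (- M) \<inter> space \<Omega>"]) auto
  qed
  with noise show "AE \<omega> in \<Omega>. X \<omega> \<in> M \<and> norm (\<xi> \<omega>) \<le> r\<xi>" by eventually_elim auto
qed

text \<open>The observed centres and points are each within r\<xi> of \<open>M\<close>, so radii
  change by at most 2 r\<xi>. On \<open>M\<close> the constant density reduces probabilities to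
  Riemannian volumes, where the volume ratio applies.\<close>

lemma lens_probability_ge:
  fixes \<Omega> :: "'w measure" and X \<xi> :: "'w \<Rightarrow> 'a::euclidean_space"
  assumes A: "assumptions_A TYPE('d::finite) \<Omega> X \<xi> P M V f \<kappa> r\<xi> b b' r r" and r: "0 < r"
    and const: "f constant_on M"
    and pa: "p \<in> M" "norm (a - p) \<le> r\<xi>" and yb: "y0 \<in> M" "norm (a' - y0) \<le> r\<xi>"
    and near: "norm (a - a') \<le> b * r"
  defines "q \<equiv> adj_vol_coeff CARD('d) \<kappa> r\<xi> b' r (norm (a - a') / r)"
  shows "0 < q" "q < 1" "q * measure P (cball a r \<union> cball a' r) \<le> measure P (cball a r \<inter> cball a' r)"
proof -
  let ?d = "CARD('d)"
  interpret \<Omega>: prob_space \<Omega> using A by (simp add: assumptions_A_def)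
  have X [measurable]: "X \<in> borel_measurable \<Omega>" and \<xi> [measurable]: "\<xi> \<in> borel_measurable \<Omega>"
    and P: "P = distr \<Omega> borel (\<lambda>\<omega>. X \<omega> + \<xi> \<omega>)"
    and rv: "riemannian_volume TYPE('d) M V" and f0: "\<And>x. x \<in> M \<Longrightarrow> 0 \<le> f x"
    and dist: "distributed \<Omega> V X (\<lambda>x. ennreal (f x))" and noise: "AE \<omega> in \<Omega>. norm (\<xi> \<omega>) \<le> r\<xi>"
    and comp: "compact M" and sub: "C2_submanifold TYPE('d) M" and \<kappa>: "0 < \<kappa>"
    and reach: "ereal (1 / \<kappa>) \<le> reach M"
    and iv: "r\<xi> \<le> r / max 20 (5 * real ?d)"
    and v: "r \<le> 1 / (max 120 (sqrt (720 * real ?d)) * \<kappa>)"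
    and b: "b' < 2" "1 < b" "b \<le> b' / ((1 + 360 * \<kappa>\<^sup>2 * r\<^sup>2) * (1 + 5 * r\<xi> / r))"
    using A by (auto simp: assumptions_A_def)
  define x where "x = r\<xi> / r"
  define k where "k = (\<kappa> * r)\<^sup>2"
  have d1: "1 \<le> ?d" by (simp add: Suc_leI)
  have r\<xi>: "0 \<le> r\<xi>" using pa(2) norm_ge_zero order_trans by blast
  have xr: "r\<xi> = x * r" using r by (simp add: x_def)
  have x: "0 \<le> x" "x \<le> 1 / 20" "5 * real ?d * x \<le> 1"
  proof -
    show "0 \<le> x" using r\<xi> r by (simp add: x_def)
    have m: "x * max 20 (5 * real ?d) \<le> 1"
      using iv r by (simp add: x_def pos_le_divide_eq field_simps)
    have "x * 20 \<le> x * max 20 (5 * real ?d)" "x * (5 * real ?d) \<le> x * max 20 (5 * real ?d)"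
      using \<open>0 \<le> x\<close> by (auto intro!: mult_left_mono)
    then show "x \<le> 1 / 20" "5 * real ?d * x \<le> 1" using m by (auto simp: mult_ac)
  qed
  have kr: "\<kappa> * r * max 120 (sqrt (720 * real ?d)) \<le> 1"
    using v \<kappa> by (simp add: pos_le_divide_eq mult_ac)
  have kr0: "0 < \<kappa> * r" using \<kappa> r by simp
  have kr120: "\<kappa> * r \<le> 1 / 120"
  proof -
    have "\<kappa> * r * 120 \<le> \<kappa> * r * max 120 (sqrt (720 * real ?d))" using kr0 by (intro mult_left_mono) auto
    then show ?thesis using kr by simp
  qed
  have k: "0 \<le> k" "k \<le> 1 / 14400" "720 * real ?d * k \<le> 1"
  proof -
    show "0 \<le> k" by (simp add: k_def)
    have "k \<le> (1 / 120)\<^sup>2" unfolding k_def using kr120 kr0 by (intro power_mono) auto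
    then show "k \<le> 1 / 14400" by (simp add: power2_eq_square)
    have "\<kappa> * r * sqrt (720 * real ?d) \<le> \<kappa> * r * max 120 (sqrt (720 * real ?d))"
      using kr0 by (intro mult_left_mono) auto
    then have "\<kappa> * r * sqrt (720 * real ?d) \<le> 1" using kr by linarith
    then have "(\<kappa> * r * sqrt (720 * real ?d))\<^sup>2 \<le> 1\<^sup>2" using kr0 by (intro power_mono) auto
    then show "720 * real ?d * k \<le> 1" by (simp add: power_mult_distrib k_def mult_ac)
  qed
  have b3: "b \<le> b' / ((1 + 360 * k) * (1 + 5 * x))"
    using b(3) by (simp add: k_def x_def power_mult_distrib mult.assoc)
  define s where "s = norm (a - a') / r"
  have s: "0 \<le> s" "s \<le> b" using near r by (auto simp: s_def pos_divide_le_eq)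
  have "1 * 1 \<le> (1 + 360 * k) * (1 + 5 * x)" using k x by (intro mult_mono) auto
  then have "b * 1 \<le> b * ((1 + 360 * k) * (1 + 5 * x))" using b(2) by (intro mult_left_mono) auto
  moreover have "b * ((1 + 360 * k) * (1 + 5 * x)) \<le> b'"
    using b3 k x by (subst (asm) pos_le_divide_eq) (auto intro!: mult_pos_pos)
  ultimately have bb': "b \<le> b'" by simp
  have b'2: "0 < 1 - (b' / 2)\<^sup>2" using b bb' by (simp add: abs_square_less_1)
  have s2: "s < 2" using s bb' b by simp
  show q: "0 < q" "q < 1"
    unfolding q_def s_def[symmetric] using adj_vol_coeff_bounds[OF \<kappa> r r\<xi> b'2 s(1) s2 d1] by auto
  interpret compact_reach_submanifold M \<kappa> "TYPE('d)"
    by unfold_locales (use comp \<kappa> reach sub in auto)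
  obtain Q :: "real ^ 'd idx \<Rightarrow> 'a" where Q: "linear Q" "range Q = tangent_space M p" "\<And>x. norm (Q x) = norm x"
    by (rule tangent_isometry[OF pa(1) card_idx]) blast
  interpret tangent_projection M \<kappa> "TYPE('d)" p r Q
    by (rule tangent_projection.intro[OF compact_reach_submanifold_axioms
          tangent_projection_axioms.intro[OF pa(1) r kr120 Q card_idx]])
  \<comment> \<open>The base points are at most (s + 2 x) r apart; \<open>s'\<close> is this
    distance in units of the radius of the shrunken lens,
    \<open>(1 - \<eta>) * ((1 - 2 * x) * r)\<close>.\<close>
  define s' where "s' = (s + 2 * x) / ((1 - 300 * k) * (1 - 2 * x))"
  note coef = adjusted_coefficient_le[OF d1 s b(2) b3 b(1) x k, folded s'_def]
  have \<eta>: "\<eta> = 300 * k" by (simp add: \<eta>_def k_def)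
  have y0p: "norm (y0 - p) \<le> (s + 2 * x) * r"
  proof -
    have "norm (y0 - p) \<le> norm (y0 - a') + norm (a' - a) + norm (a - p)"
      using norm_triangle_ineq[of "y0 - a'" "a' - p"] norm_triangle_ineq[of "a' - a" "a - p"] by simp
    also have "\<dots> \<le> x * r + s * r + x * r"
      using pa yb r xr by (intro add_mono) (auto simp: s_def norm_minus_commute)
    finally show ?thesis by (simp add: algebra_simps)
  qed
  have "norm (y0 - p) \<le> 2.1 * r"
  proof -
    have "s + 2 * x \<le> 2.1" using s2 x by simp
    then have "(s + 2 * x) * r \<le> 2.1 * r" using r by (intro mult_right_mono) auto
    then show ?thesis using y0p by linarith
  qed
  moreover have "norm (y0 - p) \<le> (1 - \<eta>) * ((1 - 2 * x) * r) * s'"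
  proof -
    have "(1 - 300 * k) * (1 - 2 * x) \<noteq> 0" using k x by simp
    then have "(1 - 300 * k) * (1 - 2 * x) * s' = s + 2 * x" by (simp add: s'_def)
    moreover have "(1 - \<eta>) * ((1 - 2 * x) * r) * s' = ((1 - 300 * k) * (1 - 2 * x) * s') * r"
      unfolding \<eta> by (simp only: mult_ac)
    ultimately have "(1 - \<eta>) * ((1 - 2 * x) * r) * s' = (s + 2 * x) * r" by (simp only:)
    then show ?thesis using y0p by (simp only:)
  qed
  moreover have "0 \<le> s'" "s' < 2" using coef s b by auto
  ultimately have ratio: "ennreal (((1 - \<eta>)\<^sup>2 * ((1 - 2 * x) / (1 + 2 * x))) ^ CARD('d idx) * vol_coeff CARD('d idx) s')
       * emeasure V (M \<inter> (cball p ((1 + 2 * x) * r) \<union> cball y0 ((1 + 2 * x) * r)))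
     \<le> emeasure V (M \<inter> (cball p ((1 - 2 * x) * r) \<inter> cball y0 ((1 - 2 * x) * r)))"
    by (intro volume_ratio[OF rv yb(1) x(1,2)]) auto
  define \<rho> where "\<rho> = ((1 - \<eta>)\<^sup>2 * ((1 - 2 * x) / (1 + 2 * x))) ^ ?d * vol_coeff ?d s'"
  define Big where "Big = M \<inter> (cball p ((1 + 2 * x) * r) \<union> cball y0 ((1 + 2 * x) * r))"
  define Sml where "Sml = M \<inter> (cball p ((1 - 2 * x) * r) \<inter> cball y0 ((1 - 2 * x) * r))"
  have q\<rho>: "q \<le> \<rho>"
  proof -
    let ?M = "1 + eps_M ?d \<kappa> b' r" and ?X = "1 + eps_xi ?d r\<xi> b' r"
    have MX: "0 < ?M" "0 < ?X"
      using \<kappa> r r\<xi> by (auto simp: eps_M_def eps_xi_def intro!: add_pos_nonneg mult_nonneg_nonneg divide_nonneg_nonneg)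
    have "vol_coeff ?d s \<le> ?M * ?X * \<rho>"
      using coef(3) unfolding \<rho>_def \<eta> by (simp add: eps_M_def eps_xi_def k_def x_def power_mult_distrib mult.assoc)
    then have "inverse ?M * inverse ?X * vol_coeff ?d s \<le> inverse ?M * inverse ?X * (?M * ?X * \<rho>)"
      using MX by (intro mult_left_mono) auto
    also have "\<dots> = (inverse ?M * ?M) * (inverse ?X * ?X) * \<rho>" by (simp only: mult_ac)
    also have "\<dots> = \<rho>" using MX by simp
    finally show ?thesis by (simp add: q_def adj_vol_coeff_def s_def)
  qed
  have ratio': "ennreal \<rho> * emeasure V Big \<le> emeasure V Sml"
    using ratio unfolding \<rho>_def Big_def Sml_def by (simp only: card_idx)
  obtain c where c: "\<And>x. x \<in> M \<Longrightarrow> f x = c" using const unfolding constant_on_def by blast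
  have setsV: "sets V = sets borel" and VM: "emeasure V (- M) = 0"
    using rv by (auto simp: riemannian_volume_def)
  have Mb: "M \<in> sets borel" using comp by (simp add: compact_imp_closed)
  have bS: "Big \<in> sets borel" "Sml \<in> sets borel" unfolding Big_def Sml_def using Mb by auto
  have XB: "emeasure \<Omega> (X -` B \<inter> space \<Omega>) = ennreal c * emeasure V B" if B: "B \<in> sets borel" "B \<subseteq> M" for B
  proof -
    have "emeasure \<Omega> (X -` B \<inter> space \<Omega>) = (\<integral>\<^sup>+z. ennreal (f z) * indicator B z \<partial>V)"
      using dist B setsV by (intro distributed_emeasure) auto
    also have "\<dots> = (\<integral>\<^sup>+z. ennreal c * indicator B z \<partial>V)"
      using B c by (intro nn_integral_cong) (auto simp: indicator_def)
    also have "\<dots> = ennreal c * emeasure V B"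
      using B setsV by (simp add: nn_integral_cmult_indicator)
    finally show ?thesis .
  qed
  note AE = assumptions_A_AE[OF A]
  have Z: "(\<lambda>\<omega>. X \<omega> + \<xi> \<omega>) \<in> borel_measurable \<Omega>" by measurable
  have measP: "measure P B = \<Omega>.prob ((\<lambda>\<omega>. X \<omega> + \<xi> \<omega>) -` B \<inter> space \<Omega>)" if "B \<in> sets borel" for B
    unfolding P using Z that by (intro measure_distr) auto
  \<comment> \<open>One r\<xi> for the displacement \<open>w\<close> of the observation, one for
    that of the centre.\<close>
  have tri: "norm (z + w - a) \<le> norm (z - p) + 2 * r\<xi>" "norm (z - p) \<le> norm (z + w - a) + 2 * r\<xi>"
     "norm (z + w - a') \<le> norm (z - y0) + 2 * r\<xi>" "norm (z - y0) \<le> norm (z + w - a') + 2 * r\<xi>"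
    if "norm w \<le> r\<xi>" for z w
    using that pa(2) yb(2) norm_triangle_ineq[of "z - p" "w - (a - p)"] norm_triangle_ineq4[of w "a - p"]
      norm_triangle_ineq4[of "z + w - a" "w - (a - p)"]
      norm_triangle_ineq[of "z - y0" "w - (a' - y0)"] norm_triangle_ineq4[of w "a' - y0"]
      norm_triangle_ineq4[of "z + w - a'" "w - (a' - y0)"]
    by (auto simp: algebra_simps)
  have R12: "(1 + 2 * x) * r = r + 2 * r\<xi>" "(1 - 2 * x) * r = r - 2 * r\<xi>"
    by (auto simp: xr algebra_simps)
  have up: "measure P (cball a r \<union> cball a' r) \<le> \<Omega>.prob (X -` Big \<inter> space \<Omega>)"
  proof -
    have "AE \<omega> in \<Omega>. \<omega> \<in> (\<lambda>\<omega>. X \<omega> + \<xi> \<omega>) -` (cball a r \<union> cball a' r) \<inter> space \<Omega> \<longrightarrow> \<omega> \<in> X -` Big \<inter> space \<Omega>"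
      using AE
    proof eventually_elim
      case (elim \<omega>)
      then show ?case using tri(2,4)[of "\<xi> \<omega>" "X \<omega>"]
        by (auto simp: Big_def R12 dist_norm norm_minus_commute)
    qed
    then show ?thesis using measP[of "cball a r \<union> cball a' r"] measurable_sets[OF X bS(1)]
      by (simp add: \<Omega>.finite_measure_mono_AE)
  qed
  have low: "\<Omega>.prob (X -` Sml \<inter> space \<Omega>) \<le> measure P (cball a r \<inter> cball a' r)"
  proof -
    have "AE \<omega> in \<Omega>. \<omega> \<in> X -` Sml \<inter> space \<Omega> \<longrightarrow> \<omega> \<in> (\<lambda>\<omega>. X \<omega> + \<xi> \<omega>) -` (cball a r \<inter> cball a' r) \<inter> space \<Omega>"
      using AE
    proof eventually_elim
      case (elim \<omega>)
      then show ?case using tri(1,3)[of "\<xi> \<omega>" "X \<omega>"]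
        by (auto simp: Sml_def R12 dist_norm norm_minus_commute)
    qed
    moreover have "(\<lambda>\<omega>. X \<omega> + \<xi> \<omega>) -` (cball a r \<inter> cball a' r) \<inter> space \<Omega> \<in> sets \<Omega>"
      by (rule measurable_sets[OF Z]) auto
    ultimately show ?thesis using measP[of "cball a r \<inter> cball a' r"]
      by (simp add: \<Omega>.finite_measure_mono_AE)
  qed
  have \<rho>0: "0 \<le> \<rho>" using q q\<rho> by simp
  have "ennreal (\<rho> * \<Omega>.prob (X -` Big \<inter> space \<Omega>)) = ennreal \<rho> * (ennreal c * emeasure V Big)"
    using XB[OF bS(1)] \<rho>0 by (simp add: ennreal_mult \<Omega>.emeasure_eq_measure Big_def)
  also have "\<dots> = ennreal c * (ennreal \<rho> * emeasure V Big)" by (simp only: mult_ac)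
  also have "\<dots> \<le> ennreal c * emeasure V Sml" by (rule mult_left_mono[OF ratio']) simp
  also have "\<dots> = ennreal (\<Omega>.prob (X -` Sml \<inter> space \<Omega>))"
    using XB[OF bS(2)] by (simp add: \<Omega>.emeasure_eq_measure Sml_def)
  finally have "\<rho> * \<Omega>.prob (X -` Big \<inter> space \<Omega>) \<le> \<Omega>.prob (X -` Sml \<inter> space \<Omega>)" by simp
  moreover have "q * measure P (cball a r \<union> cball a' r) \<le> \<rho> * \<Omega>.prob (X -` Big \<inter> space \<Omega>)"
    using q q\<rho> up by (intro mult_mono) auto
  ultimately show "q * measure P (cball a r \<union> cball a' r) \<le> measure P (cball a r \<inter> cball a' r)"
    using low by linarith
qed

theorem theorem1:
  fixes \<Omega> :: "'w measure" and X \<xi> :: "'w \<Rightarrow> 'a::euclidean_space"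
    and P V :: "'a measure" and M :: "'a set" and f :: "'a \<Rightarrow> real"
    and \<kappa> r\<xi> b b' C :: real and h :: "nat \<Rightarrow> real" and K k n i j :: nat
  assumes "0 < h 0"
    and "\<And>l. 1 \<le> l \<Longrightarrow> l \<le> K \<Longrightarrow> h (l - 1) < h l"
    and "\<And>l. 1 \<le> l \<Longrightarrow> l \<le> K \<Longrightarrow> h l = b * h (l - 1)"
    and "k \<in> {1..K}"
    and "assumptions_A TYPE('d::finite) \<Omega> X \<xi> P M V f \<kappa> r\<xi> b b' (h (k - 1)) (h (k - 1))"
    and "f constant_on M"
    and "C > 0"
    and "i \<in> {1..n}" and "j \<in> {1..n}" and "i \<noteq> j"
  shows "cond_prob (Pi\<^sub>M {1..n} (\<lambda>_. P))
           (\<lambda>x. awc_stat CARD('d) \<kappa> r\<xi> b' (h (k - 1)) n x i j > C * ln (real n))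
           (\<lambda>x. norm (x i - x j) \<le> h k)
         \<le> 2 * real n powr (- C)"
proof -
  let ?r = "h (k - 1)"
  have "0 < h l" if "l \<le> K" for l
    using that
  proof (induction l)
    case (Suc l)
    then show ?case using assms(2)[of "Suc l"] by simp
  qed (use assms(1) in simp)
  then have r: "0 < ?r" using assms(4) by auto
  have hk: "h k = b * ?r" using assms(3,4) by auto
  note A = assms(5)
  interpret \<Omega>: prob_space \<Omega> using A by (simp add: assumptions_A_def)
  have X [measurable]: "X \<in> borel_measurable \<Omega>" and \<xi> [measurable]: "\<xi> \<in> borel_measurable \<Omega>"
    and P: "P = distr \<Omega> borel (\<lambda>\<omega>. X \<omega> + \<xi> \<omega>)"
    using A by (auto simp: assumptions_A_def)
  have n: "1 \<le> n" using assms(8) by auto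
  define G where "G = {a. \<exists>p\<in>M. norm (a - p) \<le> r\<xi>}"
  have "cond_prob (Pi\<^sub>M {1..n} (\<lambda>_. P))
           (\<lambda>x. C * ln (real n) < test_stat n x (no_gap_weights ?r x)
              (adj_vol_coeff CARD('d) \<kappa> r\<xi> b' ?r (norm (x i - x j) / ?r)) i j)
           (\<lambda>x. norm (x i - x j) \<le> h k) \<le> exp (- (C * ln (real n)))"
  proof (rule cond_prob_test_stat_le[where G = G and
        q = "\<lambda>a a'. adj_vol_coeff CARD('d) \<kappa> r\<xi> b' ?r (norm (a - a') / ?r)"])
    show "prob_space P" unfolding P by (rule \<Omega>.prob_space_distr) measurable
    show "sets P = sets borel" by (simp add: P)
    \<comment> \<open>The tube \<open>G\<close> is the Minkowski sum of \<open>M\<close> and a ball,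
      hence compact and Borel, so that the almost sure statement can be transferred to the
      distribution \<open>P\<close>.\<close>
    have "compact M" using A by (simp add: assumptions_A_def)
    then have "compact {p + v |p v. p \<in> M \<and> v \<in> cball 0 r\<xi>}" by (intro compact_sums compact_cball)
    also have "{p + v |p v. p \<in> M \<and> v \<in> cball 0 r\<xi>} = G"
    proof (intro equalityI subsetI)
      fix a assume "a \<in> G"
      then obtain p where p: "p \<in> M" "norm (a - p) \<le> r\<xi>" by (auto simp: G_def)
      moreover have "a = p + (a - p)" by simp
      ultimately show "a \<in> {p + v |p v. p \<in> M \<and> v \<in> cball 0 r\<xi>}"
        by (intro CollectI exI[of _ p] exI[of _ "a - p"]) simp
    qed (force simp: G_def)
    finally have "G \<in> sets borel" by (simp add: compact_imp_closed)
    moreover have "AE \<omega> in \<Omega>. X \<omega> + \<xi> \<omega> \<in> G"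
      using assumptions_A_AE[OF A] unfolding G_def by eventually_elim (force intro: bexI[of _ "X _"])
    ultimately show "AE a in P. a \<in> G" unfolding P by (subst AE_distr_iff) auto
    \<comment> \<open>The index \<open>i\<close> forces n \<ge> 1. A nonnegative threshold keeps the
      value 0 of the statistic at an empty union out of the event.\<close>
    show "0 \<le> C * ln (real n)" using assms(7) n by simp
    fix a a' assume "a \<in> G" "a' \<in> G" and "norm (a - a') \<le> h k"
    then obtain p y0 where "p \<in> M" "norm (a - p) \<le> r\<xi>" "y0 \<in> M" "norm (a' - y0) \<le> r\<xi>"
      "norm (a - a') \<le> b * ?r" unfolding G_def hk by blast
    from lens_probability_ge[OF A r assms(6) this]
    show "0 < adj_vol_coeff CARD('d) \<kappa> r\<xi> b' ?r (norm (a - a') / ?r) \<and>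
       adj_vol_coeff CARD('d) \<kappa> r\<xi> b' ?r (norm (a - a') / ?r) < 1 \<and>
       adj_vol_coeff CARD('d) \<kappa> r\<xi> b' ?r (norm (a - a') / ?r) * measure P (cball a ?r \<union> cball a' ?r)
         \<le> measure P (cball a ?r \<inter> cball a' ?r)" by blast
  qed (use assms r in auto)
  also have "exp (- (C * ln (real n))) = real n powr (- C)"
    using n by (simp add: powr_def)
  also have "\<dots> \<le> 2 * real n powr (- C)" by simp
  finally show ?thesis by (simp add: awc_stat_def)
qed

end
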